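(* Let $m_0\in\mathcal{P}(\mathbb{R}^{2d})$ and let $(\psi,\phi)$ be $m_0$-admissible weights with associated weight $m$. Let $f_0$ be a minimizer of $$\mathfrak{F}^{\psi,\phi,m_0}[f]=\|\psi f\|^2_{L^2(\mathbb{R}^d)}+\|\phi\widehat f\|^2_{L^2(\mathbb{R}^d)}$$ in $M^2_m(\mathbb{R}^d)$ subject to the constraint $\|f\|_{M^2_{m_0}(\mathbb{R}^d)}=1$. Then $f_0$ is an eigenvector of $A^{-1}$ associated with the eigenvalue $\lambda+1=\mathfrak{F}^{\psi,\phi,m_0}[f_0]+1$, which is the smallest eigenvalue of $A^{-1}$.
   Context: A weight on $\mathbb{R}^n$ is a positive continuous function. A weight $m$ is $v$-moderate if $m(x+y)\le Cm(x)v(y)$ for all $x,y$ and some $C>0$. $\mathcal{P}(\mathbb{R}^n)$ is the set of weights that are $v$-moderate for some polynomial weight $v$. $L^\infty_0(\mathbb{R}^n)$ is the set of $h\in L^\infty(\mathbb{R}^n)$ with $\lim_{R\to\infty}\operatorname{ess\,sup}_{|z|\ge R}|h(z)|=0$. Given $m_0\in\mathcal{P}(\mathbb{R}^{2d})$, a pair of continuous functions $\psi,\phi\in L^\infty_{loc}(\mathbb{R}^d)$ is called $m_0$-admissible weights if $m(x,\omega)=\sqrt{|m_0(x,\omega)|^2+|\psi(x)|^2+|\phi(\omega)|^2}$ satisfies $m\in\mathcal{P}(\mathbb{R}^{2d})$ and $m_0/m\in L^\infty_0(\mathbb{R}^{2d})$. The Fourier transform is $\widehat f(\omega)=\int f(x)e^{-2\pi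 ix\cdot\omega}dx$. Fix $g\in\mathcal{S}(\mathbb{R}^d)\setminus\{0\}$ and let $V_gf(x,\omega)=\int_{\mathbb{R}^d}f(t)\overline{g(t-x)}e^{-2\pi it\cdot\omega}dt$ (extended to $\mathcal S'$ by duality). For $\mu\in\mathcal{P}(\mathbb{R}^{2d})$, $M^2_\mu(\mathbb{R}^d)$ is the space of $f\in\mathcal{S}'(\mathbb{R}^d)$ with $\|f\|_{M^2_\mu}=\left(\int_{\mathbb{R}^{2d}}|\mu(z)V_gf(z)|^2dz\right)^{1/2}<\infty$, with inner product $(u,v)_{M^2_\mu}=\int_{\mathbb{R}^{2d}}\mu(z)^2V_gu(z)\overline{V_gv(z)}dz$. The space $M^2_m(\mathbb{R}^d)$ is regarded as a Hilbert space with the inner product $$(u,v)_{\psi,\phi,m_0}=(u,v)_{M^2_{m_0}}+\int_{\mathbb{R}^d}|\psi(x)|^2u(x)\overline{v(x)}dx+\int_{\mathbb{R}^d}|\phi(\omega)|^2\widehat u(\omega)\overline{\widehat v(\omega)}d\omega,$$ whose norm $\|\cdot\|_{\psi,\phi,m_0}$ is equivalent to $\|\cdot\|_{M^2_m}$. The operator $A:M^2_m(\mathbb{R}^d)\to M^2_m(\mathbb{R}^d)$ is the bounded linear operator (given by the Riesz representation theorem) such that $(u,v)_{M^2_{m_0}}=(Au,v)_{\psi,\phi,m_0}$ for all $u,v\in M^2_m(\mathbb{R}^d)$. It is injective, and $A^{-1}$ denotes its inverse, with domain $\mathrm{Ran}(A)$. *)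

theory Defs
  imports "HOL-Analysis.Analysis" "HOL-Probability.Essential_Supremum"
begin

section \<open>Weights\<close>

definition weight :: "('a::euclidean_space \<Rightarrow> real) \<Rightarrow> bool" where
  "weight m \<longleftrightarrow> continuous_on UNIV m \<and> (\<forall>x. 0 < m x)"

definition moderate :: "('a::euclidean_space \<Rightarrow> real) \<Rightarrow> ('a \<Rightarrow> real) \<Rightarrow> bool" where
  "moderate v m \<longleftrightarrow> (\<exists>C>0. \<forall>x y. m (x + y) \<le> C * m x * v y)"

definition poly_weight :: "real \<Rightarrow> 'a::euclidean_space \<Rightarrow> real" where
  "poly_weight s x = (1 + norm x) powr s"

definition poly_moderate_weights :: "('a::euclidean_space \<Rightarrow> real) set" where
  "poly_moderate_weights = {m. weight m \<and> (\<exists>s\<ge>0. moderate (poly_weight s) m)}"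

definition Linf :: "('a::euclidean_space \<Rightarrow> complex) set" where
  "Linf = {h. h \<in> borel_measurable lborel \<and> esssup lborel (\<lambda>x. ereal (norm (h x))) < \<infinity>}"

definition Linf_loc :: "('a::euclidean_space \<Rightarrow> complex) set" where
  "Linf_loc = {h. h \<in> borel_measurable lborel \<and>
     (\<forall>K. compact K \<longrightarrow> esssup (restrict_space lborel K) (\<lambda>x. ereal (norm (h x))) < \<infinity>)}"

definition Linf_0 :: "('a::euclidean_space \<Rightarrow> complex) set" where
  "Linf_0 = {h \<in> Linf.
     ((\<lambda>R. esssup (restrict_space lborel {z. R \<le> norm z}) (\<lambda>z. ereal (norm (h z)))) \<longlongrightarrow> 0) at_top}"

definition assoc_weight ::
  "('a::euclidean_space \<times> 'a \<Rightarrow> real) \<Rightarrow> ('a \<Rightarrow> complex) \<Rightarrow> ('a \<Rightarrow> complex) \<Rightarrow> 'a \<times> 'a \<Rightarrow> real" where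
  "assoc_weight m0 \<psi> \<phi> =
     (\<lambda>(x, \<omega>). sqrt (\<bar>m0 (x, \<omega>)\<bar>\<^sup>2 + (norm (\<psi> x))\<^sup>2 + (norm (\<phi> \<omega>))\<^sup>2))"

definition admissible_weights ::
  "('a::euclidean_space \<times> 'a \<Rightarrow> real) \<Rightarrow> ('a \<Rightarrow> complex) \<Rightarrow> ('a \<Rightarrow> complex) \<Rightarrow> bool" where
  "admissible_weights m0 \<psi> \<phi> \<longleftrightarrow>
     continuous_on UNIV \<psi> \<and> \<psi> \<in> Linf_loc \<and>
     continuous_on UNIV \<phi> \<and> \<phi> \<in> Linf_loc \<and>
     assoc_weight m0 \<psi> \<phi> \<in> poly_moderate_weights \<and>
     (\<lambda>z. complex_of_real (m0 z / assoc_weight m0 \<psi> \<phi> z)) \<in> Linf_0"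

section \<open>Schwartz functions and tempered distributions\<close>

text \<open>Iterated partial derivative along a list of basis vectors.\<close>

primrec iter_deriv :: "'a::euclidean_space list \<Rightarrow> ('a \<Rightarrow> complex) \<Rightarrow> 'a \<Rightarrow> complex" where
  "iter_deriv [] f = f"
| "iter_deriv (b # bs) f = (\<lambda>x. frechet_derivative (iter_deriv bs f) (at x) b)"

definition schwartz :: "('a::euclidean_space \<Rightarrow> complex) set" where
  "schwartz = {f. \<forall>bs \<in> lists Basis. iter_deriv bs f differentiable_on UNIV \<and>
     (\<forall>N::nat. bdd_above (range (\<lambda>x. (1 + norm x) ^ N * norm (iter_deriv bs f x))))}"

definition schwartz_norm :: "nat \<Rightarrow> ('a::euclidean_space \<Rightarrow> complex) \<Rightarrow> real" where
  "schwartz_norm N f = (\<Sum>bs | set bs \<subseteq> Basis \<and> length bs \<le> N.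
     (SUP x. (1 + norm x) ^ N * norm (iter_deriv bs f x)))"

text \<open>Tempered distributions are complex-linear (not antilinear) functionals on Schwartz functions,
  continuous for the Frechet topology of the above norms.  They are represented by total functions
  that are 0 outside \<open>schwartz\<close>, so that equality of distributions is equality of functions.\<close>

type_synonym 'a functional = "('a \<Rightarrow> complex) \<Rightarrow> complex"

definition tempered :: "'a::euclidean_space functional set" where
  "tempered = {u.
     (\<forall>f. f \<notin> schwartz \<longrightarrow> u f = 0) \<and>
     (\<forall>f\<in>schwartz. \<forall>h\<in>schwartz. \<forall>a b. u (\<lambda>x. a * f x + b * h x) = a * u f + b * u h) \<and>
     (\<exists>C N. \<forall>f\<in>schwartz. norm (u f) \<le> C * schwartz_norm N f)}"

definition lincomb ::
  "complex \<Rightarrow> 'a functional \<Rightarrow> complex \<Rightarrow> 'a functional \<Rightarrow> 'a functional" where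
  "lincomb a u b v = (\<lambda>f. a * u f + b * v f)"

definition fourier :: "('a::euclidean_space \<Rightarrow> complex) \<Rightarrow> 'a \<Rightarrow> complex" where
  "fourier f \<omega> = (\<integral>x. f x * cis (- 2 * pi * (x \<bullet> \<omega>)) \<partial>lborel)"

definition fourier_dist :: "'a::euclidean_space functional \<Rightarrow> 'a functional" where
  "fourier_dist u = (\<lambda>f. if f \<in> schwartz then u (fourier f) else 0)"

definition represents :: "('a::euclidean_space \<Rightarrow> complex) \<Rightarrow> 'a functional \<Rightarrow> bool" where
  "represents h u \<longleftrightarrow> h \<in> borel_measurable lborel \<and>
     (\<forall>f\<in>schwartz. integrable lborel (\<lambda>x. h x * f x) \<and> u f = (\<integral>x. h x * f x \<partial>lborel))"

text \<open>The pointwise values \<open>u x\<close> of a distribution that is given by a function (unique up to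
  null sets); the value is irrelevant if there is no such function.\<close>

definition dist_fun :: "'a::euclidean_space functional \<Rightarrow> 'a \<Rightarrow> complex" where
  "dist_fun u = (SOME h. represents h u)"

section \<open>Modulation spaces\<close>

text \<open>For a function \<open>u\<close> this is \<open>\<integral> u(t) cnj (g (t - x)) exp (- 2 \<pi> i t \<bullet> \<omega>) dt\<close>.\<close>

definition stft ::
  "('a::euclidean_space \<Rightarrow> complex) \<Rightarrow> 'a functional \<Rightarrow> 'a \<times> 'a \<Rightarrow> complex" where
  "stft g u = (\<lambda>(x, \<omega>). u (\<lambda>t. cnj (g (t - x)) * cis (- 2 * pi * (t \<bullet> \<omega>))))"

definition mod_space ::
  "('a::euclidean_space \<Rightarrow> complex) \<Rightarrow> ('a \<times> 'a \<Rightarrow> real) \<Rightarrow> 'a functional set" where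
  "mod_space g \<mu> = {u \<in> tempered. integrable lborel (\<lambda>z. (norm (\<mu> z * stft g u z))\<^sup>2)}"

definition mod_norm ::
  "('a::euclidean_space \<Rightarrow> complex) \<Rightarrow> ('a \<times> 'a \<Rightarrow> real) \<Rightarrow> 'a functional \<Rightarrow> real" where
  "mod_norm g \<mu> u = sqrt (\<integral>z. (norm (\<mu> z * stft g u z))\<^sup>2 \<partial>lborel)"

definition mod_inner ::
  "('a::euclidean_space \<Rightarrow> complex) \<Rightarrow> ('a \<times> 'a \<Rightarrow> real) \<Rightarrow> 'a functional \<Rightarrow> 'a functional \<Rightarrow> complex" where
  "mod_inner g \<mu> u v = (\<integral>z. (\<mu> z)\<^sup>2 * stft g u z * cnj (stft g v z) \<partial>lborel)"

section \<open>The confinement functional and the operator\<close>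

text \<open>Let \<open>m = assoc_weight m0 \<psi> \<phi>\<close> be a moderate weight and \<open>u \<in> mod_space g m\<close>.  If \<open>\<psi>\<close> is not
  identically zero, then \<open>u\<close> is a function with \<open>\<psi> u\<close> square integrable, so the terms below are
  genuine.  If \<open>\<psi>\<close> vanishes identically, then \<open>u\<close> need not be a function; the product \<open>\<psi> u\<close> is zero
  and so are the terms below.  The same holds for \<open>\<phi>\<close> and the Fourier transform of \<open>u\<close>.\<close>

definition confinement ::
  "('a::euclidean_space \<Rightarrow> complex) \<Rightarrow> ('a \<Rightarrow> complex) \<Rightarrow> 'a functional \<Rightarrow> real" where
  "confinement \<psi> \<phi> u =
     (\<integral>x. (norm (\<psi> x * dist_fun u x))\<^sup>2 \<partial>lborel) +
     (\<integral>\<omega>. (norm (\<phi> \<omega> * dist_fun (fourier_dist u) \<omega>))\<^sup>2 \<partial>lborel)"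

definition conf_inner ::
  "('a::euclidean_space \<Rightarrow> complex) \<Rightarrow> ('a \<Rightarrow> complex) \<Rightarrow> ('a \<Rightarrow> complex) \<Rightarrow> ('a \<times> 'a \<Rightarrow> real) \<Rightarrow>
     'a functional \<Rightarrow> 'a functional \<Rightarrow> complex" where
  "conf_inner g \<psi> \<phi> m0 u v = mod_inner g m0 u v +
     (\<integral>x. (norm (\<psi> x))\<^sup>2 * dist_fun u x * cnj (dist_fun v x) \<partial>lborel) +
     (\<integral>\<omega>. (norm (\<phi> \<omega>))\<^sup>2 * dist_fun (fourier_dist u) \<omega> * cnj (dist_fun (fourier_dist v) \<omega>) \<partial>lborel)"

definition conf_norm ::
  "('a::euclidean_space \<Rightarrow> complex) \<Rightarrow> ('a \<Rightarrow> complex) \<Rightarrow> ('a \<Rightarrow> complex) \<Rightarrow> ('a \<times> 'a \<Rightarrow> real) \<Rightarrow>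
     'a functional \<Rightarrow> real" where
  "conf_norm g \<psi> \<phi> m0 u = sqrt (Re (conf_inner g \<psi> \<phi> m0 u u))"

text \<open>The bounded linear operator \<open>A\<close> on \<open>M = mod_space g (assoc_weight m0 \<psi> \<phi>)\<close> that the Riesz
  theorem associates with the form \<open>mod_inner g m0\<close>; these conditions determine \<open>A\<close> on \<open>M\<close>.\<close>

definition riesz_operator ::
  "('a::euclidean_space \<Rightarrow> complex) \<Rightarrow> ('a \<Rightarrow> complex) \<Rightarrow> ('a \<Rightarrow> complex) \<Rightarrow> ('a \<times> 'a \<Rightarrow> real) \<Rightarrow>
     ('a functional \<Rightarrow> 'a functional) \<Rightarrow> bool" where
  "riesz_operator g \<psi> \<phi> m0 A \<longleftrightarrow> (let M = mod_space g (assoc_weight m0 \<psi> \<phi>) in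
     (\<forall>u\<in>M. A u \<in> M) \<and>
     (\<forall>u\<in>M. \<forall>v\<in>M. \<forall>a b. A (lincomb a u b v) = lincomb a (A u) b (A v)) \<and>
     (\<exists>C. \<forall>u\<in>M. conf_norm g \<psi> \<phi> m0 (A u) \<le> C * conf_norm g \<psi> \<phi> m0 u) \<and>
     (\<forall>u\<in>M. \<forall>v\<in>M. mod_inner g m0 u v = conf_inner g \<psi> \<phi> m0 (A u) v))"

text \<open>Eigenvectors of an operator \<open>T\<close> with domain \<open>D\<close>.\<close>

definition eigenvector ::
  "'a functional set \<Rightarrow> ('a functional \<Rightarrow> 'a functional) \<Rightarrow> complex \<Rightarrow> 'a functional \<Rightarrow> bool" where
  "eigenvector D T \<mu> u \<longleftrightarrow> u \<in> D \<and> u \<noteq> (\<lambda>_. 0) \<and> T u = (\<lambda>f. \<mu> * u f)"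

definition eigenvalue ::
  "'a functional set \<Rightarrow> ('a functional \<Rightarrow> 'a functional) \<Rightarrow> complex \<Rightarrow> bool" where
  "eigenvalue D T \<mu> \<longleftrightarrow> (\<exists>u. eigenvector D T \<mu> u)"

end

theory Submission
  imports Defs "HOL-Probability.Characteristic_Functions" "HOL-Probability.Sinc_Integral"
begin

text \<open>
  On the modulation space \<open>M\<close> the inner product \<open>conf_inner\<close> is the sum of \<open>mod_inner\<close> and of the form
  whose diagonal is the confinement functional. Let \<open>\<lambda>\<close> be the minimum. By homogeneity, minimality of
  \<open>f0\<close> means that the Hermitian form \<open>conf_inner - (\<lambda> + 1) mod_inner\<close> is nonnegative on the diagonal of
  \<open>M\<close>; it vanishes at \<open>f0\<close>, so \<open>f0\<close> lies in its kernel. By the definition of \<open>A\<close> this says that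
  \<open>f0 - (\<lambda> + 1) A f0\<close> is orthogonal to \<open>M\<close>, hence zero. Conversely, if \<open>u = \<mu> A u\<close> with \<open>u \<noteq> 0\<close>, then
  \<open>\<mu>\<close> is one plus the quotient of the confinement of \<open>u\<close> by its squared norm, which is at least
  \<open>1 + \<lambda>\<close>. This is \<open>minimizer_is_ground_state\<close>.

  The analysis has to supply that \<open>mod_inner\<close> is definite and that \<open>conf_inner\<close> is sesquilinear on \<open>M\<close>.
  Both follow from the reproducing formula \<open>stft_reproducing\<close>: for a tempered distribution \<open>u\<close> and a
  Schwartz function \<open>f\<close>, the value \<open>u f\<close> is, up to the energy of the window, the integral of the
  short-time Fourier transform of \<open>u\<close> against a rapidly decaying transform of \<open>f\<close>. For functions this is
  Fourier inversion; \<open>tempered_superposition\<close> allows \<open>u\<close> to be applied under the integral sign.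
  Definiteness is immediate.

  Sesquilinearity is the harder point, since the confinement terms refer to the pointwise values of
  \<open>u\<close> and of its Fourier transform. Suppose that \<open>\<psi>\<close> does not vanish identically. Then the infimum
  \<open>p x\<close> of the weight over all frequencies is a positive moderate weight that dominates \<open>\<bar>\<psi>\<bar>\<close>
  (\<open>marginal_weight\<close>), and the transform of \<open>u\<close> times \<open>p\<close> is square integrable. Synthesis from the
  transform, with the Bessel inequality in the frequency and a Schur estimate in the position, then
  produces a function \<open>h\<close> that represents \<open>u\<close> and for which \<open>p h\<close> is square integrable
  (\<open>L2_representation\<close>). The same argument applies to the Fourier transform of \<open>u\<close>: with the Fourier
  transform of \<open>g\<close> as the window, its short-time Fourier transform is that of \<open>u\<close> on the rotated phase
  space, up to a phase factor (\<open>stft_dual_fourier_rotation\<close>). Functions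
  that represent the same distribution agree almost everywhere (\<open>schwartz_annihilator\<close>), so pointwise
  values depend linearly on the distribution up to null sets.
\<close>

section \<open>Smooth functions with bounds on all derivatives\<close>

text \<open>The step of the recursion for iterated derivatives, so that the iterated derivative along
  \<open>b # bs\<close> is \<open>pd b\<close> of the one along \<open>bs\<close>.\<close>

definition pd :: "'a::euclidean_space \<Rightarrow> ('a \<Rightarrow> complex) \<Rightarrow> 'a \<Rightarrow> complex" where
  "pd b f = (\<lambda>x. frechet_derivative f (at x) b)"

lemma has_derivative_pd:
  fixes f :: "'a::euclidean_space \<Rightarrow> complex"
  assumes "f differentiable (at x)"
  shows "(f has_derivative (\<lambda>h. \<Sum>b\<in>Basis. (h \<bullet> b) *\<^sub>R pd b f x)) (at x)"
proof -
  let ?D = "frechet_derivative f (at x)"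
  have D: "(f has_derivative ?D) (at x)"
    using assms by (simp add: frechet_derivative_works)
  interpret D: linear ?D
    using D by (rule has_derivative_linear)
  have "?D h = (\<Sum>b\<in>Basis. (h \<bullet> b) *\<^sub>R pd b f x)" for h
  proof -
    have "?D h = ?D (\<Sum>b\<in>Basis. (h \<bullet> b) *\<^sub>R b)"
      by (simp add: euclidean_representation)
    also have "\<dots> = (\<Sum>b\<in>Basis. (h \<bullet> b) *\<^sub>R ?D b)"
      by (simp add: D.sum D.scale)
    finally show ?thesis by (simp add: pd_def)
  qed
  then have "?D = (\<lambda>h. \<Sum>b\<in>Basis. (h \<bullet> b) *\<^sub>R pd b f x)" by auto
  with D show ?thesis by simp
qed

lemma pd_eq: "(\<And>x. (f has_derivative D x) (at x)) \<Longrightarrow> pd b f = (\<lambda>x. D x b)"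
  unfolding pd_def using frechet_derivative_at by metis

lemma diff_on_UNIV_iff: "f differentiable_on UNIV \<longleftrightarrow> (\<forall>x. f differentiable (at x))"
  by (simp add: differentiable_on_def)

text \<open>One definition covers Schwartz functions (\<open>B\<close> is rapid decay), smooth functions of polynomial
  growth, and families that are Schwartz in one variable and grow polynomially in a parameter.\<close>

definition smooth_class :: "(('a::euclidean_space \<Rightarrow> complex) \<Rightarrow> bool) \<Rightarrow> ('a \<Rightarrow> complex) set" where
  "smooth_class B = {f. \<forall>bs \<in> lists Basis. iter_deriv bs f differentiable_on UNIV \<and> B (iter_deriv bs f)}"

lemma iter_deriv_Cons_pd: "iter_deriv (b # bs) f = pd b (iter_deriv bs f)"
  by (simp add: pd_def)

text \<open>A smooth class is the largest set of functions that are differentiable, satisfy \<open>B\<close>, and whose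
  first partial derivatives stay in the set. Membership is therefore shown by exhibiting a set that is
  closed under \<open>pd\<close>, which involves first derivatives only.\<close>

lemma smooth_class_coinduct:
  assumes "f \<in> X"
    and X: "\<And>f. f \<in> X \<Longrightarrow> f differentiable_on UNIV" "\<And>f. f \<in> X \<Longrightarrow> B f"
      "\<And>f b. f \<in> X \<Longrightarrow> b \<in> Basis \<Longrightarrow> pd b f \<in> X"
  shows "f \<in> smooth_class B"
proof -
  have "iter_deriv bs f \<in> X" if "bs \<in> lists Basis" for bs
    using that
  proof (induction bs)
    case Nil
    then show ?case using assms(1) by simp
  next
    case (Cons b bs)
    then show ?case using X(3)[of "iter_deriv bs f" b] by (simp add: pd_def)
  qed
  then show ?thesis using X(1,2) by (auto simp: smooth_class_def)
qed

lemma smooth_class_iter: "f \<in> smooth_class B \<Longrightarrow> bs \<in> lists Basis \<Longrightarrow> iter_deriv bs f \<in> smooth_class B"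
proof -
  have "iter_deriv cs (iter_deriv bs f) = iter_deriv (cs @ bs) f" for cs
    by (induction cs) auto
  then show "f \<in> smooth_class B \<Longrightarrow> bs \<in> lists Basis \<Longrightarrow> iter_deriv bs f \<in> smooth_class B"
    unfolding smooth_class_def by auto
qed

lemma smooth_classD:
  assumes "f \<in> smooth_class B"
  shows smooth_class_diff: "f differentiable_on UNIV" and smooth_class_bound: "B f"
    and smooth_class_pd: "b \<in> Basis \<Longrightarrow> pd b f \<in> smooth_class B"
proof -
  show "f differentiable_on UNIV" "B f"
    using assms by (auto simp: smooth_class_def dest: bspec[of _ _ "[]"])
  show "pd b f \<in> smooth_class B" if "b \<in> Basis"
    using smooth_class_iter[OF assms, of "[b]"] that by (simp add: pd_def)
qed

lemma smooth_class_has_derivative: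
  assumes "f \<in> smooth_class B"
  shows "(f has_derivative (\<lambda>h. \<Sum>b\<in>Basis. (h \<bullet> b) *\<^sub>R pd b f x)) (at x)"
  using has_derivative_pd smooth_class_diff[OF assms] by (auto simp: diff_on_UNIV_iff)

lemma smooth_class_continuous:
  assumes "f \<in> smooth_class B" shows "continuous_on UNIV f"
  using smooth_class_diff[OF assms] by (rule differentiable_imp_continuous_on)

lemma smooth_class_measurable [measurable_dest]:
  assumes "f \<in> smooth_class B" shows "f \<in> borel_measurable borel"
  using smooth_class_continuous[OF assms] by (rule borel_measurable_continuous_onI)

lemma differentiable_onI_UNIV:
  "(\<And>x. (f has_derivative D x) (at x)) \<Longrightarrow> f differentiable_on UNIV"
  by (auto simp: diff_on_UNIV_iff differentiable_def)

definition additive_class :: "(('a::euclidean_space \<Rightarrow> complex) \<Rightarrow> bool) \<Rightarrow> bool" where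
  "additive_class B \<longleftrightarrow> (\<forall>f h. B f \<longrightarrow> B h \<longrightarrow> B (\<lambda>x. f x + h x)) \<and> (\<forall>f c. B f \<longrightarrow> B (\<lambda>x. c * f x))"

lemma smooth_class_add:
  assumes "additive_class B" "f \<in> smooth_class B" "h \<in> smooth_class B"
  shows "(\<lambda>x. f x + h x) \<in> smooth_class B"
proof (rule smooth_class_coinduct[where X = "{(\<lambda>x. f x + h x) |f h. f \<in> smooth_class B \<and> h \<in> smooth_class B}"])
  show "(\<lambda>x. f x + h x) \<in> {(\<lambda>x. f x + h x) |f h. f \<in> smooth_class B \<and> h \<in> smooth_class B}"
    using assms by blast
next
  fix p assume "p \<in> {(\<lambda>x. f x + h x) |f h. f \<in> smooth_class B \<and> h \<in> smooth_class B}"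
  then obtain f h where p: "p = (\<lambda>x. f x + h x)" and fh: "f \<in> smooth_class B" "h \<in> smooth_class B" by blast
  have D: "(p has_derivative (\<lambda>k. (\<Sum>b\<in>Basis. (k \<bullet> b) *\<^sub>R pd b f x) + (\<Sum>b\<in>Basis. (k \<bullet> b) *\<^sub>R pd b h x))) (at x)" for x
    unfolding p by (intro has_derivative_add smooth_class_has_derivative[OF fh(1)] smooth_class_has_derivative[OF fh(2)])
  show "p differentiable_on UNIV" by (rule differentiable_onI_UNIV[OF D])
  show "B p" using assms(1) fh[THEN smooth_class_bound] by (auto simp: p additive_class_def)
  fix b :: 'a assume b: "b \<in> Basis"
  have "pd b p = (\<lambda>x. pd b f x + pd b h x)"
    unfolding pd_eq[OF D] using b by (auto simp: inner_Basis if_distrib if_distribR cong: if_cong)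
  then show "pd b p \<in> {(\<lambda>x. f x + h x) |f h. f \<in> smooth_class B \<and> h \<in> smooth_class B}"
    using fh[THEN smooth_class_pd, OF b] by blast
qed

lemma smooth_class_cmult:
  assumes "additive_class B" "f \<in> smooth_class B"
  shows "(\<lambda>x. c * f x) \<in> smooth_class B"
proof (rule smooth_class_coinduct[where X = "{(\<lambda>x. c * f x) |f. f \<in> smooth_class B}"])
  show "(\<lambda>x. c * f x) \<in> {(\<lambda>x. c * f x) |f. f \<in> smooth_class B}"
    using assms by blast
next
  fix p assume "p \<in> {(\<lambda>x. c * f x) |f. f \<in> smooth_class B}"
  then obtain f where p: "p = (\<lambda>x. c * f x)" and f: "f \<in> smooth_class B" by blast
  have D: "(p has_derivative (\<lambda>k. c * (\<Sum>b\<in>Basis. (k \<bullet> b) *\<^sub>R pd b f x))) (at x)" for x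
    unfolding p by (intro has_derivative_mult_right smooth_class_has_derivative[OF f])
  show "p differentiable_on UNIV" by (rule differentiable_onI_UNIV[OF D])
  show "B p" using assms(1) f[THEN smooth_class_bound] by (auto simp: p additive_class_def)
  fix b :: 'a assume b: "b \<in> Basis"
  have "pd b p = (\<lambda>x. c * pd b f x)"
    unfolding pd_eq[OF D] using b by (auto simp: inner_Basis if_distrib if_distribR cong: if_cong)
  then show "pd b p \<in> {(\<lambda>x. c * f x) |f. f \<in> smooth_class B}"
    using f[THEN smooth_class_pd, OF b] by blast
qed

lemma smooth_class_sum:
  assumes "additive_class B" "finite I" "I \<noteq> {}" "\<And>i. i \<in> I \<Longrightarrow> f i \<in> smooth_class B"
  shows "(\<lambda>x. \<Sum>i\<in>I. f i x) \<in> smooth_class B"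
  using assms(2-4)
proof (induction I rule: finite_ne_induct)
  case (insert i I)
  then show ?case
    using smooth_class_add[OF assms(1), of "f i" "\<lambda>x. \<Sum>i\<in>I. f i x"] by (simp add: insert)
qed simp

text \<open>The Leibniz rule turns a product into a sum of two products; this span is the smallest set that
  contains the products and absorbs such sums.\<close>

inductive_set prod_span :: "('a \<Rightarrow> complex) set \<Rightarrow> ('a \<Rightarrow> complex) set \<Rightarrow> ('a \<Rightarrow> complex) set" for F H where
  "f \<in> F \<Longrightarrow> h \<in> H \<Longrightarrow> (\<lambda>x. f x * h x) \<in> prod_span F H"
| "p \<in> prod_span F H \<Longrightarrow> q \<in> prod_span F H \<Longrightarrow> (\<lambda>x. p x + q x) \<in> prod_span F H"

lemma smooth_class_mult:
  assumes B: "\<And>f h. B1 f \<Longrightarrow> B2 h \<Longrightarrow> B3 (\<lambda>x. f x * h x)" and add: "additive_class B3"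
    and f: "f \<in> smooth_class B1" and h: "h \<in> smooth_class B2"
  shows "(\<lambda>x. f x * h x) \<in> smooth_class B3"
proof -
  let ?X = "prod_span (smooth_class B1) (smooth_class B2)"
  have *: "p differentiable_on UNIV \<and> B3 p \<and> (\<forall>b\<in>Basis. pd b p \<in> ?X)" if "p \<in> ?X" for p
    using that
  proof (induction rule: prod_span.induct)
    case (1 f h)
    let ?p = "\<lambda>x. f x * h x"
    have D: "(?p has_derivative (\<lambda>k. f x * (\<Sum>b\<in>Basis. (k \<bullet> b) *\<^sub>R pd b h x) + (\<Sum>b\<in>Basis. (k \<bullet> b) *\<^sub>R pd b f x) * h x)) (at x)" for x
      by (intro has_derivative_mult smooth_class_has_derivative[OF 1(1)] smooth_class_has_derivative[OF 1(2)])
    have "pd b ?p = (\<lambda>x. f x * pd b h x + pd b f x * h x)" if "b \<in> Basis" for b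
      unfolding pd_eq[OF D] using that by (auto simp: inner_Basis if_distrib if_distribR cong: if_cong)
    moreover have "(\<lambda>x. f x * pd b h x + pd b f x * h x) \<in> ?X" if "b \<in> Basis" for b
      by (intro prod_span.intros 1 smooth_class_pd that)
    ultimately show ?case
      using differentiable_onI_UNIV[OF D] B[OF 1[THEN smooth_class_bound]] by auto
  next
    case (2 p q)
    let ?r = "\<lambda>x. p x + q x"
    have D: "(?r has_derivative (\<lambda>k. (\<Sum>b\<in>Basis. (k \<bullet> b) *\<^sub>R pd b p x) + (\<Sum>b\<in>Basis. (k \<bullet> b) *\<^sub>R pd b q x))) (at x)" for x
      using 2 by (intro has_derivative_add has_derivative_pd) (auto simp: diff_on_UNIV_iff)
    have "pd b ?r = (\<lambda>x. pd b p x + pd b q x)" if "b \<in> Basis" for b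
      unfolding pd_eq[OF D] using that by (auto simp: inner_Basis if_distrib if_distribR cong: if_cong)
    moreover have "B3 ?r" using add 2 by (auto simp: additive_class_def)
    ultimately show ?case
      using differentiable_onI_UNIV[OF D] 2 by (auto intro: prod_span.intros)
  qed
  show ?thesis
    by (rule smooth_class_coinduct[where X = ?X]) (use * f h in \<open>auto intro: prod_span.intros\<close>)
qed

lemma smooth_class_dir:
  assumes "additive_class B" "f \<in> smooth_class B"
  shows "(\<lambda>x. \<Sum>c\<in>Basis. (v \<bullet> c) *\<^sub>R pd c f x) \<in> smooth_class B"
  unfolding scaleR_conv_of_real
  by (intro smooth_class_sum smooth_class_cmult smooth_class_pd assms) auto

lemma smooth_class_compose:
  fixes l :: "'b::euclidean_space \<Rightarrow> 'a::euclidean_space"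
  assumes l: "bounded_linear l" and add: "additive_class B"
    and B: "\<And>f. B f \<Longrightarrow> B' (\<lambda>x. f (a + l x))"
    and f: "f \<in> smooth_class B"
  shows "(\<lambda>x. f (a + l x)) \<in> smooth_class B'"
proof (rule smooth_class_coinduct[where X = "{(\<lambda>x. f (a + l x)) |f. f \<in> smooth_class B}"])
  show "(\<lambda>x. f (a + l x)) \<in> {(\<lambda>x. f (a + l x)) |f. f \<in> smooth_class B}" using f by blast
next
  fix p assume "p \<in> {(\<lambda>x. f (a + l x)) |f. f \<in> smooth_class B}"
  then obtain f where p: "p = (\<lambda>x. f (a + l x))" and f: "f \<in> smooth_class B" by blast
  have "((\<lambda>x. a + l x) has_derivative l) (at x)" for x
    by (auto intro!: derivative_eq_intros bounded_linear_imp_has_derivative[OF l])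
  then have D: "(p has_derivative (\<lambda>k. \<Sum>c\<in>Basis. (l k \<bullet> c) *\<^sub>R pd c f (a + l x))) (at x)" for x
    unfolding p by (rule has_derivative_compose) (rule smooth_class_has_derivative[OF f])
  show "p differentiable_on UNIV" by (rule differentiable_onI_UNIV[OF D])
  show "B' p" unfolding p by (intro B smooth_class_bound[OF f])
  fix b :: 'b assume b: "b \<in> Basis"
  have "pd b p = (\<lambda>x. (\<lambda>y. \<Sum>c\<in>Basis. (l b \<bullet> c) *\<^sub>R pd c f y) (a + l x))"
    unfolding pd_eq[OF D] by simp
  then show "pd b p \<in> {(\<lambda>x. f (a + l x)) |f. f \<in> smooth_class B}"
    using smooth_class_dir[OF add f, of "l b"]
    by (intro CollectI exI[of _ "\<lambda>y. \<Sum>c\<in>Basis. (l b \<bullet> c) *\<^sub>R pd c f y"] conjI)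
qed

lemma smooth_class_cnj:
  assumes B: "\<And>f. B f \<Longrightarrow> B (\<lambda>x. cnj (f x))" and f: "f \<in> smooth_class B"
  shows "(\<lambda>x. cnj (f x)) \<in> smooth_class B"
proof (rule smooth_class_coinduct[where X = "{(\<lambda>x. cnj (f x)) |f. f \<in> smooth_class B}"])
  show "(\<lambda>x. cnj (f x)) \<in> {(\<lambda>x. cnj (f x)) |f. f \<in> smooth_class B}" using f by blast
next
  fix p assume "p \<in> {(\<lambda>x. cnj (f x)) |f. f \<in> smooth_class B}"
  then obtain f where p: "p = (\<lambda>x. cnj (f x))" and f: "f \<in> smooth_class B" by blast
  have D: "(p has_derivative (\<lambda>k. cnj (\<Sum>b\<in>Basis. (k \<bullet> b) *\<^sub>R pd b f x))) (at x)" for x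
    unfolding p by (intro has_derivative_cnj smooth_class_has_derivative[OF f])
  show "p differentiable_on UNIV" by (rule differentiable_onI_UNIV[OF D])
  show "B p" unfolding p by (intro B smooth_class_bound[OF f])
  fix b :: 'a assume b: "b \<in> Basis"
  have "pd b p = (\<lambda>x. cnj (pd b f x))"
    unfolding pd_eq[OF D] using b by (auto simp: inner_Basis if_distrib if_distribR cong: if_cong)
  then show "pd b p \<in> {(\<lambda>x. cnj (f x)) |f. f \<in> smooth_class B}"
    using f[THEN smooth_class_pd, OF b] by blast
qed

section \<open>Rapid decay, slow growth and parametrised families\<close>

definition rapid :: "('a::real_normed_vector \<Rightarrow> complex) \<Rightarrow> bool" where
  "rapid f \<longleftrightarrow> (\<forall>N::nat. \<exists>C. \<forall>x. (1 + norm x) ^ N * norm (f x) \<le> C)"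

definition slow :: "('a::real_normed_vector \<Rightarrow> complex) \<Rightarrow> bool" where
  "slow f \<longleftrightarrow> (\<exists>C K. \<forall>x. norm (f x) \<le> C * (1 + norm x) ^ K)"

text \<open>Functions \<open>G (z, t)\<close> that decay rapidly in \<open>t\<close>, where each bound may grow polynomially in the
  parameter \<open>z\<close>.\<close>

definition mixed :: "('z::real_normed_vector \<times> 'a::real_normed_vector \<Rightarrow> complex) \<Rightarrow> bool" where
  "mixed G \<longleftrightarrow> (\<forall>N::nat. \<exists>C K. \<forall>z t. (1 + norm t) ^ N * norm (G (z, t)) \<le> C * (1 + norm z) ^ K)"

lemma schwartz_eq: "schwartz = smooth_class rapid"
  unfolding schwartz_def smooth_class_def rapid_def bdd_above_def by auto

lemma slowE:
  assumes "slow f"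
  obtains C K where "C \<ge> 0" "\<And>x. norm (f x) \<le> C * (1 + norm x) ^ K"
proof -
  obtain C K where *: "\<And>x. norm (f x) \<le> C * (1 + norm x) ^ K" using assms by (auto simp: slow_def)
  have "C \<ge> 0" using order_trans[OF norm_ge_zero *[of 0]] by simp
  with * show thesis using that by blast
qed

lemma rapidE:
  assumes "rapid f"
  obtains C where "C \<ge> 0" "\<And>x. (1 + norm x) ^ N * norm (f x) \<le> C"
proof -
  obtain C where *: "\<And>x. (1 + norm x) ^ N * norm (f x) \<le> C" using assms by (auto simp: rapid_def)
  have "0 \<le> (1 + norm (0::'a)) ^ N * norm (f 0)" by simp
  with *[of 0] have "C \<ge> 0" by linarith
  with * show thesis using that by blast
qed

lemma mixedE:
  assumes "mixed G"
  obtains C K where "C \<ge> 0" "\<And>z t. (1 + norm t) ^ N * norm (G (z, t)) \<le> C * (1 + norm z) ^ K"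
proof -
  obtain C K where *: "\<And>z t. (1 + norm t) ^ N * norm (G (z, t)) \<le> C * (1 + norm z) ^ K"
    using assms unfolding mixed_def by metis
  have "0 \<le> (1 + norm (0::'b)) ^ N * norm (G (0, 0))" by simp
  moreover have "(1 + norm (0::'b)) ^ N * norm (G (0, 0)) \<le> C" using *[of 0 0] by simp
  ultimately have "C \<ge> 0" by linarith
  with * show thesis using that by blast
qed

lemma one_plus_norm_power_mono: "j \<le> k \<Longrightarrow> (1 + norm x) ^ j \<le> (1 + norm x) ^ k"
  by (rule power_increasing) auto

lemma additive_rapid: "additive_class rapid"
  unfolding additive_class_def
proof (intro conjI allI impI)
  fix f h :: "'a::euclidean_space \<Rightarrow> complex" assume f: "rapid f" and h: "rapid h"
  show "rapid (\<lambda>x. f x + h x)"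
    unfolding rapid_def
  proof
    fix N
    obtain C1 where C1: "\<And>x. (1 + norm x) ^ N * norm (f x) \<le> C1" using rapidE[OF f] by metis
    obtain C2 where C2: "\<And>x. (1 + norm x) ^ N * norm (h x) \<le> C2" using rapidE[OF h] by metis
    have "(1 + norm x) ^ N * norm (f x + h x) \<le> C1 + C2" for x
    proof -
      have "(1 + norm x) ^ N * norm (f x + h x) \<le> (1 + norm x) ^ N * (norm (f x) + norm (h x))"
        by (intro mult_left_mono norm_triangle_ineq) auto
      also have "\<dots> \<le> C1 + C2" using C1[of x] C2[of x] by (simp add: distrib_left)
      finally show ?thesis .
    qed
    then show "\<exists>C. \<forall>x. (1 + norm x) ^ N * norm (f x + h x) \<le> C" by blast
  qed
next
  fix f :: "'a::euclidean_space \<Rightarrow> complex" and c assume f: "rapid f"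
  show "rapid (\<lambda>x. c * f x)"
    unfolding rapid_def
  proof
    fix N
    obtain C1 where C1: "\<And>x. (1 + norm x) ^ N * norm (f x) \<le> C1" using rapidE[OF f] by metis
    have "(1 + norm x) ^ N * norm (c * f x) \<le> norm c * C1" for x
      using mult_left_mono[OF C1[of x], of "norm c"] by (simp add: norm_mult mult_ac)
    then show "\<exists>C. \<forall>x. (1 + norm x) ^ N * norm (c * f x) \<le> C" by blast
  qed
qed

lemma additive_slow: "additive_class slow"
  unfolding additive_class_def
proof (intro conjI allI impI)
  fix f h :: "'a::euclidean_space \<Rightarrow> complex" assume f: "slow f" and h: "slow h"
  obtain C1 K1 where 1: "C1 \<ge> 0" "\<And>x. norm (f x) \<le> C1 * (1 + norm x) ^ K1" using f by (rule slowE) blast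
  obtain C2 K2 where 2: "C2 \<ge> 0" "\<And>x. norm (h x) \<le> C2 * (1 + norm x) ^ K2" using h by (rule slowE) blast
  have "norm (f x + h x) \<le> (C1 + C2) * (1 + norm x) ^ (K1 + K2)" for x
  proof -
    have "norm (f x + h x) \<le> C1 * (1 + norm x) ^ K1 + C2 * (1 + norm x) ^ K2"
      using norm_triangle_ineq[of "f x" "h x"] 1(2)[of x] 2(2)[of x] by linarith
    also have "\<dots> \<le> C1 * (1 + norm x) ^ (K1 + K2) + C2 * (1 + norm x) ^ (K1 + K2)"
      by (intro add_mono mult_left_mono one_plus_norm_power_mono 1 2) auto
    finally show ?thesis by (simp add: distrib_right)
  qed
  then show "slow (\<lambda>x. f x + h x)" unfolding slow_def by blast
next
  fix f :: "'a::euclidean_space \<Rightarrow> complex" and c assume f: "slow f"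
  obtain C1 K1 where 1: "C1 \<ge> 0" "\<And>x. norm (f x) \<le> C1 * (1 + norm x) ^ K1" using f by (rule slowE) blast
  have "norm (c * f x) \<le> (norm c * C1) * (1 + norm x) ^ K1" for x
    using mult_left_mono[OF 1(2)[of x], of "norm c"] by (simp add: norm_mult mult_ac)
  then show "slow (\<lambda>x. c * f x)" unfolding slow_def by blast
qed

lemma additive_mixed: "additive_class (mixed :: ('z::euclidean_space \<times> 'a::euclidean_space \<Rightarrow> complex) \<Rightarrow> bool)"
  unfolding additive_class_def
proof (intro conjI allI impI)
  fix f h :: "'z \<times> 'a \<Rightarrow> complex" assume f: "mixed f" and h: "mixed h"
  show "mixed (\<lambda>x. f x + h x)"
    unfolding mixed_def
  proof
    fix N
    obtain C1 K1 where 1: "C1 \<ge> 0" "\<And>z t. (1 + norm t) ^ N * norm (f (z, t)) \<le> C1 * (1 + norm z) ^ K1"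
      using f by (rule mixedE) blast
    obtain C2 K2 where 2: "C2 \<ge> 0" "\<And>z t. (1 + norm t) ^ N * norm (h (z, t)) \<le> C2 * (1 + norm z) ^ K2"
      using h by (rule mixedE) blast
    have "(1 + norm t) ^ N * norm (f (z, t) + h (z, t)) \<le> (C1 + C2) * (1 + norm z) ^ (K1 + K2)" for z t
    proof -
      have "(1 + norm t) ^ N * norm (f (z, t) + h (z, t)) \<le> (1 + norm t) ^ N * (norm (f (z, t)) + norm (h (z, t)))"
        by (intro mult_left_mono norm_triangle_ineq) auto
      also have "\<dots> \<le> C1 * (1 + norm z) ^ K1 + C2 * (1 + norm z) ^ K2"
        using 1(2)[of t z] 2(2)[of t z] by (simp add: distrib_left)
      also have "\<dots> \<le> C1 * (1 + norm z) ^ (K1 + K2) + C2 * (1 + norm z) ^ (K1 + K2)"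
        by (intro add_mono mult_left_mono one_plus_norm_power_mono 1 2) auto
      finally show ?thesis by (simp add: distrib_right)
    qed
    then show "\<exists>C K. \<forall>z t. (1 + norm t) ^ N * norm (f (z, t) + h (z, t)) \<le> C * (1 + norm z) ^ K" by blast
  qed
next
  fix f :: "'z \<times> 'a \<Rightarrow> complex" and c assume f: "mixed f"
  show "mixed (\<lambda>x. c * f x)"
    unfolding mixed_def
  proof
    fix N
    obtain C1 K1 where 1: "C1 \<ge> 0" "\<And>z t. (1 + norm t) ^ N * norm (f (z, t)) \<le> C1 * (1 + norm z) ^ K1"
      using f by (rule mixedE) blast
    have "(1 + norm t) ^ N * norm (c * f (z, t)) \<le> norm c * C1 * (1 + norm z) ^ K1" for z t
      using mult_left_mono[OF 1(2)[of t z], of "norm c"] by (simp add: norm_mult mult_ac)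
    then show "\<exists>C K. \<forall>z t. (1 + norm t) ^ N * norm (c * f (z, t)) \<le> C * (1 + norm z) ^ K" by blast
  qed
qed

lemma slow_mult: "slow f \<Longrightarrow> slow h \<Longrightarrow> slow (\<lambda>x. f x * h x)"
proof -
  assume f: "slow f" and h: "slow h"
  obtain C1 K1 where 1: "C1 \<ge> 0" "\<And>x. norm (f x) \<le> C1 * (1 + norm x) ^ K1" using f by (rule slowE) blast
  obtain C2 K2 where 2: "C2 \<ge> 0" "\<And>x. norm (h x) \<le> C2 * (1 + norm x) ^ K2" using h by (rule slowE) blast
  have "norm (f x * h x) \<le> (C1 * C2) * (1 + norm x) ^ (K1 + K2)" for x
    using mult_mono[OF 1(2)[of x] 2(2)[of x]] 1(1) by (simp add: norm_mult power_add mult_ac)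
  then show "slow (\<lambda>x. f x * h x)" unfolding slow_def by blast
qed

lemma rapid_mult_slow: "rapid f \<Longrightarrow> slow h \<Longrightarrow> rapid (\<lambda>x. f x * h x)"
  unfolding rapid_def
proof
  fix N
  assume "\<forall>N. \<exists>C. \<forall>x. (1 + norm x) ^ N * norm (f x) \<le> C" and h: "slow h"
  then have f: "rapid f" by (simp add: rapid_def)
  obtain C2 K2 where 2: "C2 \<ge> 0" "\<And>x. norm (h x) \<le> C2 * (1 + norm x) ^ K2" using h by (rule slowE) blast
  obtain C1 where C1: "\<And>x. (1 + norm x) ^ (N + K2) * norm (f x) \<le> C1" using rapidE[OF f] by metis
  have "(1 + norm x) ^ N * norm (f x * h x) \<le> C1 * C2" for x
  proof -
    have "(1 + norm x) ^ N * norm (f x * h x) \<le> (1 + norm x) ^ N * (norm (f x) * (C2 * (1 + norm x) ^ K2))"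
      unfolding norm_mult by (intro mult_left_mono 2) auto
    also have "\<dots> = ((1 + norm x) ^ (N + K2) * norm (f x)) * C2" by (simp add: power_add mult_ac)
    also have "\<dots> \<le> C1 * C2" by (intro mult_right_mono C1 2)
    finally show ?thesis .
  qed
  then show "\<exists>C. \<forall>x. (1 + norm x) ^ N * norm (f x * h x) \<le> C" by blast
qed

lemma mixed_mult_slow: "mixed f \<Longrightarrow> slow h \<Longrightarrow> mixed (\<lambda>x. f x * h x)"
  unfolding mixed_def
proof
  fix N
  assume "\<forall>N. \<exists>C K. \<forall>z t. (1 + norm t) ^ N * norm (f (z, t)) \<le> C * (1 + norm z) ^ K" and h: "slow h"
  then have f: "mixed f" by (simp add: mixed_def)
  obtain C2 K2 where 2: "C2 \<ge> 0" "\<And>x. norm (h x) \<le> C2 * (1 + norm x) ^ K2" using h by (rule slowE) blast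
  obtain C1 K1 where 1: "C1 \<ge> 0" "\<And>z t. (1 + norm t) ^ (N + K2) * norm (f (z, t)) \<le> C1 * (1 + norm z) ^ K1"
    using f by (rule mixedE) blast
  have "(1 + norm t) ^ N * norm (f (z, t) * h (z, t)) \<le> C1 * C2 * (1 + norm z) ^ (K1 + K2)" for z t
  proof -
    have "1 + norm (z, t) \<le> 1 + (norm z + norm t)" by (intro add_left_mono norm_Pair_le)
    also have "\<dots> \<le> (1 + norm z) * (1 + norm t)" by (simp add: algebra_simps)
    finally have "(1 + norm (z, t)) ^ K2 \<le> ((1 + norm z) * (1 + norm t)) ^ K2"
      by (intro power_mono) auto
    then have "norm (h (z, t)) \<le> C2 * ((1 + norm z) ^ K2 * (1 + norm t) ^ K2)"
      using 2(2)[of "(z, t)"] 2(1) by (smt (verit, best) mult_left_mono power_mult_distrib)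
    then have "(1 + norm t) ^ N * norm (f (z, t) * h (z, t)) \<le> (1 + norm t) ^ N * (norm (f (z, t)) * (C2 * ((1 + norm z) ^ K2 * (1 + norm t) ^ K2)))"
      unfolding norm_mult by (intro mult_left_mono) auto
    also have "\<dots> = ((1 + norm t) ^ (N + K2) * norm (f (z, t))) * (C2 * (1 + norm z) ^ K2)" by (simp add: power_add mult_ac)
    also have "\<dots> \<le> (C1 * (1 + norm z) ^ K1) * (C2 * (1 + norm z) ^ K2)" by (intro mult_right_mono 1) (use 2 in auto)
    finally show ?thesis by (simp add: power_add mult_ac)
  qed
  then show "\<exists>C K. \<forall>z t. (1 + norm t) ^ N * norm (f (z, t) * h (z, t)) \<le> C * (1 + norm z) ^ K" by blast
qed

lemma slow_compose:
  assumes l: "bounded_linear l" and f: "slow f"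
  shows "slow (\<lambda>x. f (a + l x))"
proof -
  obtain C K where 1: "C \<ge> 0" "\<And>x. norm (f x) \<le> C * (1 + norm x) ^ K" using f by (rule slowE) blast
  obtain L where L: "L > 0" "\<And>x. norm (l x) \<le> norm x * L" using bounded_linear.pos_bounded[OF l] by blast
  let ?c = "1 + norm a + L"
  have "norm (f (a + l x)) \<le> (C * ?c ^ K) * (1 + norm x) ^ K" for x
  proof -
    have "1 + norm (a + l x) \<le> 1 + norm a + norm x * L"
      using norm_triangle_ineq[of a "l x"] L(2)[of x] by linarith
    also have "\<dots> \<le> ?c * (1 + norm x)" using L(1) by (simp add: algebra_simps)
    finally have "(1 + norm (a + l x)) ^ K \<le> (?c * (1 + norm x)) ^ K" by (intro power_mono) auto
    then show ?thesis using 1(2)[of "a + l x"] 1(1)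
      by (smt (verit, best) mult.assoc mult_left_mono power_mult_distrib)
  qed
  then show ?thesis unfolding slow_def by blast
qed

lemma slow_class_mult: "f \<in> smooth_class slow \<Longrightarrow> h \<in> smooth_class slow \<Longrightarrow> (\<lambda>x. f x * h x) \<in> smooth_class slow"
  by (rule smooth_class_mult[OF slow_mult additive_slow])

lemma schwartz_mult_slow: "f \<in> schwartz \<Longrightarrow> h \<in> smooth_class slow \<Longrightarrow> (\<lambda>x. f x * h x) \<in> schwartz"
  unfolding schwartz_eq by (rule smooth_class_mult[OF rapid_mult_slow additive_rapid])

lemma slow_class_linear: "(\<lambda>x. a + b * complex_of_real (x \<bullet> c)) \<in> smooth_class slow"
proof (rule smooth_class_coinduct[where X = "{(\<lambda>x. a + b * complex_of_real (x \<bullet> c)) |a b. True}"])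
  show "(\<lambda>x. a + b * complex_of_real (x \<bullet> c)) \<in> {(\<lambda>x. a + b * complex_of_real (x \<bullet> c)) |a b. True}" by blast
next
  fix p assume "p \<in> {(\<lambda>x. a + b * complex_of_real (x \<bullet> c)) |a b. True}"
  then obtain a b where p: "p = (\<lambda>x. a + b * complex_of_real (x \<bullet> c))" by blast
  have D: "(p has_derivative (\<lambda>k. b * complex_of_real (k \<bullet> c))) (at x)" for x
    unfolding p by (auto intro!: derivative_eq_intros)
  show "p differentiable_on UNIV" by (rule differentiable_onI_UNIV[OF D])
  have "norm (p x) \<le> (norm a + norm b * norm c) * (1 + norm x) ^ 1" for x
  proof -
    have "norm (p x) \<le> norm a + norm b * \<bar>x \<bullet> c\<bar>"
      unfolding p by (rule order_trans[OF norm_triangle_ineq]) (simp add: norm_mult)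
    also have "\<dots> \<le> norm a + norm b * (norm x * norm c)"
      by (intro add_left_mono mult_left_mono Cauchy_Schwarz_ineq2) auto
    also have "\<dots> \<le> (norm a + norm b * norm c) * (1 + norm x) ^ 1" by (simp add: algebra_simps)
    finally show ?thesis .
  qed
  then show "slow p" unfolding slow_def by blast
  fix e :: 'a assume "e \<in> Basis"
  have "pd e p = (\<lambda>x. b * complex_of_real (e \<bullet> c) + 0 * complex_of_real (x \<bullet> c))"
    unfolding pd_eq[OF D] by simp
  then show "pd e p \<in> {(\<lambda>x. a + b * complex_of_real (x \<bullet> c)) |a b. True}" by blast
qed

lemma slow_class_const: "(\<lambda>x. c) \<in> smooth_class slow"
  using slow_class_linear[of c 0] by simp

lemma slow_class_inner:
  fixes l1 l2 :: "'b::euclidean_space \<Rightarrow> 'a::euclidean_space"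
  assumes l: "bounded_linear l1" "bounded_linear l2"
  shows "(\<lambda>x. complex_of_real (l1 x \<bullet> l2 x)) \<in> smooth_class slow"
proof -
  have *: "(\<lambda>x. complex_of_real (l x \<bullet> c)) \<in> smooth_class slow" if "bounded_linear l" for l :: "'b \<Rightarrow> 'a" and c
    using smooth_class_compose[where B' = slow and a = 0, OF that additive_slow _ slow_class_linear[of 0 1 c]]
      slow_compose[OF that, of _ 0] by simp
  have "(\<lambda>x. \<Sum>c\<in>Basis. complex_of_real (l1 x \<bullet> c) * complex_of_real (l2 x \<bullet> c)) \<in> smooth_class slow"
    by (intro smooth_class_sum additive_slow slow_class_mult *[OF l(1)] *[OF l(2)]) auto
  also have "(\<lambda>x. \<Sum>c\<in>Basis. complex_of_real (l1 x \<bullet> c) * complex_of_real (l2 x \<bullet> c)) = (\<lambda>x. complex_of_real (l1 x \<bullet> l2 x))"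
    by (auto simp: euclidean_inner[of "l1 _" "l2 _"])
  finally show ?thesis .
qed

text \<open>Every derivative of \<open>a exp Q\<close> is again of this form, with another slowly growing factor \<open>a\<close>.
  This yields the characters (\<open>Q\<close> imaginary) as well as the Gaussian (\<open>Q\<close> a negative square).\<close>

lemma smooth_class_exp:
  assumes Q: "Q \<in> smooth_class slow" and B: "\<And>a. a \<in> smooth_class slow \<Longrightarrow> B (\<lambda>x. a x * exp (Q x))"
    and a: "a \<in> smooth_class slow"
  shows "(\<lambda>x. a x * exp (Q x)) \<in> smooth_class B"
proof (rule smooth_class_coinduct[where X = "{(\<lambda>x. a x * exp (Q x)) |a. a \<in> smooth_class slow}"])
  show "(\<lambda>x. a x * exp (Q x)) \<in> {(\<lambda>x. a x * exp (Q x)) |a. a \<in> smooth_class slow}" using a by blast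
next
  fix p assume "p \<in> {(\<lambda>x. a x * exp (Q x)) |a. a \<in> smooth_class slow}"
  then obtain a where p: "p = (\<lambda>x. a x * exp (Q x))" and a: "a \<in> smooth_class slow" by blast
  have E: "((\<lambda>x. exp (Q x)) has_derivative (\<lambda>k. exp (Q x) * (\<Sum>b\<in>Basis. (k \<bullet> b) *\<^sub>R pd b Q x))) (at x)" for x
    by (rule has_derivative_compose[OF smooth_class_has_derivative[OF Q]])
       (use DERIV_exp[of "Q x"] in \<open>simp add: has_field_derivative_def\<close>)
  have D: "(p has_derivative (\<lambda>k. a x * (exp (Q x) * (\<Sum>b\<in>Basis. (k \<bullet> b) *\<^sub>R pd b Q x)) + (\<Sum>b\<in>Basis. (k \<bullet> b) *\<^sub>R pd b a x) * exp (Q x))) (at x)" for x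
    unfolding p by (intro has_derivative_mult E smooth_class_has_derivative[OF a])
  show "p differentiable_on UNIV" by (rule differentiable_onI_UNIV[OF D])
  show "B p" unfolding p by (intro B a)
  fix b :: 'a assume b: "b \<in> Basis"
  have "pd b p = (\<lambda>x. (a x * pd b Q x + pd b a x) * exp (Q x))"
    unfolding pd_eq[OF D] using b by (auto simp: inner_Basis if_distrib if_distribR algebra_simps cong: if_cong)
  moreover have "(\<lambda>x. a x * pd b Q x + pd b a x) \<in> smooth_class slow"
    by (intro smooth_class_add slow_class_mult smooth_class_pd additive_slow a Q b)
  ultimately show "pd b p \<in> {(\<lambda>x. a x * exp (Q x)) |a. a \<in> smooth_class slow}"
    by (intro CollectI exI[of _ "\<lambda>x. a x * pd b Q x + pd b a x"] conjI)
qed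

lemma slow_class_cis:
  assumes q: "(\<lambda>x. complex_of_real (q x)) \<in> smooth_class slow"
  shows "(\<lambda>x. cis (r * q x)) \<in> smooth_class slow"
proof -
  have Q: "(\<lambda>x. (\<i> * complex_of_real r) * complex_of_real (q x)) \<in> smooth_class slow"
    by (rule smooth_class_cmult[OF additive_slow q])
  have "(\<lambda>x. 1 * exp ((\<i> * complex_of_real r) * complex_of_real (q x))) \<in> smooth_class slow"
  proof (rule smooth_class_exp[OF Q])
    fix a :: "'a \<Rightarrow> complex" assume "a \<in> smooth_class slow"
    then have "slow a" by (rule smooth_class_bound)
    then show "slow (\<lambda>x. a x * exp ((\<i> * complex_of_real r) * complex_of_real (q x)))"
      by (simp add: slow_def norm_mult)
  qed (rule slow_class_const)
  then show ?thesis by (simp add: cis_conv_exp mult_ac)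
qed

section \<open>Integrals over Euclidean spaces\<close>

lemma borel_measurable_cis [measurable]: "cis \<in> borel_measurable borel"
  by (intro borel_measurable_continuous_onI continuous_intros)

lemma borel_measurable_cnj [measurable]: "cnj \<in> borel_measurable borel"
  by (intro borel_measurable_continuous_onI continuous_intros)

lemma norm_integral_le_nn_integral:
  fixes f :: "'a \<Rightarrow> 'b::{banach, second_countable_topology}"
  shows "ennreal (norm (\<integral>x. f x \<partial>M)) \<le> (\<integral>\<^sup>+x. ennreal (norm (f x)) \<partial>M)"
  by (cases "integrable M f") (auto simp: integral_norm_bound_ennreal not_integrable_integral_eq)

text \<open>Lebesgue measure is the image of a product measure, so products of functions of the coordinates
  integrate coordinatewise. Both uses below are of this kind: a polynomially decaying majorant and
  the Gaussian.\<close>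

lemma integrable_coordinate_prod:
  fixes f :: "'a::euclidean_space \<Rightarrow> real \<Rightarrow> complex"
  assumes f: "\<And>b. b \<in> Basis \<Longrightarrow> integrable lborel (f b)"
  shows "integrable lborel (\<lambda>x::'a. \<Prod>b\<in>Basis. f b (x \<bullet> b))"
    and integral_coordinate_prod:
      "(\<integral>x. (\<Prod>b\<in>(Basis::'a set). f b (x \<bullet> b)) \<partial>lborel) = (\<Prod>b\<in>Basis. \<integral>x. f b x \<partial>lborel)"
proof -
  interpret product_sigma_finite "\<lambda>_::'a. lborel :: real measure" ..
  have [measurable]: "f b \<in> borel_measurable borel" if "b \<in> Basis" for b
    using f[OF that] by (auto dest: borel_measurable_integrable)
  have c: "(\<Sum>b\<in>Basis. x b *\<^sub>R b) \<bullet> c = x c" if "c \<in> Basis" for x :: "'a \<Rightarrow> real" and c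
    using that by (simp add: inner_sum_left inner_Basis if_distrib cong: if_cong)
  have m: "(\<lambda>x::'a. \<Prod>b\<in>Basis. f b (x \<bullet> b)) \<in> borel_measurable borel"
    by measurable
  have m': "(\<lambda>x. \<Sum>b\<in>(Basis::'a set). x b *\<^sub>R b) \<in> measurable (\<Pi>\<^sub>M b\<in>(Basis::'a set). lborel) borel"
    by measurable
  show "integrable lborel (\<lambda>x::'a. \<Prod>b\<in>Basis. f b (x \<bullet> b))"
    by (subst lborel_eq, subst integrable_distr_eq[OF m' m])
       (simp add: c product_integrable_prod f)
  show "(\<integral>x. (\<Prod>b\<in>(Basis::'a set). f b (x \<bullet> b)) \<partial>lborel) = (\<Prod>b\<in>Basis. \<integral>x. f b x \<partial>lborel)"
    by (subst lborel_eq, subst integral_distr[OF m' m])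
       (simp add: c product_integral_prod f)
qed

definition decay :: "nat \<Rightarrow> 'a::euclidean_space \<Rightarrow> real" where
  "decay N x = inverse ((1 + norm x) ^ N)"

lemma decay_nonneg [simp]: "0 \<le> decay N x" and decay_pos [simp]: "0 < decay N x"
  by (auto simp: decay_def add_pos_nonneg)

lemma decay_measurable [measurable]: "decay N \<in> borel_measurable borel"
  unfolding decay_def by measurable

lemma le_decay_iff: "c \<le> C * decay N x \<longleftrightarrow> (1 + norm x) ^ N * c \<le> C"
proof -
  have "(1 + norm x) ^ N > 0" by (simp add: add_pos_nonneg)
  then show ?thesis unfolding decay_def by (simp add: field_simps)
qed

lemma decay_antimono: "N \<le> K \<Longrightarrow> decay K x \<le> decay N x"
  unfolding decay_def by (intro le_imp_inverse_le one_plus_norm_power_mono) (auto simp: add_pos_nonneg)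

lemma decay_power: "(1 + norm x) ^ K * decay (K + N) x = decay N x"
proof -
  have "(1 + norm x) ^ K > 0" by (simp add: add_pos_nonneg)
  then show ?thesis unfolding decay_def power_add inverse_mult_distrib
    by (metis less_irrefl mult.assoc mult_1 right_inverse)
qed

lemma integrable_inverse_one_plus_abs_square:
  "integrable lborel (\<lambda>x::real. inverse ((1 + \<bar>x\<bar>) ^ 2))"
proof (rule Bochner_Integration.integrable_bound)
  show "integrable lborel (\<lambda>x::real. inverse (1 + x ^ 2))"
    using integrable_inverse_1_plus_square by (simp add: set_integrable_def)
  have "inverse ((1 + \<bar>x\<bar>) ^ 2) \<le> inverse (1 + x ^ 2)" for x :: real
    by (rule le_imp_inverse_le) (auto simp: power2_eq_square algebra_simps add_pos_nonneg)
  then show "AE x in lborel. norm (inverse ((1 + \<bar>x\<bar>) ^ 2)) \<le> norm (inverse (1 + x ^ 2) :: real)"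
    by simp
qed measurable

text \<open>Each of the factors \<open>1 + norm x\<close> dominates \<open>1 + \<bar>x \<bullet> b\<bar>\<close>; giving two of them to every
  coordinate leaves a product of integrable functions of one variable.\<close>

lemma integrable_decay:
  assumes "2 * DIM('a) \<le> N"
  shows "integrable lborel (decay N :: 'a::euclidean_space \<Rightarrow> real)"
proof -
  let ?f = "\<lambda>x::'a. \<Prod>b\<in>Basis. complex_of_real (inverse ((1 + \<bar>x \<bullet> b\<bar>) ^ 2))"
  have f: "integrable lborel ?f"
    by (rule integrable_coordinate_prod) (intro integrable_of_real integrable_inverse_one_plus_abs_square)
  have "decay N x \<le> norm (?f x)" for x :: 'a
  proof -
    have "decay N x \<le> decay (2 * DIM('a)) x" by (rule decay_antimono[OF assms])
    also have "\<dots> = (\<Prod>b\<in>(Basis::'a set). inverse ((1 + norm x) ^ 2))"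
      by (simp add: decay_def power_mult power_inverse)
    also have "\<dots> \<le> (\<Prod>b\<in>Basis. inverse ((1 + \<bar>x \<bullet> b\<bar>) ^ 2))"
      by (intro prod_mono conjI le_imp_inverse_le power_mono add_left_mono Basis_le_norm) auto
    also have "\<dots> = norm (?f x)" unfolding prod_norm[symmetric] norm_of_real by simp
    finally show ?thesis .
  qed
  then show ?thesis
    by (intro Bochner_Integration.integrable_bound[OF f]) auto
qed

lemma rapid_bound_decay:
  assumes "rapid f"
  obtains C where "C \<ge> 0" "\<And>x. norm (f x) \<le> C * decay N x"
  using rapidE[OF assms, of N] unfolding le_decay_iff by metis

lemma rapid_slow_integrable:
  fixes f :: "'a::euclidean_space \<Rightarrow> complex"
  assumes f: "rapid f" and h: "\<And>x. norm (h x) \<le> C * (1 + norm x) ^ K * norm (f x)"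
    and m [measurable]: "h \<in> borel_measurable borel"
  shows "integrable lborel (h :: 'a \<Rightarrow> complex)"
proof -
  obtain D where D: "D \<ge> 0" "\<And>x. norm (f x) \<le> D * decay (K + 2 * DIM('a)) x"
    using rapid_bound_decay[OF f] by metis
  have "norm (h x) \<le> norm (\<bar>C\<bar> * D * decay (2 * DIM('a)) x)" for x
  proof -
    have "norm (h x) \<le> C * ((1 + norm x) ^ K * norm (f x))"
      using h[of x] by (simp only: mult.assoc)
    also have "\<dots> \<le> \<bar>C\<bar> * ((1 + norm x) ^ K * norm (f x))"
      by (intro mult_right_mono abs_ge_self) auto
    also have "\<dots> \<le> \<bar>C\<bar> * ((1 + norm x) ^ K * (D * decay (K + 2 * DIM('a)) x))"
      by (intro mult_left_mono D) auto
    also have "\<dots> = \<bar>C\<bar> * D * decay (2 * DIM('a)) x"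
      using decay_power[of x K "2 * DIM('a)"] by (simp add: mult_ac)
    finally show ?thesis using D by simp
  qed
  then have "AE x in lborel. norm (h x) \<le> norm (\<bar>C\<bar> * D * decay (2 * DIM('a)) x)" by simp
  then show ?thesis
    by (rule Bochner_Integration.integrable_bound[where f = "\<lambda>x::'a. \<bar>C\<bar> * D * decay (2 * DIM('a)) x", rotated 2])
       (simp_all add: integrable_decay)
qed

lemma rapid_integrable:
  fixes f :: "'a::euclidean_space \<Rightarrow> complex"
  assumes f: "rapid f" and m: "f \<in> borel_measurable borel"
  shows "integrable lborel f"
  by (rule rapid_slow_integrable[OF f _ m, of 1 0]) simp

lemma integrable_pair_bound:
  fixes H :: "'a::euclidean_space \<Rightarrow> 'b::euclidean_space \<Rightarrow> complex" and F :: "'a \<Rightarrow> complex" and G :: "'b \<Rightarrow> complex"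
  assumes F: "integrable lborel F" and G: "integrable lborel G"
    and H [measurable]: "case_prod H \<in> borel_measurable (lborel \<Otimes>\<^sub>M lborel)"
    and le: "\<And>x y. norm (H x y) \<le> norm (F x) * norm (G y)"
  shows "integrable (lborel \<Otimes>\<^sub>M lborel) (case_prod H)"
proof (rule integrableI_bounded[OF H])
  have [measurable]: "F \<in> borel_measurable borel" "G \<in> borel_measurable borel"
    using borel_measurable_integrable[OF F] borel_measurable_integrable[OF G] by auto
  have "(\<integral>\<^sup>+z. ennreal (norm (case_prod H z)) \<partial>(lborel \<Otimes>\<^sub>M lborel)) = (\<integral>\<^sup>+x. \<integral>\<^sup>+y. ennreal (norm (H x y)) \<partial>lborel \<partial>lborel)"
    using lborel.nn_integral_fst[of "\<lambda>z. ennreal (norm (case_prod H z))" lborel] by simp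
  also have "\<dots> \<le> (\<integral>\<^sup>+x. \<integral>\<^sup>+y. ennreal (norm (F x)) * ennreal (norm (G y)) \<partial>lborel \<partial>lborel)"
    by (intro nn_integral_mono) (use le in \<open>auto simp: ennreal_mult[symmetric] intro!: ennreal_leI\<close>)
  also have "\<dots> = (\<integral>\<^sup>+x. ennreal (norm (F x)) \<partial>lborel) * (\<integral>\<^sup>+y. ennreal (norm (G y)) \<partial>lborel)"
    by (simp add: nn_integral_cmult nn_integral_multc)
  also have "\<dots> < \<infinity>"
    using F G by (auto simp: integrable_iff_bounded ennreal_mult_less_top)
  finally show "(\<integral>\<^sup>+z. ennreal (norm (case_prod H z)) \<partial>(lborel \<Otimes>\<^sub>M lborel)) < \<infinity>" .
qed

section \<open>Gaussians\<close>

definition gauss_density :: "'a::euclidean_space \<Rightarrow> real" where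
  "gauss_density x = (\<Prod>b\<in>Basis. std_normal_density (x \<bullet> b))"

definition gauss :: "'a::euclidean_space \<Rightarrow> real" where
  "gauss x = exp (- (norm x)\<^sup>2 / 2)"

lemma gauss_measurable [measurable]: "gauss \<in> borel_measurable borel"
  unfolding gauss_def by measurable

lemma gauss_le_1: "gauss x \<le> 1" and gauss_pos: "0 < gauss x" and abs_gauss [simp]: "\<bar>gauss x\<bar> = gauss x"
  by (auto simp: gauss_def)

lemma gauss_prod: "gauss x = (\<Prod>b\<in>Basis. exp (- (x \<bullet> b)\<^sup>2 / 2))"
proof -
  have "(norm x)\<^sup>2 = (\<Sum>b\<in>Basis. (x \<bullet> b)\<^sup>2)"
    by (subst power2_norm_eq_inner, subst euclidean_inner) (simp add: power2_eq_square)
  then show ?thesis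
    by (simp add: gauss_def exp_sum[symmetric] sum_negf sum_divide_distrib)
qed

lemma gauss_density_eq: "gauss_density x = (1 / sqrt (2 * pi)) ^ DIM('a) * gauss (x::'a::euclidean_space)"
  unfolding gauss_density_def gauss_prod std_normal_density_def by (simp only: prod.distrib) simp

lemma gauss_eq: "gauss (x::'a::euclidean_space) = (sqrt (2 * pi)) ^ DIM('a) * gauss_density x"
  unfolding gauss_density_eq by (simp add: power_divide field_simps)

lemma gauss_density_measurable [measurable]: "gauss_density \<in> borel_measurable borel"
  unfolding gauss_density_def by measurable

lemma gauss_density_pos: "gauss_density x > 0"
  by (auto simp: gauss_density_def intro!: prod_pos normal_density_pos)

lemma abs_gauss_density [simp]: "\<bar>gauss_density x\<bar> = gauss_density x"
  using gauss_density_pos[of x] by simp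

text \<open>Coordinatewise, this is the characteristic function of the standard normal distribution.\<close>

lemma gauss_density_fourier:
  fixes w :: "'a::euclidean_space"
  shows "integrable lborel (\<lambda>x. complex_of_real (gauss_density x) * cis (x \<bullet> w))"
    and "(\<integral>x. complex_of_real (gauss_density x) * cis (x \<bullet> w) \<partial>lborel) = complex_of_real (gauss w)"
proof -
  let ?f = "\<lambda>b y. complex_of_real (std_normal_density y) * cis (y * (w \<bullet> b))"
  have i: "integrable lborel (?f b)" for b
  proof (rule Bochner_Integration.integrable_bound)
    show "integrable lborel std_normal_density" by simp
  qed (auto simp: norm_mult)
  have eq: "(\<Prod>b\<in>Basis. ?f b (x \<bullet> b)) = complex_of_real (gauss_density x) * cis (x \<bullet> w)" for x
  proof -
    have "(\<Prod>b\<in>Basis. cis ((x \<bullet> b) * (w \<bullet> b))) = cis (x \<bullet> w)"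
      by (simp add: cis_conv_exp exp_sum[symmetric] sum_distrib_left euclidean_inner[of x w])
    then show ?thesis by (simp add: gauss_density_def prod.distrib)
  qed
  have v: "(\<integral>y. ?f b y \<partial>lborel) = complex_of_real (exp (- (w \<bullet> b)\<^sup>2 / 2))" for b
  proof -
    have "char std_normal_distribution (w \<bullet> b) = (\<integral>y. ?f b y \<partial>lborel)"
      unfolding char_def
      by (subst integral_density) (auto simp: cis_conv_exp mult_ac scaleR_conv_of_real)
    then show ?thesis by (simp add: char_std_normal_distribution)
  qed
  show "integrable lborel (\<lambda>x. complex_of_real (gauss_density x) * cis (x \<bullet> w))"
    using integrable_coordinate_prod[of ?f] i eq by simp
  show "(\<integral>x. complex_of_real (gauss_density x) * cis (x \<bullet> w) \<partial>lborel) = complex_of_real (gauss w)"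
    using integral_coordinate_prod[of ?f] i by (simp add: eq v gauss_prod del: exp_le_cancel_iff)
qed

lemma gauss_density_integral:
  shows "integrable lborel (gauss_density :: 'a::euclidean_space \<Rightarrow> real)"
    and "(\<integral>x. gauss_density (x::'a) \<partial>lborel) = 1"
proof -
  have *: "integrable lborel (\<lambda>x::'a. complex_of_real (gauss_density x))"
    using gauss_density_fourier(1)[of "0::'a"] by simp
  then show i: "integrable lborel (gauss_density :: 'a \<Rightarrow> real)"
  proof -
    have "(\<lambda>x::'a. norm (complex_of_real (gauss_density x))) = gauss_density"
      by auto
    then show ?thesis using integrable_norm[OF *] by simp
  qed
  have "complex_of_real (\<integral>x. gauss_density (x::'a) \<partial>lborel) = 1"
    using gauss_density_fourier(2)[of "0::'a"] by (simp add: gauss_def)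
  then show "(\<integral>x. gauss_density (x::'a) \<partial>lborel) = 1" by simp
qed

lemma lborel_integral_affine:
  fixes f :: "'a::euclidean_space \<Rightarrow> 'b::{banach, second_countable_topology}"
  assumes "c \<noteq> 0" and [measurable]: "f \<in> borel_measurable borel"
  shows "(\<integral>x. f x \<partial>lborel) = \<bar>c\<bar> ^ DIM('a) *\<^sub>R (\<integral>x. f (t + c *\<^sub>R x) \<partial>lborel)"
    and "integrable lborel f \<longleftrightarrow> integrable lborel (\<lambda>x. f (t + c *\<^sub>R x))"
proof -
  show "(\<integral>x. f x \<partial>lborel) = \<bar>c\<bar> ^ DIM('a) *\<^sub>R (\<integral>x. f (t + c *\<^sub>R x) \<partial>lborel)"
    by (subst lborel_affine[OF assms(1), of t], subst integral_density)
       (auto simp: integral_distr)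
  have "integrable lborel f \<longleftrightarrow> integrable (density (distr lborel borel (\<lambda>x. t + c *\<^sub>R x)) (\<lambda>_. ennreal (\<bar>c\<bar> ^ DIM('a)))) f"
    by (subst lborel_affine[OF assms(1), of t]) simp
  also have "\<dots> \<longleftrightarrow> integrable lborel (\<lambda>x. f (t + c *\<^sub>R x))"
    using assms(1) integrable_scaleR_right[of "inverse (\<bar>c\<bar> ^ DIM('a))" lborel "\<lambda>x. \<bar>c\<bar> ^ DIM('a) *\<^sub>R f (t + c *\<^sub>R x)"]
    by (subst integrable_density) (auto simp: integrable_distr_eq)
  finally show "integrable lborel f \<longleftrightarrow> integrable lborel (\<lambda>x. f (t + c *\<^sub>R x))" .
qed

lemma lborel_nn_integral_translate:
  fixes f :: "'a::euclidean_space \<Rightarrow> ennreal"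
  assumes [measurable]: "f \<in> borel_measurable borel"
  shows "(\<integral>\<^sup>+x. f (t + x) \<partial>lborel) = (\<integral>\<^sup>+x. f x \<partial>lborel)"
  by (subst (2) lborel_distr_plus[of t, symmetric], subst nn_integral_distr) auto

lemma lborel_nn_integral_reflect:
  fixes f :: "'a::euclidean_space \<Rightarrow> ennreal"
  assumes [measurable]: "f \<in> borel_measurable borel"
  shows "(\<integral>\<^sup>+x. f (t - x) \<partial>lborel) = (\<integral>\<^sup>+x. f x \<partial>lborel)"
  by (subst (2) lborel_affine[of "-1" t], simp, subst nn_integral_density) (auto simp: nn_integral_distr)

lemma gauss_scaled_fourier:
  fixes y :: "'a::euclidean_space"
  assumes d: "d > 0"
  shows "integrable lborel (\<lambda>w. complex_of_real (gauss ((2 * pi * d) *\<^sub>R w)) * cis (2 * pi * (y \<bullet> w)))" (is "integrable lborel ?f")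
    and "(\<integral>w. complex_of_real (gauss ((2 * pi * d) *\<^sub>R w)) * cis (2 * pi * (y \<bullet> w)) \<partial>lborel)
      = complex_of_real (gauss_density (y /\<^sub>R d) / d ^ DIM('a))"
proof -
  let ?c = "2 * pi * d" and ?n = "DIM('a)"
  let ?g = "\<lambda>x. complex_of_real (gauss_density x) * cis (x \<bullet> (y /\<^sub>R d))"
  have c: "?c \<noteq> 0" using d by simp
  have m: "?g \<in> borel_measurable borel" by measurable
  have eq: "?f w = complex_of_real (sqrt (2 * pi) ^ ?n) * ?g (0 + ?c *\<^sub>R w)" for w
  proof -
    have "(?c *\<^sub>R w) \<bullet> (y /\<^sub>R d) = 2 * pi * (y \<bullet> w)"
      using d by (simp add: inner_commute)
    then have "?g (0 + ?c *\<^sub>R w) = complex_of_real (gauss_density (?c *\<^sub>R w)) * cis (2 * pi * (y \<bullet> w))"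
      by (simp only: add_0_left)
    then show ?thesis by (simp only: gauss_eq of_real_mult mult.assoc)
  qed
  have "integrable lborel (\<lambda>w. ?g (0 + ?c *\<^sub>R w))"
    using lborel_integral_affine(2)[OF c m, of 0] gauss_density_fourier(1)[of "y /\<^sub>R d"] by blast
  then show "integrable lborel ?f" unfolding eq by (rule integrable_mult_right)
  have s: "sqrt (2 * pi) * sqrt (2 * pi) = 2 * pi" by simp
  have "complex_of_real (gauss (y /\<^sub>R d)) = complex_of_real (?c ^ ?n) * (\<integral>w. ?g (0 + ?c *\<^sub>R w) \<partial>lborel)"
    using lborel_integral_affine(1)[OF c m, of 0] d unfolding gauss_density_fourier(2) by (simp add: scaleR_conv_of_real)
  then have "(\<integral>w. ?g (0 + ?c *\<^sub>R w) \<partial>lborel) = complex_of_real (gauss (y /\<^sub>R d) / ?c ^ ?n)"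
    using d by (simp add: field_simps)
  then have "(\<integral>w. ?f w \<partial>lborel) = complex_of_real (sqrt (2 * pi) ^ ?n * (gauss (y /\<^sub>R d) / ?c ^ ?n))"
    unfolding eq by simp
  also have "sqrt (2 * pi) ^ ?n * (gauss (y /\<^sub>R d) / ?c ^ ?n) = (sqrt (2 * pi) * sqrt (2 * pi)) ^ ?n * gauss_density (y /\<^sub>R d) / ?c ^ ?n"
    by (simp only: gauss_eq power_mult_distrib) simp
  also have "\<dots> = gauss_density (y /\<^sub>R d) / d ^ ?n"
    unfolding s by (simp add: power_mult_distrib)
  finally show "(\<integral>w. ?f w \<partial>lborel) = complex_of_real (gauss_density (y /\<^sub>R d) / d ^ ?n)" .
qed

section \<open>Fourier inversion and the Bessel inequality\<close>

lemma fourier_measurable [measurable]: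
  assumes [measurable]: "f \<in> borel_measurable borel"
  shows "fourier f \<in> borel_measurable borel"
  unfolding fourier_def[abs_def] by measurable

lemma fourier_bound: "norm (fourier f w) \<le> (\<integral>x. norm (f x) \<partial>lborel)"
  unfolding fourier_def using integral_norm_bound[of lborel "\<lambda>x. f x * cis (- 2 * pi * (x \<bullet> w))"]
  by (simp add: norm_mult)

text \<open>Inserting a Gaussian cutoff into the inversion integral makes the exchange of the integrals
  legitimate, and the integral over frequencies becomes the Gaussian density at scale \<open>d\<close>. Inversion,
  the Bessel inequality and the uniqueness of representing functions all come from this identity by
  letting \<open>d\<close> tend to zero.\<close>

lemma gauss_smoothing:
  fixes k :: "'a::euclidean_space \<Rightarrow> complex"
  assumes k: "integrable lborel k" and d: "d > 0"
  shows "(\<integral>w. complex_of_real (gauss ((2 * pi * d) *\<^sub>R w)) * fourier k w * cis (2 * pi * (t \<bullet> w)) \<partial>lborel)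
    = (\<integral>x. complex_of_real (gauss_density x) * k (t - d *\<^sub>R x) \<partial>lborel)"
proof -
  have [measurable]: "k \<in> borel_measurable borel" using borel_measurable_integrable[OF k] by simp
  let ?G = "\<lambda>w::'a. complex_of_real (gauss ((2 * pi * d) *\<^sub>R w))"
  let ?H = "\<lambda>w s. ?G w * k s * cis (2 * pi * ((t - s) \<bullet> w))"
  have G: "integrable lborel ?G"
    using gauss_scaled_fourier(1)[OF d, of 0] by simp
  have "integrable (lborel \<Otimes>\<^sub>M lborel) (case_prod ?H)"
    by (rule integrable_pair_bound[OF G k]) (auto simp: norm_mult)
  then have F: "(\<integral>w. \<integral>s. ?H w s \<partial>lborel \<partial>lborel) = (\<integral>s. \<integral>w. ?H w s \<partial>lborel \<partial>lborel)"
    using lborel_pair.Fubini_integral[of ?H] by simp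
  have "(\<integral>s. ?H w s \<partial>lborel) = ?G w * fourier k w * cis (2 * pi * (t \<bullet> w))" for w
  proof -
    have *: "?H w s = (?G w * cis (2 * pi * (t \<bullet> w))) * (k s * cis (- 2 * pi * (s \<bullet> w)))" for s
    proof -
      have "cis (2 * pi * ((t - s) \<bullet> w)) = cis (2 * pi * (t \<bullet> w)) * cis (- 2 * pi * (s \<bullet> w))"
        by (simp add: cis_mult inner_diff_left algebra_simps)
      then show ?thesis by (simp only: mult_ac)
    qed
    have "(\<integral>s. ?H w s \<partial>lborel) = (\<integral>s. (?G w * cis (2 * pi * (t \<bullet> w))) * (k s * cis (- 2 * pi * (s \<bullet> w))) \<partial>lborel)"
      by (intro Bochner_Integration.integral_cong refl *)
    then show ?thesis unfolding integral_mult_right_zero fourier_def by (simp only: mult_ac)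
  qed
  then have "(\<integral>w. ?G w * fourier k w * cis (2 * pi * (t \<bullet> w)) \<partial>lborel) = (\<integral>w. \<integral>s. ?H w s \<partial>lborel \<partial>lborel)"
    by simp
  also have "\<dots> = (\<integral>s. k s * complex_of_real (gauss_density ((t - s) /\<^sub>R d) / d ^ DIM('a)) \<partial>lborel)"
  proof (unfold F, rule Bochner_Integration.integral_cong[OF refl])
    fix s
    have "(\<integral>w. ?H w s \<partial>lborel) = (\<integral>w. k s * (?G w * cis (2 * pi * ((t - s) \<bullet> w))) \<partial>lborel)"
      by (simp add: mult_ac)
    also have "\<dots> = k s * complex_of_real (gauss_density ((t - s) /\<^sub>R d) / d ^ DIM('a))"
      by (simp only: integral_mult_right_zero gauss_scaled_fourier(2)[OF d])
    finally show "(\<integral>w. ?H w s \<partial>lborel) = k s * complex_of_real (gauss_density ((t - s) /\<^sub>R d) / d ^ DIM('a))" .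
  qed
  also have "\<dots> = \<bar>- d\<bar> ^ DIM('a) *\<^sub>R (\<integral>x. k (t + (- d) *\<^sub>R x) * complex_of_real (gauss_density ((t - (t + (- d) *\<^sub>R x)) /\<^sub>R d) / d ^ DIM('a)) \<partial>lborel)"
    by (rule lborel_integral_affine) (use d in auto)
  also have "\<dots> = (\<integral>x. complex_of_real (gauss_density x) * k (t - d *\<^sub>R x) \<partial>lborel)"
  proof -
    have "(t - (t + (- d) *\<^sub>R x)) /\<^sub>R d = x" for x using d by simp
    then have "(\<integral>x. k (t + (- d) *\<^sub>R x) * complex_of_real (gauss_density ((t - (t + (- d) *\<^sub>R x)) /\<^sub>R d) / d ^ DIM('a)) \<partial>lborel)
       = (\<integral>x. (complex_of_real (gauss_density x) * k (t - d *\<^sub>R x)) / d ^ DIM('a) \<partial>lborel)"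
      by (simp only:) (simp add: mult_ac)
    then show ?thesis using d by (simp add: scaleR_conv_of_real)
  qed
  finally show ?thesis .
qed

lemma lim_inverse_Suc: "(\<lambda>n. 1 / real (Suc n)) \<longlonglongrightarrow> 0"
  using LIMSEQ_inverse_real_of_nat by (simp add: inverse_eq_divide)

lemma gauss_average_tendsto:
  fixes k :: "'a::euclidean_space \<Rightarrow> complex"
  assumes [measurable]: "k \<in> borel_measurable borel" and B: "\<And>x. norm (k x) \<le> B" and c: "isCont k t"
  shows "(\<lambda>n. \<integral>x. complex_of_real (gauss_density x) * k (t - (1 / real (Suc n)) *\<^sub>R x) \<partial>lborel) \<longlonglongrightarrow> k t"
proof -
  have "(\<lambda>n. \<integral>x. complex_of_real (gauss_density x) * k (t - (1 / real (Suc n)) *\<^sub>R x) \<partial>lborel)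
     \<longlonglongrightarrow> (\<integral>x. complex_of_real (gauss_density (x::'a)) * k t \<partial>lborel)"
  proof (rule integral_dominated_convergence)
    show "integrable lborel (\<lambda>x::'a. gauss_density x * B)"
      by (intro integrable_mult_left gauss_density_integral)
    show "AE x in lborel. (\<lambda>n. complex_of_real (gauss_density x) * k (t - (1 / real (Suc n)) *\<^sub>R x)) \<longlonglongrightarrow> complex_of_real (gauss_density x) * k t"
    proof (rule AE_I2)
      fix x :: 'a
      have "(\<lambda>n. (1 / real (Suc n)) *\<^sub>R x) \<longlonglongrightarrow> 0 *\<^sub>R x"
        by (intro tendsto_scaleR tendsto_const lim_inverse_Suc)
      then have "(\<lambda>n. t - (1 / real (Suc n)) *\<^sub>R x) \<longlonglongrightarrow> t - 0"
        by (intro tendsto_diff tendsto_const) simp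
      then have "(\<lambda>n. k (t - (1 / real (Suc n)) *\<^sub>R x)) \<longlonglongrightarrow> k t"
        by (intro isCont_tendsto_compose[OF c]) simp
      then show "(\<lambda>n. complex_of_real (gauss_density x) * k (t - (1 / real (Suc n)) *\<^sub>R x)) \<longlonglongrightarrow> complex_of_real (gauss_density x) * k t"
        by (intro tendsto_mult tendsto_const)
    qed
    show "AE x in lborel. norm (complex_of_real (gauss_density x) * k (t - (1 / real (Suc n)) *\<^sub>R x)) \<le> gauss_density x * B" for n
      by (intro AE_I2) (auto simp: norm_mult intro!: mult_left_mono B less_imp_le[OF gauss_density_pos])
  qed auto
  also have "(\<integral>x. complex_of_real (gauss_density (x::'a)) * k t \<partial>lborel) = k t"
    using gauss_density_integral(2)[where 'a = 'a] by simp
  finally show ?thesis .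
qed

lemma gauss_tendsto_1: "(\<lambda>n. gauss ((2 * pi * (1 / real (Suc n))) *\<^sub>R w)) \<longlonglongrightarrow> 1"
proof -
  have "(\<lambda>n. exp (- (norm ((2 * pi * (1 / real (Suc n))) *\<^sub>R w))\<^sup>2 / 2)) \<longlonglongrightarrow> exp (- (norm ((2 * pi * 0) *\<^sub>R w))\<^sup>2 / 2)"
    by (intro tendsto_intros lim_inverse_Suc) simp
  then show ?thesis by (simp add: gauss_def)
qed

theorem fourier_inversion:
  fixes k :: "'a::euclidean_space \<Rightarrow> complex"
  assumes k: "integrable lborel k" and B: "\<And>x. norm (k x) \<le> B" and c: "isCont k t"
    and F: "integrable lborel (fourier k)"
  shows "(\<integral>w. fourier k w * cis (2 * pi * (t \<bullet> w)) \<partial>lborel) = k t"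
proof (rule LIMSEQ_unique)
  have [measurable]: "k \<in> borel_measurable borel" using borel_measurable_integrable[OF k] by simp
  let ?I = "\<lambda>n. \<integral>w. complex_of_real (gauss ((2 * pi * (1 / real (Suc n))) *\<^sub>R w)) * fourier k w * cis (2 * pi * (t \<bullet> w)) \<partial>lborel"
  show "?I \<longlonglongrightarrow> k t"
    using gauss_average_tendsto[OF _ B c] by (subst gauss_smoothing[OF k]) auto
  show "?I \<longlonglongrightarrow> (\<integral>w. fourier k w * cis (2 * pi * (t \<bullet> w)) \<partial>lborel)"
  proof (rule integral_dominated_convergence[where w = "\<lambda>w. norm (fourier k w)"])
    show "AE w in lborel. (\<lambda>n. complex_of_real (gauss ((2 * pi * (1 / real (Suc n))) *\<^sub>R w)) * fourier k w * cis (2 * pi * (t \<bullet> w)))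
       \<longlonglongrightarrow> fourier k w * cis (2 * pi * (t \<bullet> w))"
    proof (rule AE_I2)
      fix w :: 'a
      have "(\<lambda>n. complex_of_real (gauss ((2 * pi * (1 / real (Suc n))) *\<^sub>R w)) * fourier k w * cis (2 * pi * (t \<bullet> w)))
       \<longlonglongrightarrow> complex_of_real 1 * fourier k w * cis (2 * pi * (t \<bullet> w))"
        by (intro tendsto_intros tendsto_of_real gauss_tendsto_1)
      then show "(\<lambda>n. complex_of_real (gauss ((2 * pi * (1 / real (Suc n))) *\<^sub>R w)) * fourier k w * cis (2 * pi * (t \<bullet> w)))
       \<longlonglongrightarrow> fourier k w * cis (2 * pi * (t \<bullet> w))" by simp
    qed
    show "AE w in lborel. norm (complex_of_real (gauss ((2 * pi * (1 / real (Suc n))) *\<^sub>R w)) * fourier k w * cis (2 * pi * (t \<bullet> w))) \<le> norm (fourier k w)" for n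
      by (auto simp: norm_mult intro!: mult_left_le_one_le gauss_le_1 less_imp_le[OF gauss_pos])
  qed (auto intro!: integrable_norm F)
qed

text \<open>With the cutoff, the energy of the transform is the double integral of
  \<open>cnj (k t) k (t - d x)\<close> against a probability density in \<open>x\<close>. Bounding the product by half the sum
  of the squares and using translation invariance gives at most the energy of \<open>k\<close>; the cutoff is then
  removed by Fatou's lemma.\<close>

lemma fourier_bessel:
  fixes k :: "'a::euclidean_space \<Rightarrow> complex"
  assumes k: "integrable lborel k" and k2: "integrable lborel (\<lambda>x. (norm (k x))\<^sup>2)"
  shows "(\<integral>\<^sup>+w. ennreal ((norm (fourier k w))\<^sup>2) \<partial>lborel) \<le> (\<integral>\<^sup>+x. ennreal ((norm (k x))\<^sup>2) \<partial>lborel)"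
proof -
  have [measurable]: "k \<in> borel_measurable borel" using borel_measurable_integrable[OF k] by simp
  have [measurable]: "fourier k \<in> borel_measurable borel" by (rule fourier_measurable) measurable
  let ?K = "\<integral>\<^sup>+x. ennreal ((norm (k x))\<^sup>2) \<partial>lborel"
  have smoothed: "(\<integral>\<^sup>+w. ennreal (gauss ((2 * pi * d) *\<^sub>R w) * (norm (fourier k w))\<^sup>2) \<partial>lborel) \<le> ?K" if d: "d > 0" for d
  proof -
    let ?G = "\<lambda>w::'a. complex_of_real (gauss ((2 * pi * d) *\<^sub>R w))"
    have G: "integrable lborel ?G" using gauss_scaled_fourier(1)[OF d, of 0] by simp
    define C where "C = (\<integral>x. norm (k x) \<partial>lborel)"
    have C: "norm (fourier k w) \<le> C" for w unfolding C_def by (rule fourier_bound)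
    then have C0: "C \<ge> 0" using norm_ge_zero order_trans by blast
    have GF: "integrable lborel (\<lambda>w. ?G w * fourier k w)"
      using C by (intro Bochner_Integration.integrable_bound[OF integrable_mult_right[OF G, of C]])
        (auto simp: norm_mult mult.commute intro!: mult_right_mono order_trans[OF _ abs_ge_self] less_imp_le[OF gauss_pos])
    let ?H = "\<lambda>w t. ?G w * fourier k w * (cnj (k t) * cis (2 * pi * (t \<bullet> w)))"
    have ck: "integrable lborel (\<lambda>t. cnj (k t))" using k by simp
    have H: "integrable (lborel \<Otimes>\<^sub>M lborel) (case_prod ?H)"
      by (rule integrable_pair_bound[OF GF ck]) (auto simp: norm_mult)
    have cnjF: "(\<integral>t. cnj (k t) * cis (2 * pi * (t \<bullet> w)) \<partial>lborel) = cnj (fourier k w)" for w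
    proof -
      have "cnj (fourier k w) = (\<integral>x. cnj (k x * cis (- 2 * pi * (x \<bullet> w))) \<partial>lborel)"
        unfolding fourier_def by (rule Bochner_Integration.integral_cnj[symmetric])
      also have "\<dots> = (\<integral>t. cnj (k t) * cis (2 * pi * (t \<bullet> w)) \<partial>lborel)"
        by (rule Bochner_Integration.integral_cong) (simp_all only: complex_cnj_mult cis_cnj, simp)
      finally show ?thesis ..
    qed
    have I: "(\<integral>t. ?H w t \<partial>lborel) = complex_of_real (gauss ((2 * pi * d) *\<^sub>R w) * (norm (fourier k w))\<^sup>2)" for w
      unfolding integral_mult_right_zero cnjF
      by (simp add: mult.assoc flip: complex_norm_square)
    have J: "(\<integral>w. ?H w t \<partial>lborel) = cnj (k t) * (\<integral>x. complex_of_real (gauss_density x) * k (t - d *\<^sub>R x) \<partial>lborel)" for t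
    proof -
      have "(\<integral>w. ?H w t \<partial>lborel) = (\<integral>w. cnj (k t) * (?G w * fourier k w * cis (2 * pi * (t \<bullet> w))) \<partial>lborel)"
        by (simp only: mult_ac)
      then show ?thesis unfolding gauss_smoothing[OF k d, symmetric] integral_mult_right_zero .
    qed
    have int: "integrable lborel (\<lambda>w. complex_of_real (gauss ((2 * pi * d) *\<^sub>R w) * (norm (fourier k w))\<^sup>2))"
      using lborel_pair.integrable_fst[OF H] unfolding I .
    have eq: "complex_of_real (\<integral>w. gauss ((2 * pi * d) *\<^sub>R w) * (norm (fourier k w))\<^sup>2 \<partial>lborel) =
       (\<integral>t. cnj (k t) * (\<integral>x. complex_of_real (gauss_density x) * k (t - d *\<^sub>R x) \<partial>lborel) \<partial>lborel)"
      using lborel_pair.Fubini_integral[OF H] unfolding I J integral_complex_of_real by (rule sym)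
    have nn: "gauss ((2 * pi * d) *\<^sub>R w) * (norm (fourier k w))\<^sup>2 \<ge> 0" for w
      by (simp add: gauss_pos less_imp_le)
    have int': "integrable lborel (\<lambda>w. gauss ((2 * pi * d) *\<^sub>R w) * (norm (fourier k w))\<^sup>2)"
      using integrable_Re[OF int] unfolding Re_complex_of_real .
    have "(\<integral>\<^sup>+w. ennreal (gauss ((2 * pi * d) *\<^sub>R w) * (norm (fourier k w))\<^sup>2) \<partial>lborel) =
       ennreal (\<integral>w. gauss ((2 * pi * d) *\<^sub>R w) * (norm (fourier k w))\<^sup>2 \<partial>lborel)"
      by (rule nn_integral_eq_integral[OF int']) (simp add: nn)
    also have "\<dots> \<le> ennreal (norm (\<integral>t. cnj (k t) * (\<integral>x. complex_of_real (gauss_density x) * k (t - d *\<^sub>R x) \<partial>lborel) \<partial>lborel))"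
      unfolding eq[symmetric] by (intro ennreal_leI) simp
    also have "\<dots> \<le> (\<integral>\<^sup>+t. \<integral>\<^sup>+x. ennreal (norm (cnj (k t) * (complex_of_real (gauss_density x) * k (t - d *\<^sub>R x)))) \<partial>lborel \<partial>lborel)"
      unfolding integral_mult_right_zero[symmetric]
      by (rule order_trans[OF norm_integral_le_nn_integral])
         (intro nn_integral_mono norm_integral_le_nn_integral)
    also have "\<dots> \<le> (\<integral>\<^sup>+t. \<integral>\<^sup>+x. ennreal (gauss_density x * ((norm (k t))\<^sup>2 / 2 + (norm (k (t - d *\<^sub>R x)))\<^sup>2 / 2)) \<partial>lborel \<partial>lborel)"
    proof (intro nn_integral_mono ennreal_leI)
      fix t x
      have "norm (k t) * norm (k (t - d *\<^sub>R x)) \<le> (norm (k t))\<^sup>2 / 2 + (norm (k (t - d *\<^sub>R x)))\<^sup>2 / 2"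
        using sum_squares_bound[of "norm (k t)" "norm (k (t - d *\<^sub>R x))"] by simp
      from mult_left_mono[OF this less_imp_le[OF gauss_density_pos[of x]]]
      show "norm (cnj (k t) * (complex_of_real (gauss_density x) * k (t - d *\<^sub>R x))) \<le> gauss_density x * ((norm (k t))\<^sup>2 / 2 + (norm (k (t - d *\<^sub>R x)))\<^sup>2 / 2)"
        using gauss_density_pos[of x] by (simp add: norm_mult mult_ac)
    qed
    also have "\<dots> = (\<integral>\<^sup>+x. \<integral>\<^sup>+t. ennreal (gauss_density x * ((norm (k t))\<^sup>2 / 2 + (norm (k (t - d *\<^sub>R x)))\<^sup>2 / 2)) \<partial>lborel \<partial>lborel)"
      by (rule lborel_pair.Fubini') measurable
    also have "\<dots> = (\<integral>\<^sup>+x. ennreal (gauss_density (x::'a)) * ?K \<partial>lborel)"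
    proof (rule nn_integral_cong)
      fix x
      define h :: real where "h = 1 / 2"
      have h: "h \<ge> 0" "h + h = 1" "\<And>a. a / 2 = h * a" by (simp_all add: h_def)
      have "(\<integral>\<^sup>+t. ennreal (gauss_density x * ((norm (k t))\<^sup>2 / 2 + (norm (k (t - d *\<^sub>R x)))\<^sup>2 / 2)) \<partial>lborel)
        = (\<integral>\<^sup>+t. ennreal (gauss_density x) * (ennreal h * ennreal ((norm (k t))\<^sup>2) + ennreal h * ennreal ((norm (k (- (d *\<^sub>R x) + t)))\<^sup>2)) \<partial>lborel)"
        using less_imp_le[OF gauss_density_pos[of x]]
        unfolding h(3) using h(1)
        by (intro nn_integral_cong) (simp add: ennreal_mult[symmetric] ennreal_plus[symmetric] del: ennreal_plus)
      also have "\<dots> = ennreal (gauss_density x) * (ennreal h * ?K + ennreal h * (\<integral>\<^sup>+t. ennreal ((norm (k (- (d *\<^sub>R x) + t)))\<^sup>2) \<partial>lborel))"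
        by (simp add: nn_integral_cmult nn_integral_add)
      also have "(\<integral>\<^sup>+t. ennreal ((norm (k (- (d *\<^sub>R x) + t)))\<^sup>2) \<partial>lborel) = ?K"
        by (rule lborel_nn_integral_translate[of "\<lambda>t. ennreal ((norm (k t))\<^sup>2)"]) measurable
      also have "ennreal h * ?K + ennreal h * ?K = ?K"
        using h by (simp add: distrib_right[symmetric] ennreal_plus[symmetric] del: ennreal_plus)
      finally show "(\<integral>\<^sup>+t. ennreal (gauss_density x * ((norm (k t))\<^sup>2 / 2 + (norm (k (t - d *\<^sub>R x)))\<^sup>2 / 2)) \<partial>lborel) = ennreal (gauss_density x) * ?K" .
    qed
    also have "\<dots> = ?K"
    proof -
      have "(\<integral>\<^sup>+x. ennreal (gauss_density (x::'a)) \<partial>lborel) = ennreal 1"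
        unfolding gauss_density_integral(2)[where 'a = 'a, symmetric]
        by (intro nn_integral_eq_integral gauss_density_integral(1) AE_I2 less_imp_le[OF gauss_density_pos])
      then show ?thesis by (subst nn_integral_multc) auto
    qed
    finally show ?thesis .
  qed
  have "(\<integral>\<^sup>+w. ennreal ((norm (fourier k w))\<^sup>2) \<partial>lborel)
    = (\<integral>\<^sup>+w. liminf (\<lambda>n. ennreal (gauss ((2 * pi * (1 / real (Suc n))) *\<^sub>R w) * (norm (fourier k w))\<^sup>2)) \<partial>lborel)"
  proof (intro nn_integral_cong lim_imp_Liminf[symmetric])
    fix w
    have "(\<lambda>n. ennreal (gauss ((2 * pi * (1 / real (Suc n))) *\<^sub>R w) * (norm (fourier k w))\<^sup>2)) \<longlonglongrightarrow> ennreal (1 * (norm (fourier k w))\<^sup>2)"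
      by (intro tendsto_ennrealI tendsto_intros gauss_tendsto_1)
    then show "(\<lambda>n. ennreal (gauss ((2 * pi * (1 / real (Suc n))) *\<^sub>R w) * (norm (fourier k w))\<^sup>2)) \<longlonglongrightarrow> ennreal ((norm (fourier k w))\<^sup>2)" by simp
  qed simp
  also have "\<dots> \<le> liminf (\<lambda>n. \<integral>\<^sup>+w. ennreal (gauss ((2 * pi * (1 / real (Suc n))) *\<^sub>R w) * (norm (fourier k w))\<^sup>2) \<partial>lborel)"
    by (rule nn_integral_liminf) measurable
  also have "\<dots> \<le> liminf (\<lambda>n. ?K)"
    by (intro Liminf_mono always_eventually allI smoothed) simp
  also have "\<dots> = ?K" by (simp add: Liminf_const)
  finally show ?thesis .
qed

section \<open>Differentiation under the integral sign\<close>

text \<open>The difference quotients are dominated because the mean value theorem bounds them by the partial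
  derivatives on a unit ball, so a local majorant of these suffices.\<close>

lemma has_derivative_integral:
  fixes G :: "'s::euclidean_space \<Rightarrow> 'a::euclidean_space \<Rightarrow> complex"
  assumes int: "\<And>t. integrable lborel (\<lambda>s. G s t)"
    and der: "\<And>s t. (G s has_derivative (\<lambda>h. \<Sum>b\<in>Basis. (h \<bullet> b) *\<^sub>R P b s t)) (at t)"
    and Pm: "\<And>b t. b \<in> Basis \<Longrightarrow> (\<lambda>s. P b s t) \<in> borel_measurable borel"
    and bd: "\<And>b s t. b \<in> Basis \<Longrightarrow> t \<in> ball t0 1 \<Longrightarrow> norm (P b s t) \<le> B s"
    and B: "integrable lborel B"
  shows "((\<lambda>t. \<integral>s. G s t \<partial>lborel) has_derivative (\<lambda>h. \<Sum>b\<in>Basis. (h \<bullet> b) *\<^sub>R (\<integral>s. P b s t0 \<partial>lborel))) (at t0)"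
proof -
  define D where "D s h = (\<Sum>b\<in>Basis. (h \<bullet> b) *\<^sub>R P b s t0)" for s h
  have P: "integrable lborel (\<lambda>s. P b s t0)" if "b \<in> Basis" for b
    using Pm[OF that, of t0] bd[OF that, of t0]
    by (intro Bochner_Integration.integrable_bound[OF B]) (auto intro!: AE_I2 order_trans[OF _ abs_ge_self])
  have Dint: "integrable lborel (\<lambda>s. D s h)" for h
    unfolding D_def by (intro Bochner_Integration.integrable_sum integrable_scaleR_right P)
  have Deq: "(\<integral>s. D s h \<partial>lborel) = (\<Sum>b\<in>Basis. (h \<bullet> b) *\<^sub>R (\<integral>s. P b s t0 \<partial>lborel))" for h
    unfolding D_def by (simp add: P)
  have B0: "B s \<ge> 0" for s
    using order_trans[OF norm_ge_zero bd[OF SOME_Basis, of t0 s]] by simp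
  have comp_le: "norm (\<Sum>b\<in>Basis. (h \<bullet> b) *\<^sub>R P b s t) \<le> real DIM('a) * B s * norm h" if "t \<in> ball t0 1" for s t h
  proof -
    have "norm (\<Sum>b\<in>Basis. (h \<bullet> b) *\<^sub>R P b s t) \<le> (\<Sum>b\<in>(Basis::'a set). B s * norm h)"
    proof (rule sum_norm_le)
      fix b :: 'a assume b: "b \<in> Basis"
      have "norm ((h \<bullet> b) *\<^sub>R P b s t) = \<bar>h \<bullet> b\<bar> * norm (P b s t)" by simp
      also have "\<dots> \<le> norm h * B s" by (intro mult_mono Basis_le_norm b bd that) auto
      finally show "norm ((h \<bullet> b) *\<^sub>R P b s t) \<le> B s * norm h" by (simp add: mult.commute)
    qed
    then show ?thesis by (simp add: mult.assoc)
  qed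
  have lip: "norm (G s (t0 + h) - G s t0) \<le> real DIM('a) * B s * norm h" if "norm h < 1" for s h
  proof -
    have "norm (G s (t0 + h) - G s t0) \<le> real DIM('a) * B s * norm (t0 + h - t0)"
    proof (rule differentiable_bound[where S = "ball t0 1"])
      show "(G s has_derivative (\<lambda>h. \<Sum>b\<in>Basis. (h \<bullet> b) *\<^sub>R P b s t)) (at t within ball t0 1)" for t
        using der by (rule has_derivative_at_withinI)
      show "onorm (\<lambda>h. \<Sum>b\<in>Basis. (h \<bullet> b) *\<^sub>R P b s t) \<le> real DIM('a) * B s" if "t \<in> ball t0 1" for t
        by (rule onorm_le) (rule comp_le[OF that])
    qed (use that in \<open>auto simp: dist_norm\<close>)
    then show ?thesis by simp
  qed
  have "(\<lambda>h. norm ((\<integral>s. G s (t0 + h) \<partial>lborel) - (\<integral>s. G s t0 \<partial>lborel) - (\<integral>s. D s h \<partial>lborel)) / norm h) \<midarrow>0\<rightarrow> 0"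
    unfolding tendsto_at_iff_sequentially
  proof (intro allI impI)
    fix X :: "nat \<Rightarrow> 'a" assume X: "\<forall>i. X i \<in> UNIV - {0}" and X0: "X \<longlonglongrightarrow> 0"
    obtain N where N: "\<And>i. i \<ge> N \<Longrightarrow> norm (X i) < 1"
      using LIMSEQ_D[OF X0, of 1] by auto
    define Y where "Y i = X (i + N)" for i
    have Y: "Y i \<noteq> 0" "norm (Y i) < 1" for i using X N[of "i + N"] by (auto simp: Y_def)
    have Y0: "Y \<longlonglongrightarrow> 0" unfolding Y_def using X0 by (rule LIMSEQ_ignore_initial_segment)
    define q where "q i s = (G s (t0 + Y i) - G s t0 - D s (Y i)) /\<^sub>R norm (Y i)" for i s
    have "(\<lambda>i. \<integral>s. q i s \<partial>lborel) \<longlonglongrightarrow> (\<integral>s. 0 \<partial>(lborel :: 's measure))"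
    proof (rule integral_dominated_convergence[where w = "\<lambda>s. 2 * real DIM('a) * B s"])
      show "q i \<in> borel_measurable lborel" for i
        unfolding q_def using int[of "t0 + Y i"] int[of t0] Dint[of "Y i"]
        by (intro borel_measurable_scaleR borel_measurable_diff borel_measurable_integrable) auto
      show "integrable lborel (\<lambda>s. 2 * real DIM('a) * B s)" using B by simp
      show "AE s in lborel. (\<lambda>i. q i s) \<longlonglongrightarrow> 0"
      proof (rule AE_I2)
        fix s
        have "(\<lambda>h. norm (G s (t0 + h) - G s t0 - D s h) / norm h) \<midarrow>0\<rightarrow> 0"
          using der[of s t0] unfolding has_derivative_at D_def by simp
        then have "((\<lambda>h. norm (G s (t0 + h) - G s t0 - D s h) / norm h) \<circ> Y) \<longlonglongrightarrow> 0"
          unfolding tendsto_at_iff_sequentially using Y Y0 by blast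
        then have "(\<lambda>i. norm (q i s)) \<longlonglongrightarrow> 0"
          by (simp add: q_def o_def divide_inverse mult.commute)
        then show "(\<lambda>i. q i s) \<longlonglongrightarrow> 0" by (rule tendsto_norm_zero_cancel)
      qed
      show "AE s in lborel. norm (q i s) \<le> 2 * real DIM('a) * B s" for i
      proof (rule AE_I2)
        fix s
        have "norm (G s (t0 + Y i) - G s t0 - D s (Y i)) \<le> norm (G s (t0 + Y i) - G s t0) + norm (D s (Y i))"
          by (rule norm_triangle_ineq4)
        also have "\<dots> \<le> real DIM('a) * B s * norm (Y i) + real DIM('a) * B s * norm (Y i)"
          unfolding D_def by (intro add_mono lip comp_le Y) auto
        finally have "norm (G s (t0 + Y i) - G s t0 - D s (Y i)) / norm (Y i) \<le> 2 * real DIM('a) * B s"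
          using Y(1)[of i] by (simp add: pos_divide_le_eq mult_ac)
        then show "norm (q i s) \<le> 2 * real DIM('a) * B s"
          by (simp add: q_def divide_inverse mult.commute)
      qed
    qed simp
    then have "(\<lambda>i. norm (\<integral>s. q i s \<partial>lborel)) \<longlonglongrightarrow> 0"
      using tendsto_norm_zero by simp
    moreover have "norm (\<integral>s. q i s \<partial>lborel) = norm ((\<integral>s. G s (t0 + Y i) \<partial>lborel) - (\<integral>s. G s t0 \<partial>lborel) - (\<integral>s. D s (Y i) \<partial>lborel)) / norm (Y i)" for i
      unfolding q_def by (simp add: int Dint divide_inverse mult.commute)
    ultimately have "(\<lambda>i. ((\<lambda>h. norm ((\<integral>s. G s (t0 + h) \<partial>lborel) - (\<integral>s. G s t0 \<partial>lborel) - (\<integral>s. D s h \<partial>lborel)) / norm h) \<circ> X) (i + N)) \<longlonglongrightarrow> 0"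
      by (simp add: Y_def)
    then show "((\<lambda>h. norm ((\<integral>s. G s (t0 + h) \<partial>lborel) - (\<integral>s. G s t0 \<partial>lborel) - (\<integral>s. D s h \<partial>lborel)) / norm h) \<circ> X) \<longlonglongrightarrow> 0"
      by (rule LIMSEQ_offset)
  qed
  then show ?thesis
    unfolding has_derivative_at Deq[symmetric]
    by (intro conjI) (simp add: Deq, intro bounded_linear_sum bounded_linear_scaleR_const bounded_linear_inner_left)
qed

section \<open>The Fourier transform on Schwartz functions\<close>

lemmas schwartz_rapid = smooth_class_bound[where B = rapid, folded schwartz_eq]
lemmas schwartz_pd = smooth_class_pd[where B = rapid, folded schwartz_eq]
lemmas schwartz_has_derivative = smooth_class_has_derivative[where B = rapid, folded schwartz_eq]
lemmas schwartz_continuous = smooth_class_continuous[where B = rapid, folded schwartz_eq]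
lemmas schwartz_measurable [measurable_dest] = smooth_class_measurable[where B = rapid, folded schwartz_eq]
lemmas schwartz_add = smooth_class_add[where B = rapid, OF additive_rapid, folded schwartz_eq]
lemmas schwartz_cmult = smooth_class_cmult[where B = rapid, OF additive_rapid, folded schwartz_eq]

lemma schwartz_integrable: "f \<in> schwartz \<Longrightarrow> integrable lborel f"
  by (intro rapid_integrable schwartz_rapid schwartz_measurable)

lemma schwartz_isCont: "f \<in> schwartz \<Longrightarrow> isCont f x"
  using schwartz_continuous[of f] by (simp add: continuous_on_eq_continuous_at)

lemma schwartz_bounded:
  assumes "f \<in> schwartz"
  obtains C where "\<And>x. norm (f x) \<le> C"
  using rapidE[OF schwartz_rapid[OF assms], of 0] by auto

lemma schwartz_compose_affine:
  fixes l :: "'b::euclidean_space \<Rightarrow> 'a::euclidean_space"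
  assumes l: "bounded_linear l" and le: "\<And>x. norm x \<le> norm (a + l x)" and f: "f \<in> schwartz"
  shows "(\<lambda>x. f (a + l x)) \<in> schwartz"
  unfolding schwartz_eq
proof (rule smooth_class_compose[OF l additive_rapid _ f[unfolded schwartz_eq]])
  fix f :: "'a \<Rightarrow> complex" assume f: "rapid f"
  show "rapid (\<lambda>x. f (a + l x))"
    unfolding rapid_def
  proof
    fix N
    obtain C where C: "\<And>x. (1 + norm x) ^ N * norm (f x) \<le> C" using rapidE[OF f] by metis
    have "(1 + norm x) ^ N * norm (f (a + l x)) \<le> C" for x
      by (rule order_trans[OF _ C[of "a + l x"]]) (intro mult_right_mono power_mono add_left_mono le; simp)
    then show "\<exists>C. \<forall>x. (1 + norm x) ^ N * norm (f (a + l x)) \<le> C" by blast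
  qed
qed

lemma rapid_cnj: "rapid f \<Longrightarrow> rapid (\<lambda>x. cnj (f x))"
  by (simp add: rapid_def)

lemma schwartz_cnj: "f \<in> schwartz \<Longrightarrow> (\<lambda>x. cnj (f x)) \<in> schwartz"
  unfolding schwartz_eq by (rule smooth_class_cnj[where B = rapid, OF rapid_cnj])

lemma slow_class_cis_linear: "(\<lambda>x. cis (r * (x \<bullet> w))) \<in> smooth_class slow"
  by (rule slow_class_cis) (use slow_class_linear[of 0 1 w] in simp)

lemma schwartz_modulate: "f \<in> schwartz \<Longrightarrow> (\<lambda>x. f x * cis (r * (x \<bullet> w))) \<in> schwartz"
  by (rule schwartz_mult_slow[OF _ slow_class_cis_linear])

lemma schwartz_coordinate: "f \<in> schwartz \<Longrightarrow> (\<lambda>x. f x * complex_of_real (x \<bullet> w)) \<in> schwartz"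
  using schwartz_mult_slow[OF _ slow_class_linear[of 0 1 w]] by simp

text \<open>Translation invariance makes the integral of a translate constant in the translation; its
  derivative is the integral of the partial derivative.\<close>

lemma integral_pd_zero:
  fixes f :: "'a::euclidean_space \<Rightarrow> complex"
  assumes f: "f \<in> schwartz" and b: "b \<in> Basis"
  shows "(\<integral>x. pd b f x \<partial>lborel) = 0"
proof -
  let ?N = "2 * DIM('a)"
  have "\<exists>C. \<forall>x. norm (pd c f x) \<le> C * decay ?N x" if "c \<in> Basis" for c
    using rapid_bound_decay[OF schwartz_rapid[OF schwartz_pd[OF f that]]] by metis
  then obtain C where C: "\<And>c x. c \<in> Basis \<Longrightarrow> norm (pd c f x) \<le> C c * decay ?N x" by metis
  define K where "K = (\<Sum>c\<in>(Basis::'a set). \<bar>C c\<bar>)"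
  have K: "norm (pd c f x) \<le> K * decay ?N x" if "c \<in> Basis" for c x
  proof -
    have "C c \<le> K" unfolding K_def
      using member_le_sum[of c Basis "\<lambda>c. \<bar>C c\<bar>"] that by auto
    then show ?thesis using C[OF that, of x] by (meson decay_nonneg mult_right_mono order_trans)
  qed
  have K0: "K \<ge> 0" by (simp add: K_def sum_nonneg)
  have shift: "decay ?N (s + t) \<le> 2 ^ ?N * decay ?N s" if "t \<in> ball 0 1" for s t :: 'a
  proof -
    have "norm s \<le> norm (s + t) + norm t" using norm_triangle_ineq4[of "s + t" t] by simp
    then have "1 + norm s \<le> 2 * (1 + norm (s + t))" 
    proof -
      have "norm t < 1" using that by simp
      with \<open>norm s \<le> _\<close> show ?thesis using norm_ge_zero[of "s + t"] by (simp only: distrib_left)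
    qed
    then have "(1 + norm s) ^ ?N \<le> (2 * (1 + norm (s + t))) ^ ?N" by (intro power_mono) auto
    then have "(1 + norm s) ^ ?N \<le> 2 ^ ?N * (1 + norm (s + t)) ^ ?N" by (simp only: power_mult_distrib)
    moreover have "(1 + norm (s + t)) ^ ?N > 0" by (simp add: add_pos_nonneg)
    ultimately have "(1 + norm s) ^ ?N * decay ?N (s + t) \<le> 2 ^ ?N"
      unfolding decay_def by (simp add: field_simps)
    then show ?thesis unfolding le_decay_iff .
  qed
  have [measurable]: "f \<in> borel_measurable borel" using f by measurable
  have fm: "pd c f \<in> borel_measurable borel" if "c \<in> Basis" for c
    using schwartz_pd[OF f that] by measurable
  have "((\<lambda>t. \<integral>s. f (s + t) \<partial>lborel) has_derivative (\<lambda>h. \<Sum>c\<in>Basis. (h \<bullet> c) *\<^sub>R (\<integral>s. pd c f (s + 0) \<partial>lborel))) (at 0)"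
  proof (rule has_derivative_integral[where B = "\<lambda>s. K * 2 ^ ?N * decay ?N s"])
    show "integrable lborel (\<lambda>s. f (s + t))" for t
      using lborel_integral_affine(2)[of 1 f t] schwartz_integrable[OF f] by (simp add: add.commute)
    show "((\<lambda>t. f (s + t)) has_derivative (\<lambda>h. \<Sum>b\<in>Basis. (h \<bullet> b) *\<^sub>R pd b f (s + t))) (at t)" for s t
    proof (rule has_derivative_compose[of "\<lambda>t. s + t" "\<lambda>h. h"])
      show "((\<lambda>t. s + t) has_derivative (\<lambda>h. h)) (at t)" by (auto intro!: derivative_eq_intros)
    qed (rule schwartz_has_derivative[OF f])
    show "(\<lambda>s. pd c f (s + t)) \<in> borel_measurable borel" if "c \<in> Basis" for c t
      using fm[OF that] by measurable
    show "norm (pd c f (s + t)) \<le> K * 2 ^ ?N * decay ?N s" if "c \<in> Basis" "t \<in> ball 0 1" for c s t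
      using order_trans[OF K[OF that(1), of "s + t"] mult_left_mono[OF shift[OF that(2)] K0]] by (simp add: mult_ac)
    show "integrable lborel (\<lambda>s::'a. K * 2 ^ ?N * decay ?N s)"
      by (intro integrable_mult_right integrable_decay) simp
  qed
  moreover have "(\<lambda>t. \<integral>s. f (s + t) \<partial>lborel) = (\<lambda>t. \<integral>s. f s \<partial>lborel)"
    using lborel_integral_affine(1)[of 1 f] by (auto simp: add.commute)
  ultimately have "((\<lambda>t::'a. \<integral>s. f s \<partial>lborel) has_derivative (\<lambda>h. \<Sum>c\<in>Basis. (h \<bullet> c) *\<^sub>R (\<integral>s. pd c f s \<partial>lborel))) (at 0)"
    by simp
  then have "(\<lambda>h. \<Sum>c\<in>Basis. (h \<bullet> c) *\<^sub>R (\<integral>s. pd c f s \<partial>lborel)) = (\<lambda>h. 0)"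
    by (rule has_derivative_unique) simp
  then have "(\<Sum>c\<in>Basis. (b \<bullet> c) *\<^sub>R (\<integral>s. pd c f s \<partial>lborel)) = 0" by metis
  then show ?thesis using b by (simp add: inner_Basis if_distrib if_distribR cong: if_cong)
qed

lemma pd_cis_linear:
  "((\<lambda>x. cis (r * (x \<bullet> w))) has_derivative (\<lambda>h. (\<i> * complex_of_real (r * (h \<bullet> w))) * cis (r * (x \<bullet> w)))) (at x)"
proof -
  have "((\<lambda>x. \<i> * complex_of_real (r * (x \<bullet> w))) has_derivative (\<lambda>h. \<i> * complex_of_real (r * (h \<bullet> w)))) (at x)"
    by (auto intro!: derivative_eq_intros)
  then have "((\<lambda>x. exp (\<i> * complex_of_real (r * (x \<bullet> w)))) has_derivative
      (\<lambda>h. exp (\<i> * complex_of_real (r * (x \<bullet> w))) * (\<i> * complex_of_real (r * (h \<bullet> w))))) (at x)"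
    by (rule has_derivative_compose)
      (use DERIV_exp[of "\<i> * complex_of_real (r * (x \<bullet> w))"] in \<open>simp add: has_field_derivative_def\<close>)
  then show ?thesis by (simp add: cis_conv_exp mult_ac)
qed

lemma fourier_pd:
  fixes f :: "'a::euclidean_space \<Rightarrow> complex"
  assumes f: "f \<in> schwartz" and b: "b \<in> Basis"
  shows "fourier (pd b f) w = 2 * pi * \<i> * (w \<bullet> b) * fourier f w"
proof -
  let ?e = "\<lambda>x. cis (- 2 * pi * (x \<bullet> w))"
  have fe: "(\<lambda>x. f x * ?e x) \<in> schwartz" by (rule schwartz_modulate[OF f])
  have fe': "(\<lambda>x. pd b f x * ?e x) \<in> schwartz" by (rule schwartz_modulate[OF schwartz_pd[OF f b]])
  have D: "((\<lambda>x. f x * ?e x) has_derivative (\<lambda>h. f x * ((\<i> * complex_of_real (- 2 * pi * (h \<bullet> w))) * ?e x) + (\<Sum>c\<in>Basis. (h \<bullet> c) *\<^sub>R pd c f x) * ?e x)) (at x)" for x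
    by (intro has_derivative_mult schwartz_has_derivative[OF f] pd_cis_linear)
  have "pd b (\<lambda>x. f x * ?e x) = (\<lambda>x. pd b f x * ?e x - (2 * pi * \<i> * (w \<bullet> b)) * (f x * ?e x))"
    unfolding pd_eq[OF D] using b by (auto simp: inner_Basis inner_commute if_distrib if_distribR algebra_simps cong: if_cong)
  then have "0 = (\<integral>x. pd b f x * ?e x - (2 * pi * \<i> * (w \<bullet> b)) * (f x * ?e x) \<partial>lborel)"
    using integral_pd_zero[OF fe b] by simp
  also have "\<dots> = fourier (pd b f) w - 2 * pi * \<i> * (w \<bullet> b) * fourier f w"
    unfolding fourier_def
    by (subst Bochner_Integration.integral_diff)
      (intro schwartz_integrable fe' integrable_mult_right fe, intro schwartz_integrable fe integrable_mult_right, simp only: integral_mult_right_zero)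
  finally show ?thesis by simp
qed

text \<open>Sums of \<open>L\<^sup>1\<close> norms of derivatives, arranged so that one more power of the frequency costs one
  step of the recursion.\<close>

primrec fourier_seminorm :: "nat \<Rightarrow> ('a::euclidean_space \<Rightarrow> complex) \<Rightarrow> real" where
  "fourier_seminorm 0 f = (\<integral>x. norm (f x) \<partial>lborel)"
| "fourier_seminorm (Suc n) f = fourier_seminorm n f + (\<Sum>b\<in>Basis. fourier_seminorm n (pd b f))"

lemma fourier_decay:
  assumes "f \<in> schwartz"
  shows "(1 + norm w) ^ n * norm (fourier f w) \<le> fourier_seminorm n f"
  using assms
proof (induction n arbitrary: f)
  case 0
  then show ?case using fourier_bound[of f w] by simp
next
  case (Suc n)
  have "(1 + norm w) ^ Suc n * norm (fourier f w) = (1 + norm w) ^ n * norm (fourier f w) + (1 + norm w) ^ n * (norm w * norm (fourier f w))"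
    by (simp add: algebra_simps)
  also have "norm w * norm (fourier f w) \<le> (\<Sum>b\<in>Basis. norm (fourier (pd b f) w))"
  proof -
    have "norm w * norm (fourier f w) \<le> (\<Sum>b\<in>Basis. \<bar>w \<bullet> b\<bar>) * norm (fourier f w)"
      by (intro mult_right_mono norm_le_l1) auto
    also have "\<dots> \<le> (\<Sum>b\<in>Basis. norm (fourier (pd b f) w))"
      unfolding sum_distrib_right
    proof (rule sum_mono)
      fix b :: 'a assume b: "b \<in> Basis"
      have "1 * (\<bar>w \<bullet> b\<bar> * norm (fourier f w)) \<le> (2 * pi) * (\<bar>w \<bullet> b\<bar> * norm (fourier f w))"
        using pi_ge_two by (intro mult_right_mono) auto
      then show "\<bar>w \<bullet> b\<bar> * norm (fourier f w) \<le> norm (fourier (pd b f) w)"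
        unfolding fourier_pd[OF Suc.prems b] by (simp add: norm_mult)
    qed
    finally show ?thesis .
  qed
  also have "(1 + norm w) ^ n * norm (fourier f w) + (1 + norm w) ^ n * (\<Sum>b\<in>Basis. norm (fourier (pd b f) w)) \<le> fourier_seminorm (Suc n) f"
    unfolding fourier_seminorm.simps sum_distrib_left
    by (intro add_mono sum_mono Suc schwartz_pd)
  finally show ?case by (simp add: mult_left_mono)
qed

lemma fourier_rapid: "f \<in> schwartz \<Longrightarrow> rapid (fourier f)"
  unfolding rapid_def using fourier_decay by blast

lemma fourier_has_derivative:
  fixes f :: "'a::euclidean_space \<Rightarrow> complex"
  assumes f: "f \<in> schwartz"
  shows "(fourier f has_derivative (\<lambda>h. \<Sum>b\<in>Basis. (h \<bullet> b) *\<^sub>R fourier (\<lambda>x. (- 2 * pi * \<i>) * (f x * complex_of_real (x \<bullet> b))) w)) (at w)"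
  unfolding fourier_def[abs_def]
proof (rule has_derivative_integral[where B = "\<lambda>s. 2 * pi * (norm s * norm (f s))"])
  have [measurable]: "f \<in> borel_measurable borel" using f by measurable
  show "integrable lborel (\<lambda>s. f s * cis (- 2 * pi * (s \<bullet> t)))" for t
    by (intro schwartz_integrable schwartz_modulate f)
  show "((\<lambda>t. f s * cis (- 2 * pi * (s \<bullet> t))) has_derivative
      (\<lambda>h. \<Sum>b\<in>Basis. (h \<bullet> b) *\<^sub>R ((- 2 * pi * \<i>) * (f s * complex_of_real (s \<bullet> b)) * cis (- 2 * pi * (s \<bullet> t))))) (at t)" for s t
  proof -
    have "(\<Sum>b\<in>Basis. (h \<bullet> b) *\<^sub>R ((- 2 * pi * \<i>) * (f s * complex_of_real (s \<bullet> b)) * cis (- 2 * pi * (s \<bullet> t))))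
       = f s * ((\<i> * complex_of_real (- 2 * pi * (h \<bullet> s))) * cis (- 2 * pi * (t \<bullet> s)))" for h
    proof -
      have "complex_of_real (h \<bullet> s) = (\<Sum>b\<in>Basis. complex_of_real (h \<bullet> b) * complex_of_real (s \<bullet> b))"
        by (subst euclidean_inner) simp
      then show ?thesis
        by (simp add: sum_distrib_left sum_distrib_right scaleR_conv_of_real inner_commute[of t s] sum_negf mult_ac)
    qed
    then show ?thesis
      using has_derivative_mult_right[OF pd_cis_linear[of "- 2 * pi" s t], of "f s"] by (simp add: inner_commute)
  qed
  show "(\<lambda>s. (- 2 * pi * \<i>) * (f s * complex_of_real (s \<bullet> b)) * cis (- 2 * pi * (s \<bullet> t))) \<in> borel_measurable borel" for b t
    by measurable
  show "norm ((- 2 * pi * \<i>) * (f s * complex_of_real (s \<bullet> b)) * cis (- 2 * pi * (s \<bullet> t))) \<le> 2 * pi * (norm s * norm (f s))" if "b \<in> Basis" for b s t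
    using mult_right_mono[OF Basis_le_norm[OF that, of s] norm_ge_zero[of "f s"]] by (simp add: norm_mult mult.commute)
  have "integrable lborel (\<lambda>s. complex_of_real (norm s) * f s)"
    by (rule rapid_slow_integrable[OF schwartz_rapid[OF f], of _ 1 1]) (auto simp: norm_mult mult_right_mono)
  from integrable_norm[OF this] show "integrable lborel (\<lambda>s. 2 * pi * (norm s * norm (f s)))"
    by (simp add: norm_mult)
qed

lemma fourier_schwartz:
  fixes f :: "'a::euclidean_space \<Rightarrow> complex"
  assumes "f \<in> schwartz" shows "fourier f \<in> schwartz"
  unfolding schwartz_eq
proof (rule smooth_class_coinduct[where X = "fourier ` schwartz"])
  show "fourier f \<in> fourier ` schwartz" using assms by blast
next
  fix p :: "'a \<Rightarrow> complex" assume "p \<in> fourier ` schwartz"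
  then obtain f where p: "p = fourier f" and f: "f \<in> schwartz" by blast
  note D = fourier_has_derivative[OF f]
  show "p differentiable_on UNIV" unfolding p by (rule differentiable_onI_UNIV[OF D])
  show "rapid p" unfolding p by (rule fourier_rapid[OF f])
  fix b :: 'a assume b: "b \<in> Basis"
  have "pd b p = fourier (\<lambda>x. (- 2 * pi * \<i>) * (f x * complex_of_real (x \<bullet> b)))"
    unfolding p pd_eq[OF D] using b by (auto simp: inner_Basis if_distrib if_distribR cong: if_cong)
  then show "pd b p \<in> fourier ` schwartz"
    using schwartz_cmult[OF schwartz_coordinate[OF f]] by blast
qed

section \<open>Partial Fourier transforms\<close>

lemma sum_Basis_pick:
  assumes "b \<in> Basis" shows "(\<Sum>c\<in>Basis. (b \<bullet> c) *\<^sub>R X c) = (X b :: complex)"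
  using assms by (simp add: inner_Basis if_distrib if_distribR cong: if_cong)

lemma slice_schwartz:
  assumes W: "W \<in> schwartz"
  shows "(\<lambda>s. W (x, s)) \<in> schwartz"
    and slice_pd: "b \<in> Basis \<Longrightarrow> pd b (\<lambda>s. W (x, s)) = (\<lambda>s. pd (0, b) W (x, s))"
proof -
  have l: "bounded_linear (\<lambda>s::'b. (0::'a, s))" by (intro bounded_linear_intros)
  have "(\<lambda>s. W ((x, 0) + (0, s))) \<in> schwartz"
    by (rule schwartz_compose_affine[OF l _ W]) (use norm_snd_le in auto)
  then show "(\<lambda>s. W (x, s)) \<in> schwartz" by simp
  assume b: "b \<in> Basis"
  have "((\<lambda>s. (x, s)) has_derivative (\<lambda>h. (0, h))) (at s)" for s :: 'b
    by (auto intro!: derivative_eq_intros)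
  then have D: "((\<lambda>s. W (x, s)) has_derivative (\<lambda>h. \<Sum>c\<in>Basis. ((0, h) \<bullet> c) *\<^sub>R pd c W (x, s))) (at s)" for s
    by (rule has_derivative_compose) (rule schwartz_has_derivative[OF W])
  have "(0 :: 'a, b) \<in> Basis" using b by (simp add: Basis_prod_def)
  then show "pd b (\<lambda>s. W (x, s)) = (\<lambda>s. pd (0, b) W (x, s))"
    unfolding pd_eq[OF D] by (simp only: sum_Basis_pick)
qed

lemma fourier_seminorm_nonneg: "fourier_seminorm n f \<ge> 0"
  by (induction n arbitrary: f) (auto intro!: sum_nonneg add_nonneg_nonneg)

text \<open>This bound, rapid in \<open>x\<close>, is what turns decay of the transform in the frequency for each fixed
  \<open>x\<close> into joint decay.\<close>

lemma slice_seminorm_bound: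
  fixes W :: "'a::euclidean_space \<times> 'b::euclidean_space \<Rightarrow> complex"
  assumes "W \<in> schwartz"
  shows "\<exists>C\<ge>0. \<forall>x. (1 + norm x) ^ N * fourier_seminorm n (\<lambda>s. W (x, s)) \<le> C"
  using assms
proof (induction n arbitrary: W)
  case 0
  let ?K = "2 * DIM('b)"
  obtain C where C: "C \<ge> 0" "\<And>z. norm (W z) \<le> C * decay (N + ?K) z"
    using rapid_bound_decay[OF schwartz_rapid[OF 0]] by metis
  define J where "J = (\<integral>s. decay ?K (s::'b) \<partial>lborel)"
  have "(1 + norm x) ^ N * fourier_seminorm 0 (\<lambda>s. W (x, s)) \<le> C * J" for x
  proof -
    have le: "(1 + norm x) ^ N * norm (W (x, s)) \<le> C * decay ?K s" for s
    proof -
      have x: "norm x \<le> norm (x, s)" and s: "norm s \<le> norm (x, s)"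
        using norm_fst_le[of x s] norm_snd_le[of s x] by auto
      have "(1 + norm x) ^ N * norm (W (x, s)) \<le> (1 + norm x) ^ N * (C * decay (N + ?K) (x, s))"
        by (intro mult_left_mono C) auto
      also have "\<dots> \<le> (1 + norm (x, s)) ^ N * (C * decay (N + ?K) (x, s))"
        using x C(1) by (intro mult_right_mono power_mono) auto
      also have "\<dots> = C * decay ?K (x, s)" using decay_power[of "(x, s)" N ?K] by (simp add: mult_ac)
      also have "\<dots> \<le> C * decay ?K s"
        unfolding decay_def using C(1) s
        by (intro mult_left_mono le_imp_inverse_le power_mono) (auto simp: add_pos_nonneg)
      finally show ?thesis .
    qed
    have "(1 + norm x) ^ N * fourier_seminorm 0 (\<lambda>s. W (x, s)) = (\<integral>s. (1 + norm x) ^ N * norm (W (x, s)) \<partial>lborel)"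
      by simp
    also have "\<dots> \<le> (\<integral>s. C * decay ?K (s::'b) \<partial>lborel)"
      by (intro integral_mono integrable_mult_right integrable_norm schwartz_integrable slice_schwartz[OF 0] integrable_decay le) simp
    finally show ?thesis by (simp add: J_def)
  qed
  moreover have "C * J \<ge> 0" using C(1) by (simp add: J_def)
  ultimately show ?case by blast
next
  case (Suc n)
  obtain C0 where C0: "C0 \<ge> 0" "\<And>x. (1 + norm x) ^ N * fourier_seminorm n (\<lambda>s. W (x, s)) \<le> C0"
    using Suc.IH[OF Suc.prems] by blast
  have "\<exists>C. \<forall>x. (1 + norm x) ^ N * fourier_seminorm n (\<lambda>s. pd (0, b) W (x, s)) \<le> C" if "b \<in> Basis" for b :: 'b
    using Suc.IH[OF schwartz_pd[OF Suc.prems, of "(0, b)"]] that by (auto simp: Basis_prod_def)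
  then obtain C where C: "\<And>b x. b \<in> Basis \<Longrightarrow> (1 + norm x) ^ N * fourier_seminorm n (\<lambda>s. pd (0, b) W (x, s)) \<le> C b" by metis
  have "(1 + norm x) ^ N * fourier_seminorm (Suc n) (\<lambda>s. W (x, s)) \<le> C0 + (\<Sum>b\<in>Basis. C b)" for x
    unfolding fourier_seminorm.simps distrib_left sum_distrib_left
    by (intro add_mono sum_mono C0) (simp add: slice_pd[OF Suc.prems] C)
  moreover from this[of 0] have "C0 + (\<Sum>b\<in>Basis. C b) \<ge> 0"
    using fourier_seminorm_nonneg[of "Suc n" "\<lambda>s. W (0, s)"] by simp
  ultimately show ?case by blast
qed

lemma partial_fourier_rapid:
  fixes W :: "'a::euclidean_space \<times> 'b::euclidean_space \<Rightarrow> complex"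
  assumes W: "W \<in> schwartz"
  shows "rapid (\<lambda>(x, w). fourier (\<lambda>s. W (x, s)) (- w))"
  unfolding rapid_def
proof
  fix N
  obtain C where C: "\<And>x. (1 + norm x) ^ N * fourier_seminorm N (\<lambda>s. W (x, s)) \<le> C"
    using slice_seminorm_bound[OF W] by metis
  have "(1 + norm (x, w)) ^ N * norm (fourier (\<lambda>s. W (x, s)) (- w)) \<le> C" for x w
  proof -
    have "1 + norm (x, w) \<le> 1 + (norm x + norm w)" by (intro add_left_mono norm_Pair_le)
    also have "\<dots> \<le> (1 + norm x) * (1 + norm w)" by (simp add: algebra_simps)
    finally have "(1 + norm (x, w)) ^ N \<le> ((1 + norm x) * (1 + norm w)) ^ N" by (intro power_mono) auto
    then have "(1 + norm (x, w)) ^ N * norm (fourier (\<lambda>s. W (x, s)) (- w)) \<le> ((1 + norm x) * (1 + norm w)) ^ N * norm (fourier (\<lambda>s. W (x, s)) (- w))"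
      by (intro mult_right_mono) auto
    also have "\<dots> = (1 + norm x) ^ N * ((1 + norm (- w)) ^ N * norm (fourier (\<lambda>s. W (x, s)) (- w)))"
      by (simp add: power_mult_distrib mult_ac)
    also have "\<dots> \<le> (1 + norm x) ^ N * fourier_seminorm N (\<lambda>s. W (x, s))"
      by (intro mult_left_mono fourier_decay slice_schwartz[OF W]) auto
    also have "\<dots> \<le> C" by (rule C)
    finally show ?thesis .
  qed
  then show "\<exists>C. \<forall>z. (1 + norm z) ^ N * norm (case z of (x, w) \<Rightarrow> fourier (\<lambda>s. W (x, s)) (- w)) \<le> C" by auto
qed

text \<open>One factor decays in \<open>s\<close> and the other in \<open>s - x\<close>; together these control \<open>(x, s)\<close>.\<close>

lemma translate_product_schwartz:
  fixes f g :: "'a::euclidean_space \<Rightarrow> complex"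
  assumes f: "f \<in> schwartz" and g: "g \<in> schwartz"
  shows "(\<lambda>z. f (snd z) * g (snd z - fst z)) \<in> schwartz"
proof -
  define B1 :: "('a \<times> 'a \<Rightarrow> complex) \<Rightarrow> bool" where "B1 F \<longleftrightarrow> (\<forall>N::nat. \<exists>C. \<forall>x s. (1 + norm s) ^ N * norm (F (x, s)) \<le> C)" for F
  define B2 :: "('a \<times> 'a \<Rightarrow> complex) \<Rightarrow> bool" where "B2 F \<longleftrightarrow> (\<forall>N::nat. \<exists>C. \<forall>x s. (1 + norm (s - x)) ^ N * norm (F (x, s)) \<le> C)" for F
  have l1: "bounded_linear (snd :: 'a \<times> 'a \<Rightarrow> 'a)" by (rule bounded_linear_snd)
  have l2: "bounded_linear (\<lambda>z::'a \<times> 'a. snd z - fst z)" by (intro bounded_linear_intros)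
  have "B1 (\<lambda>z. f (0 + snd z))" if "rapid f" for f :: "'a \<Rightarrow> complex"
    using that unfolding rapid_def B1_def by simp
  then have 1: "(\<lambda>z. f (0 + snd z)) \<in> smooth_class B1"
    by (rule smooth_class_compose[OF l1 additive_rapid _ f[unfolded schwartz_eq]])
  have "B2 (\<lambda>z. g (0 + (snd z - fst z)))" if "rapid g" for g :: "'a \<Rightarrow> complex"
    using that unfolding rapid_def B2_def by (simp, metis)
  then have 2: "(\<lambda>z. g (0 + (snd z - fst z))) \<in> smooth_class B2"
    by (rule smooth_class_compose[OF l2 additive_rapid _ g[unfolded schwartz_eq]])
  have "rapid (\<lambda>z. F z * G z)" if F: "B1 F" and G: "B2 G" for F G
    unfolding rapid_def
  proof
    fix N
    obtain C1 where C1: "\<And>x s. (1 + norm s) ^ (N + N) * norm (F (x, s)) \<le> C1" using F unfolding B1_def by metis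
    obtain C2 where C2: "\<And>x s. (1 + norm (s - x)) ^ N * norm (G (x, s)) \<le> C2" using G unfolding B2_def by metis
    have "(1 + norm (x, s)) ^ N * norm (F (x, s) * G (x, s)) \<le> C1 * C2" for x s
    proof -
      have "norm x \<le> norm s + norm (s - x)" using norm_triangle_ineq4[of s "s - x"] by simp
      then have "1 + norm (x, s) \<le> 1 + (norm s + norm (s - x) + norm s)" using norm_Pair_le[of x s] by linarith
      also have "\<dots> \<le> ((1 + norm s) * (1 + norm s)) * (1 + norm (s - x))" by (simp add: algebra_simps)
      finally have "(1 + norm (x, s)) ^ N \<le> (((1 + norm s) * (1 + norm s)) * (1 + norm (s - x))) ^ N"
        by (intro power_mono) auto
      then have "(1 + norm (x, s)) ^ N * norm (F (x, s) * G (x, s)) \<le> (((1 + norm s) * (1 + norm s)) * (1 + norm (s - x))) ^ N * norm (F (x, s) * G (x, s))"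
        by (intro mult_right_mono) auto
      also have "\<dots> = ((1 + norm s) ^ (N + N) * norm (F (x, s))) * ((1 + norm (s - x)) ^ N * norm (G (x, s)))"
        by (simp add: power_mult_distrib power_add norm_mult mult_ac)
      also have "\<dots> \<le> C1 * C2"
      proof (intro mult_mono C1 C2)
        have "0 \<le> (1 + norm s) ^ (N + N) * norm (F (x, s))" by simp
        then show "0 \<le> C1" using C1[of s x] by linarith
      qed auto
      finally show ?thesis .
    qed
    then show "\<exists>C. \<forall>z. (1 + norm z) ^ N * norm (F z * G z) \<le> C" by auto
  qed
  from smooth_class_mult[OF this additive_rapid 1 2] show ?thesis
    unfolding schwartz_eq by simp
qed

text \<open>The transpose of the synthesis map: a test function \<open>f\<close> is paired, bilinearly, with the shifted
  and modulated copies of \<open>g\<close>.\<close>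

definition stft_dual :: "('a::euclidean_space \<Rightarrow> complex) \<Rightarrow> ('a \<Rightarrow> complex) \<Rightarrow> 'a \<times> 'a \<Rightarrow> complex" where
  "stft_dual g f = (\<lambda>(x, w). \<integral>s. f s * g (s - x) * cis (2 * pi * (s \<bullet> w)) \<partial>lborel)"

lemma stft_dual_fourier: "stft_dual g f (x, w) = fourier (\<lambda>s. f s * g (s - x)) (- w)"
  by (simp add: stft_dual_def fourier_def)

lemma stft_dual_rapid:
  assumes "f \<in> schwartz" "g \<in> schwartz"
  shows "rapid (stft_dual g f)"
proof -
  have "stft_dual g f = (\<lambda>(x, w). fourier (\<lambda>s. f s * g (s - x)) (- w))"
    by (auto simp: stft_dual_fourier)
  then show ?thesis using partial_fourier_rapid[OF translate_product_schwartz[OF assms]] by simp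
qed

lemma stft_dual_measurable [measurable]:
  assumes [measurable]: "f \<in> borel_measurable borel" "g \<in> borel_measurable borel"
  shows "stft_dual g f \<in> borel_measurable borel"
  unfolding stft_dual_def borel_prod[symmetric] by measurable

section \<open>Smooth families and tempered distributions\<close>

lemma mixed_slice:
  fixes G :: "'z::euclidean_space \<times> 'a::euclidean_space \<Rightarrow> complex"
  assumes G: "G \<in> smooth_class mixed"
  shows mixed_slice_derivative: "((\<lambda>t. G (z, t)) has_derivative (\<lambda>h. \<Sum>b\<in>Basis. (h \<bullet> b) *\<^sub>R pd (0, b) G (z, t))) (at t)"
    and mixed_slice_pd: "b \<in> Basis \<Longrightarrow> pd b (\<lambda>t. G (z, t)) = (\<lambda>t. pd (0, b) G (z, t))"
    and mixed_param_derivative: "((\<lambda>z. G (z, t)) has_derivative (\<lambda>h. \<Sum>b\<in>Basis. (h \<bullet> b) *\<^sub>R pd (b, 0) G (z, t))) (at z)"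
proof -
  have B: "(\<Sum>c\<in>Basis. ((k, h) \<bullet> c) *\<^sub>R pd c G p) = (\<Sum>b\<in>Basis. (k \<bullet> b) *\<^sub>R pd (b, 0) G p) + (\<Sum>b\<in>Basis. (h \<bullet> b) *\<^sub>R pd (0, b) G p)"
    for k h p
    unfolding Basis_prod_def
    by (subst sum.union_disjoint) (auto simp: sum.reindex inj_on_def)
  have "((\<lambda>t. (z, t)) has_derivative (\<lambda>h. (0, h))) (at t)" for z t
    by (auto intro!: derivative_eq_intros)
  from has_derivative_compose[OF this smooth_class_has_derivative[OF G]]
  show D: "((\<lambda>t. G (z, t)) has_derivative (\<lambda>h. \<Sum>b\<in>Basis. (h \<bullet> b) *\<^sub>R pd (0, b) G (z, t))) (at t)" for z t
    unfolding B by simp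
  have "((\<lambda>z. (z, t)) has_derivative (\<lambda>h. (h, 0))) (at z)" for z t
    by (auto intro!: derivative_eq_intros)
  from has_derivative_compose[OF this smooth_class_has_derivative[OF G]]
  show "((\<lambda>z. G (z, t)) has_derivative (\<lambda>h. \<Sum>b\<in>Basis. (h \<bullet> b) *\<^sub>R pd (b, 0) G (z, t))) (at z)"
    unfolding B by simp
  show "pd b (\<lambda>t. G (z, t)) = (\<lambda>t. pd (0, b) G (z, t))" if "b \<in> Basis"
    unfolding pd_eq[OF D] using that by (simp only: sum_Basis_pick)
qed

lemma mixed_pd:
  assumes "G \<in> smooth_class mixed"
  shows "b \<in> Basis \<Longrightarrow> pd (0, b) G \<in> smooth_class mixed" "c \<in> Basis \<Longrightarrow> pd (c, 0) G \<in> smooth_class mixed"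
  by (rule smooth_class_pd[OF assms], simp add: Basis_prod_def)+

lemma mixed_slice_schwartz:
  fixes G :: "'z::euclidean_space \<times> 'a::euclidean_space \<Rightarrow> complex"
  assumes G: "G \<in> smooth_class mixed"
  shows "(\<lambda>t. G (z, t)) \<in> schwartz"
  unfolding schwartz_eq
proof (rule smooth_class_coinduct[where X = "{(\<lambda>t. G (z, t)) |G. G \<in> smooth_class mixed}"])
  show "(\<lambda>t. G (z, t)) \<in> {(\<lambda>t. G (z, t)) |G. G \<in> smooth_class mixed}" using G by blast
next
  fix p :: "'a \<Rightarrow> complex" assume "p \<in> {(\<lambda>t. G (z, t)) |G. G \<in> smooth_class mixed}"
  then obtain G :: "'z \<times> 'a \<Rightarrow> complex" where p: "p = (\<lambda>t. G (z, t))" and G: "G \<in> smooth_class mixed" by blast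
  show "p differentiable_on UNIV" unfolding p by (rule differentiable_onI_UNIV[OF mixed_slice_derivative[OF G]])
  show "rapid p" unfolding rapid_def p
  proof
    fix N
    obtain C K where "\<And>z t. (1 + norm t) ^ N * norm (G (z, t)) \<le> C * (1 + norm z) ^ K"
      using mixedE[OF smooth_class_bound[OF G]] by metis
    then show "\<exists>C. \<forall>t. (1 + norm t) ^ N * norm (G (z, t)) \<le> C" by blast
  qed
  fix b :: 'a assume b: "b \<in> Basis"
  show "pd b p \<in> {(\<lambda>t. G (z, t)) |G. G \<in> smooth_class mixed}"
    unfolding p mixed_slice_pd[OF G b] by (intro CollectI exI[of _ "pd (0, b) G"] conjI refl mixed_pd(1)[OF G b])
qed

lemma iter_deriv_mixed_slice:
  fixes G :: "'z::euclidean_space \<times> 'a::euclidean_space \<Rightarrow> complex"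
  assumes G: "G \<in> smooth_class mixed" and bs: "bs \<in> lists Basis"
  shows "iter_deriv (map (Pair 0) bs) G \<in> smooth_class mixed"
    and "iter_deriv bs (\<lambda>t. G (z, t)) = (\<lambda>t. iter_deriv (map (Pair 0) bs) G (z, t))"
proof -
  have *: "iter_deriv (map (Pair 0) bs) G \<in> smooth_class mixed" if "bs \<in> lists Basis" for bs :: "'a list"
    by (rule smooth_class_iter[OF G]) (use that in \<open>auto simp: Basis_prod_def\<close>)
  show "iter_deriv (map (Pair 0) bs) G \<in> smooth_class mixed" by (rule *[OF bs])
  show "iter_deriv bs (\<lambda>t. G (z, t)) = (\<lambda>t. iter_deriv (map (Pair 0) bs) G (z, t))"
    using bs
  proof (induction bs rule: list.induct)
    case (Cons b bs)
    then have bs: "bs \<in> lists Basis" and b: "b \<in> Basis" by auto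
    show ?case
      unfolding list.map iter_deriv_Cons_pd Cons.IH[OF bs] mixed_slice_pd[OF *[OF bs] b] ..
  qed simp
qed

lemma iter_deriv_lincomb:
  assumes "f \<in> schwartz" "h \<in> schwartz" "bs \<in> lists Basis"
  shows "iter_deriv bs (\<lambda>x. a * f x + b * h x) = (\<lambda>x. a * iter_deriv bs f x + b * iter_deriv bs h x)"
  using assms(3)
proof (induction bs rule: list.induct)
  case (Cons c bs)
  then have bs: "bs \<in> lists Basis" and c: "c \<in> Basis" by auto
  have S: "iter_deriv bs f \<in> schwartz" "iter_deriv bs h \<in> schwartz"
    using assms(1,2) smooth_class_iter[OF _ bs] unfolding schwartz_eq by auto
  have D: "((\<lambda>x. a * iter_deriv bs f x + b * iter_deriv bs h x) has_derivative
     (\<lambda>k. a * (\<Sum>c\<in>Basis. (k \<bullet> c) *\<^sub>R pd c (iter_deriv bs f) x) + b * (\<Sum>c\<in>Basis. (k \<bullet> c) *\<^sub>R pd c (iter_deriv bs h) x))) (at x)" for x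
    by (intro has_derivative_add has_derivative_mult_right schwartz_has_derivative S)
  show ?case
    unfolding iter_deriv_Cons_pd Cons.IH[OF bs] pd_eq[OF D] using c by (simp only: sum_Basis_pick)
qed simp

definition linear_on_schwartz :: "(('a::euclidean_space \<Rightarrow> complex) \<Rightarrow> complex) \<Rightarrow> bool" where
  "linear_on_schwartz L \<longleftrightarrow> (\<forall>f\<in>schwartz. \<forall>h\<in>schwartz. \<forall>a b. L (\<lambda>x. a * f x + b * h x) = a * L f + b * L h)"

lemma linear_iter_deriv: "bs \<in> lists Basis \<Longrightarrow> linear_on_schwartz (\<lambda>f. iter_deriv bs f t)"
  by (simp add: linear_on_schwartz_def iter_deriv_lincomb)

lemma linear_tempered: "u \<in> tempered \<Longrightarrow> linear_on_schwartz u"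
  by (simp add: linear_on_schwartz_def tempered_def)

lemma linear_on_schwartz_sum:
  assumes L: "linear_on_schwartz L" and Y: "finite Y" "Y \<noteq> {}" and k: "\<And>y. y \<in> Y \<Longrightarrow> k y \<in> schwartz"
  shows "(\<lambda>x. \<Sum>y\<in>Y. a y * k y x) \<in> schwartz" and "L (\<lambda>x. \<Sum>y\<in>Y. a y * k y x) = (\<Sum>y\<in>Y. a y * L (k y))"
proof -
  have scale: "L (\<lambda>x. c * f x) = c * L f" if "f \<in> schwartz" for c f
    using L that unfolding linear_on_schwartz_def by (metis (no_types, lifting) add.right_neutral mult_zero_left ext)
  have "(\<lambda>x. \<Sum>y\<in>Y. a y * k y x) \<in> schwartz \<and> L (\<lambda>x. \<Sum>y\<in>Y. a y * k y x) = (\<Sum>y\<in>Y. a y * L (k y))"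
    using Y k
  proof (induction Y rule: finite_ne_induct)
    case (singleton y)
    then show ?case by (simp add: scale schwartz_cmult)
  next
    case (insert y Y)
    then have IH: "(\<lambda>x. \<Sum>y\<in>Y. a y * k y x) \<in> schwartz" "L (\<lambda>x. \<Sum>y\<in>Y. a y * k y x) = (\<Sum>y\<in>Y. a y * L (k y))" by auto
    have ky: "k y \<in> schwartz" using insert by simp
    have "L (\<lambda>x. a y * k y x + 1 * (\<Sum>y\<in>Y. a y * k y x)) = a y * L (k y) + 1 * L (\<lambda>x. \<Sum>y\<in>Y. a y * k y x)"
      by (rule L[unfolded linear_on_schwartz_def, rule_format, OF ky IH(1)])
    moreover have "(\<lambda>x. a y * k y x + (\<Sum>y\<in>Y. a y * k y x)) \<in> schwartz"
      by (intro schwartz_add schwartz_cmult ky IH)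
    ultimately show ?case using insert IH by simp
  qed
  then show "(\<lambda>x. \<Sum>y\<in>Y. a y * k y x) \<in> schwartz" and "L (\<lambda>x. \<Sum>y\<in>Y. a y * k y x) = (\<Sum>y\<in>Y. a y * L (k y))" by auto
qed

lemma linear_on_schwartz_diff:
  assumes "linear_on_schwartz L" "f \<in> schwartz" "h \<in> schwartz"
  shows "L (\<lambda>x. f x - h x) = L f - L h"
proof -
  have "L (\<lambda>x. 1 * f x + (- 1) * h x) = 1 * L f + (- 1) * L h"
    using assms unfolding linear_on_schwartz_def by blast
  then show ?thesis by simp
qed

lemma schwartz_diff: "f \<in> schwartz \<Longrightarrow> h \<in> schwartz \<Longrightarrow> (\<lambda>x. f x - h x) \<in> schwartz"
  using schwartz_add[of f "\<lambda>x. (- 1) * h x"] schwartz_cmult[of h "- 1"] by simp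

lemma finite_short_lists: "finite {bs. set bs \<subseteq> (Basis :: 'a::euclidean_space set) \<and> length bs \<le> N}"
  by (rule finite_lists_length_le) simp

lemma schwartz_norm_le:
  assumes "\<And>bs x. bs \<in> lists Basis \<Longrightarrow> (1 + norm x) ^ N * norm (iter_deriv bs f x) \<le> c bs"
  shows "schwartz_norm N f \<le> (\<Sum>bs | set bs \<subseteq> Basis \<and> length bs \<le> N. c bs)"
  unfolding schwartz_norm_def
proof (rule sum_mono)
  fix bs :: "'a list" assume "bs \<in> {bs. set bs \<subseteq> Basis \<and> length bs \<le> N}"
  then have "bs \<in> lists Basis" by auto
  then show "(SUP x. (1 + norm x) ^ N * norm (iter_deriv bs f x)) \<le> c bs"
    by (intro cSUP_least assms) auto
qed

text \<open>The mean value theorem in the parameter, on a ball that contains both parameters.\<close>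

lemma mixed_lipschitz:
  fixes G :: "'z::euclidean_space \<times> 'a::euclidean_space \<Rightarrow> complex"
  assumes G: "G \<in> smooth_class mixed"
  shows "\<exists>C K. C \<ge> 0 \<and> (\<forall>z z' t. (1 + norm t) ^ N * norm (G (z, t) - G (z', t)) \<le> C * (1 + norm z + norm z') ^ K * norm (z - z'))"
proof -
  have "\<exists>C K. C \<ge> 0 \<and> (\<forall>z t. (1 + norm t) ^ N * norm (pd (c, 0) G (z, t)) \<le> C * (1 + norm z) ^ K)" if "c \<in> Basis" for c :: 'z
    using mixedE[OF smooth_class_bound[OF mixed_pd(2)[OF G that]]] by metis
  then obtain C K where CK: "\<And>c. c \<in> Basis \<Longrightarrow> C c \<ge> 0"
      "\<And>c z t. c \<in> Basis \<Longrightarrow> (1 + norm t) ^ N * norm (pd (c, 0) G (z, t)) \<le> C c * (1 + norm z) ^ K c"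
    by metis
  define C' K' where "C' = (\<Sum>c\<in>Basis. C c)" and "K' = (\<Sum>c\<in>Basis. K c)"
  have "(1 + norm t) ^ N * norm (G (z, t) - G (z', t)) \<le> C' * (1 + norm z + norm z') ^ K' * norm (z - z')" for z z' t
  proof -
    define p where "p = (1 + norm t) ^ N"
    have p: "p > 0" by (simp add: p_def add_pos_nonneg)
    define R where "R = norm z + norm z'"
    have R: "R \<ge> 0" by (simp add: R_def)
    have "norm (G (z, t) - G (z', t)) \<le> (C' * (1 + R) ^ K' / p) * norm (z - z')"
    proof (rule differentiable_bound[where S = "cball 0 R"])
      show "((\<lambda>z. G (z, t)) has_derivative (\<lambda>h. \<Sum>b\<in>Basis. (h \<bullet> b) *\<^sub>R pd (b, 0) G (y, t))) (at y within cball 0 R)" for y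
        by (rule has_derivative_at_withinI[OF mixed_param_derivative[OF G]])
      show "onorm (\<lambda>h. \<Sum>b\<in>Basis. (h \<bullet> b) *\<^sub>R pd (b, 0) G (y, t)) \<le> C' * (1 + R) ^ K' / p" if y: "y \<in> cball 0 R" for y
      proof (rule onorm_le)
        fix h :: 'z
        have "norm (\<Sum>b\<in>Basis. (h \<bullet> b) *\<^sub>R pd (b, 0) G (y, t)) \<le> (\<Sum>b\<in>Basis. C b * (1 + R) ^ K' / p * norm h)"
        proof (rule sum_norm_le)
          fix b :: 'z assume b: "b \<in> Basis"
          have "p * norm (pd (b, 0) G (y, t)) \<le> C b * (1 + norm y) ^ K b"
            unfolding p_def by (rule CK(2)[OF b])
          also have "\<dots> \<le> C b * (1 + R) ^ K b"
            using y CK(1)[OF b] by (intro mult_left_mono power_mono) auto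
          also have "\<dots> \<le> C b * (1 + R) ^ K'"
            using CK(1)[OF b] R member_le_sum[OF b, of K] unfolding K'_def
            by (intro mult_left_mono power_increasing) auto
          finally have "norm (pd (b, 0) G (y, t)) \<le> C b * (1 + R) ^ K' / p"
            using p by (simp add: pos_le_divide_eq mult.commute)
          moreover have "\<bar>h \<bullet> b\<bar> \<le> norm h" by (rule Basis_le_norm[OF b])
          ultimately have "\<bar>h \<bullet> b\<bar> * norm (pd (b, 0) G (y, t)) \<le> norm h * (C b * (1 + R) ^ K' / p)"
            by (intro mult_mono) auto
          then show "norm ((h \<bullet> b) *\<^sub>R pd (b, 0) G (y, t)) \<le> C b * (1 + R) ^ K' / p * norm h"
            by (simp add: mult.commute)
        qed
        also have "\<dots> = C' * (1 + R) ^ K' / p * norm h"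
          by (simp add: C'_def sum_distrib_right sum_divide_distrib)
        finally show "norm (\<Sum>b\<in>Basis. (h \<bullet> b) *\<^sub>R pd (b, 0) G (y, t)) \<le> C' * (1 + R) ^ K' / p * norm h" .
      qed
    qed (auto simp: R_def)
    then have "p * norm (G (z, t) - G (z', t)) \<le> p * ((C' * (1 + R) ^ K' / p) * norm (z - z'))"
      using p by (intro mult_left_mono) auto
    also have "\<dots> = C' * (1 + norm z + norm z') ^ K' * norm (z - z')"
      using p by (simp add: R_def add.assoc)
    finally show ?thesis by (simp add: p_def)
  qed
  moreover have "C' \<ge> 0" unfolding C'_def by (intro sum_nonneg CK)
  ultimately show ?thesis by blast
qed

text \<open>A tempered distribution sees only finitely many seminorms; collecting the constants for all
  derivatives makes the previous estimate applicable to it.\<close>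

lemma mixed_iter_lipschitz:
  fixes G :: "'z::euclidean_space \<times> 'a::euclidean_space \<Rightarrow> complex"
  assumes G: "G \<in> smooth_class mixed"
  obtains c k where "\<And>bs. c bs \<ge> (0::real)"
    "\<And>bs z z' t. bs \<in> lists Basis \<Longrightarrow> (1 + norm t) ^ N * norm (iter_deriv bs (\<lambda>t. G (z, t)) t - iter_deriv bs (\<lambda>t. G (z', t)) t)
       \<le> c bs * (1 + norm z + norm z') ^ (k bs :: nat) * norm (z - z')"
proof -
  have "\<exists>C K. C \<ge> 0 \<and> (bs \<in> lists Basis \<longrightarrow> (\<forall>z z' t. (1 + norm t) ^ N * norm (iter_deriv bs (\<lambda>t. G (z, t)) t - iter_deriv bs (\<lambda>t. G (z', t)) t)
      \<le> C * (1 + norm z + norm z') ^ K * norm (z - z')))" for bs :: "'a list"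
  proof (cases "bs \<in> lists Basis")
    case True
    show ?thesis using mixed_lipschitz[OF iter_deriv_mixed_slice(1)[OF G True], of N] unfolding iter_deriv_mixed_slice(2)[OF G True] by blast
  qed auto
  then obtain c where "\<And>bs::'a list. \<exists>K. c bs \<ge> 0 \<and> (bs \<in> lists Basis \<longrightarrow> (\<forall>z z' t. (1 + norm t) ^ N * norm (iter_deriv bs (\<lambda>t. G (z, t)) t - iter_deriv bs (\<lambda>t. G (z', t)) t)
      \<le> c bs * (1 + norm z + norm z') ^ K * norm (z - z')))" by metis
  then obtain k where "\<And>bs::'a list. c bs \<ge> 0 \<and> (bs \<in> lists Basis \<longrightarrow> (\<forall>z z' t. (1 + norm t) ^ N * norm (iter_deriv bs (\<lambda>t. G (z, t)) t - iter_deriv bs (\<lambda>t. G (z', t)) t)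
      \<le> c bs * (1 + norm z + norm z') ^ k bs * norm (z - z')))" by metis
  then show thesis using that[of c k] by blast
qed

lemma temperedE:
  assumes "u \<in> tempered"
  obtains C N where "C \<ge> 0" "\<And>f. f \<in> schwartz \<Longrightarrow> norm (u f) \<le> C * schwartz_norm N f"
proof -
  obtain C N where *: "\<And>f. f \<in> schwartz \<Longrightarrow> norm (u f) \<le> C * schwartz_norm N f"
    using assms unfolding tempered_def by blast
  have pos: "schwartz_norm N f \<ge> 0" if "f \<in> schwartz" for f :: "'a \<Rightarrow> complex"
    unfolding schwartz_norm_def
  proof (rule sum_nonneg)
    fix bs :: "'a list" assume "bs \<in> {bs. set bs \<subseteq> Basis \<and> length bs \<le> N}"
    then have "bs \<in> lists Basis" by auto
    then have "bdd_above (range (\<lambda>x. (1 + norm x) ^ N * norm (iter_deriv bs f x)))"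
      using that unfolding schwartz_def by auto
    then have "(1 + norm (0::'a)) ^ N * norm (iter_deriv bs f 0) \<le> (SUP x. (1 + norm x) ^ N * norm (iter_deriv bs f x))"
      by (rule cSUP_upper[OF UNIV_I])
    moreover have "0 \<le> (1 + norm (0::'a)) ^ N * norm (iter_deriv bs f 0)" by simp
    ultimately show "0 \<le> (SUP x. (1 + norm x) ^ N * norm (iter_deriv bs f x))" by linarith
  qed
  have "norm (u f) \<le> \<bar>C\<bar> * schwartz_norm N f" if "f \<in> schwartz" for f
    using *[OF that] mult_right_mono[OF abs_ge_self[of C] pos[OF that]] by linarith
  then show thesis using that[of "\<bar>C\<bar>" N] by simp
qed

lemma tempered_family_lipschitz:
  fixes G :: "'z::euclidean_space \<times> 'a::euclidean_space \<Rightarrow> complex"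
  assumes u: "u \<in> tempered" and G: "G \<in> smooth_class mixed"
  obtains C K where "C \<ge> 0"
    "\<And>z z'. norm (u (\<lambda>t. G (z, t)) - u (\<lambda>t. G (z', t))) \<le> C * (1 + norm z + norm z') ^ K * norm (z - z')"
proof -
  obtain C N where C: "C \<ge> 0" "\<And>f. f \<in> schwartz \<Longrightarrow> norm (u f) \<le> C * schwartz_norm N f"
    using temperedE[OF u] by metis
  obtain c k where ck: "\<And>bs::'a list. c bs \<ge> 0"
    "\<And>bs z z' t. bs \<in> lists Basis \<Longrightarrow> (1 + norm t) ^ N * norm (iter_deriv bs (\<lambda>t. G (z, t)) t - iter_deriv bs (\<lambda>t. G (z', t)) t)
       \<le> c bs * (1 + norm z + norm z') ^ k bs * norm (z - z')"
    using mixed_iter_lipschitz[OF G, of N] by metis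
  let ?S = "{bs. set bs \<subseteq> (Basis::'a set) \<and> length bs \<le> N}"
  define K where "K = sum k ?S"
  have "norm (u (\<lambda>t. G (z, t)) - u (\<lambda>t. G (z', t))) \<le> (C * sum c ?S) * (1 + norm z + norm z') ^ K * norm (z - z')" for z z'
  proof -
    note Gz = mixed_slice_schwartz[OF G, of z] and Gz' = mixed_slice_schwartz[OF G, of z']
    have "norm (u (\<lambda>t. G (z, t)) - u (\<lambda>t. G (z', t))) = norm (u (\<lambda>t. G (z, t) - G (z', t)))"
      by (simp add: linear_on_schwartz_diff[OF linear_tempered[OF u] Gz Gz'])
    also have "\<dots> \<le> C * schwartz_norm N (\<lambda>t. G (z, t) - G (z', t))"
      by (intro C schwartz_diff Gz Gz')
    also have "\<dots> \<le> C * (\<Sum>bs\<in>?S. c bs * (1 + norm z + norm z') ^ k bs * norm (z - z'))"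
      by (intro mult_left_mono C schwartz_norm_le)
        (simp add: linear_on_schwartz_diff[OF linear_iter_deriv Gz Gz'] ck)
    also have "\<dots> \<le> C * (\<Sum>bs\<in>?S. c bs * (1 + norm z + norm z') ^ K * norm (z - z'))"
    proof (intro mult_left_mono C sum_mono mult_right_mono ck power_increasing)
      fix bs assume "bs \<in> ?S"
      then show "k bs \<le> K" unfolding K_def using finite_short_lists[of N] by (intro member_le_sum) auto
    qed auto
    also have "\<dots> = (C * sum c ?S) * (1 + norm z + norm z') ^ K * norm (z - z')"
      by (simp add: sum_distrib_right mult.assoc)
    finally show ?thesis .
  qed
  moreover have "C * sum c ?S \<ge> 0" by (intro mult_nonneg_nonneg C sum_nonneg ck)
  ultimately show thesis using that by blast
qed

lemma poly_lipschitz_continuous: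
  fixes h :: "'z::euclidean_space \<Rightarrow> complex"
  assumes "\<And>z z'. norm (h z - h z') \<le> C * (1 + norm z + norm z') ^ K * norm (z - z')"
  shows "continuous_on UNIV h"
proof -
  have "isCont h y" for y
  proof -
    have "((\<lambda>z. C * (1 + norm z + norm y) ^ K * norm (z - y)) \<longlongrightarrow> C * (1 + norm y + norm y) ^ K * norm (y - y)) (at y)"
      by (intro tendsto_intros)
    then have "((\<lambda>z. C * (1 + norm z + norm y) ^ K * norm (z - y)) \<longlongrightarrow> 0) (at y)" by simp
    then have "((\<lambda>z. h z - h y) \<longlongrightarrow> 0) (at y)"
      by (rule Lim_null_comparison[rotated]) (use assms in auto)
    then show ?thesis unfolding isCont_def by (rule LIM_zero_cancel)
  qed
  then show ?thesis by (simp add: continuous_on_eq_continuous_at)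
qed

lemma poly_lipschitz_slow:
  fixes h :: "'z::euclidean_space \<Rightarrow> complex"
  assumes C: "C \<ge> 0" and le: "\<And>z z'. norm (h z - h z') \<le> C * (1 + norm z + norm z') ^ K * norm (z - z')"
  shows "slow h"
proof -
  have "norm (h z) \<le> (norm (h 0) + C) * (1 + norm z) ^ Suc K" for z
  proof -
    have "norm (h z) \<le> norm (h 0) + norm (h z - h 0)"
      by (rule norm_triangle_sub)
    also have "\<dots> \<le> norm (h 0) * 1 + C * (1 + norm z) ^ K * norm z"
      using le[of z 0] by simp
    also have "\<dots> \<le> norm (h 0) * (1 + norm z) ^ Suc K + C * (1 + norm z) ^ K * (1 + norm z)"
      by (intro add_mono mult_left_mono one_le_power mult_nonneg_nonneg C) auto
    finally show ?thesis by (simp add: algebra_simps)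
  qed
  then show ?thesis unfolding slow_def by blast
qed

lemma tempered_family:
  fixes G :: "'z::euclidean_space \<times> 'a::euclidean_space \<Rightarrow> complex"
  assumes u: "u \<in> tempered" and G: "G \<in> smooth_class mixed"
  shows tempered_family_slow: "slow (\<lambda>z. u (\<lambda>t. G (z, t)))"
    and tempered_family_measurable: "(\<lambda>z. u (\<lambda>t. G (z, t))) \<in> borel_measurable borel"
proof -
  obtain C K where CK: "C \<ge> 0"
    "\<And>z z'. norm (u (\<lambda>t. G (z, t)) - u (\<lambda>t. G (z', t))) \<le> C * (1 + norm z + norm z') ^ K * norm (z - z')"
    using tempered_family_lipschitz[OF u G] by metis
  show "slow (\<lambda>z. u (\<lambda>t. G (z, t)))" by (rule poly_lipschitz_slow[OF CK])
  show "(\<lambda>z. u (\<lambda>t. G (z, t))) \<in> borel_measurable borel"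
    by (rule borel_measurable_continuous_onI[OF poly_lipschitz_continuous[OF CK(2)]])
qed

section \<open>Superpositions of smooth families\<close>

lemma rapid_superposition_integrable:
  fixes F :: "'z::euclidean_space \<Rightarrow> complex"
  assumes "rapid F" "F \<in> borel_measurable borel" "slow k" "k \<in> borel_measurable borel"
  shows "integrable lborel (\<lambda>z. F z * k z)"
  using assms by (intro rapid_integrable rapid_mult_slow) auto

lemma mixed_param_slow:
  assumes G: "G \<in> smooth_class mixed"
  shows "slow (\<lambda>z. G (z, t))" and "(\<lambda>z. G (z, t)) \<in> borel_measurable borel"
proof -
  obtain C K where "\<And>z t. (1 + norm t) ^ 0 * norm (G (z, t)) \<le> C * (1 + norm z) ^ K"
    using mixedE[OF smooth_class_bound[OF G]] by metis
  then show "slow (\<lambda>z. G (z, t))" unfolding slow_def by auto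
  have [measurable]: "G \<in> borel_measurable borel" using G by (rule smooth_class_measurable)
  have "continuous_on UNIV (\<lambda>z. G (z, t))"
    by (intro continuous_on_compose2[OF smooth_class_continuous[OF G]] continuous_intros) auto
  then show "(\<lambda>z. G (z, t)) \<in> borel_measurable borel" by (rule borel_measurable_continuous_onI)
qed

lemma superposition_has_derivative:
  fixes F :: "'z::euclidean_space \<Rightarrow> complex" and G :: "'z \<times> 'a::euclidean_space \<Rightarrow> complex"
  assumes F: "rapid F" and [measurable]: "F \<in> borel_measurable borel" and G: "G \<in> smooth_class mixed"
  shows "((\<lambda>t. \<integral>z. F z * G (z, t) \<partial>lborel) has_derivative (\<lambda>h. \<Sum>b\<in>Basis. (h \<bullet> b) *\<^sub>R (\<integral>z. F z * pd (0, b) G (z, t) \<partial>lborel))) (at t)"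
proof -
  have "\<exists>C K. C \<ge> 0 \<and> (\<forall>z t. norm (pd (0, b) G (z, t)) \<le> C * (1 + norm z) ^ K)" if "b \<in> Basis" for b :: 'a
    using mixedE[OF smooth_class_bound[OF mixed_pd(1)[OF G that]], of 0] by (metis mult_1 power_0)
  then obtain C K where CK: "\<And>b. b \<in> Basis \<Longrightarrow> C b \<ge> 0" "\<And>b z t. b \<in> Basis \<Longrightarrow> norm (pd (0, b) G (z, t)) \<le> C b * (1 + norm z) ^ K b"
    by metis
  show ?thesis
  proof (rule has_derivative_integral[where B = "\<lambda>z. norm (F z * (\<Sum>b\<in>Basis. complex_of_real (C b * (1 + norm z) ^ K b)))"])
    show "integrable lborel (\<lambda>z. F z * G (z, t))" for t
      by (intro rapid_superposition_integrable F mixed_param_slow[OF G]) simp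
    show "((\<lambda>t. F z * G (z, t)) has_derivative (\<lambda>h. \<Sum>b\<in>Basis. (h \<bullet> b) *\<^sub>R (F z * pd (0, b) G (z, t)))) (at t)" for z t
      using has_derivative_mult_right[OF mixed_slice_derivative[OF G, of z t], of "F z"]
      by (simp add: sum_distrib_left scaleR_conv_of_real mult_ac)
    show "(\<lambda>z. F z * pd (0, b) G (z, t)) \<in> borel_measurable borel" if "b \<in> Basis" for b t
      using mixed_param_slow(2)[OF mixed_pd(1)[OF G that], of t] by measurable
    show "norm (F z * pd (0, b) G (z, s)) \<le> norm (F z * (\<Sum>b\<in>Basis. complex_of_real (C b * (1 + norm z) ^ K b)))" if "b \<in> Basis" for b z s
    proof -
      have "norm (pd (0, b) G (z, s)) \<le> C b * (1 + norm z) ^ K b" by (rule CK[OF that])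
      also have "\<dots> \<le> (\<Sum>b\<in>Basis. C b * (1 + norm z) ^ K b)"
        using CK(1) by (intro member_le_sum that) auto
      also have "\<dots> \<le> norm (\<Sum>b\<in>Basis. complex_of_real (C b * (1 + norm z) ^ K b))"
        unfolding of_real_sum[symmetric] norm_of_real by (rule abs_ge_self)
      finally show ?thesis unfolding norm_mult by (rule mult_left_mono) simp
    qed
    have "slow (\<lambda>z::'z. complex_of_real (C b * (1 + norm z) ^ K b))" if "b \<in> Basis" for b
      unfolding slow_def using CK(1)[OF that] by (intro exI[of _ "C b"] exI[of _ "K b"]) (simp add: abs_mult norm_mult norm_power del: of_real_add)
    then have "integrable lborel (\<lambda>z. \<Sum>b\<in>Basis. F z * complex_of_real (C b * (1 + norm z) ^ K b))"
      by (intro Bochner_Integration.integrable_sum rapid_superposition_integrable F) auto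
    then show "integrable lborel (\<lambda>z. norm (F z * (\<Sum>b\<in>Basis. complex_of_real (C b * (1 + norm z) ^ K b))))"
      unfolding sum_distrib_left by (rule integrable_norm)
  qed
qed

lemma superposition_pd:
  fixes F :: "'z::euclidean_space \<Rightarrow> complex" and G :: "'z \<times> 'a::euclidean_space \<Rightarrow> complex"
  assumes F: "rapid F" "F \<in> borel_measurable borel" and G: "G \<in> smooth_class mixed" and b: "b \<in> Basis"
  shows "pd b (\<lambda>t. \<integral>z. F z * G (z, t) \<partial>lborel) = (\<lambda>t. \<integral>z. F z * pd (0, b) G (z, t) \<partial>lborel)"
  unfolding pd_eq[OF superposition_has_derivative[OF F G]] using b by (simp only: sum_Basis_pick)

lemma superposition_schwartz:
  fixes F :: "'z::euclidean_space \<Rightarrow> complex" and G :: "'z \<times> 'a::euclidean_space \<Rightarrow> complex"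
  assumes F: "rapid F" "F \<in> borel_measurable borel" and G: "G \<in> smooth_class mixed"
  shows "(\<lambda>t. \<integral>z. F z * G (z, t) \<partial>lborel) \<in> schwartz"
  unfolding schwartz_eq
proof (rule smooth_class_coinduct[where X = "{(\<lambda>t. \<integral>z. F z * G (z, t) \<partial>lborel) |G. G \<in> smooth_class mixed}"])
  show "(\<lambda>t. \<integral>z. F z * G (z, t) \<partial>lborel) \<in> {(\<lambda>t. \<integral>z. F z * G (z, t) \<partial>lborel) |G. G \<in> smooth_class mixed}" using G by blast
next
  fix p :: "'a \<Rightarrow> complex" assume "p \<in> {(\<lambda>t. \<integral>z. F z * G (z, t) \<partial>lborel) |G. G \<in> smooth_class mixed}"
  then obtain G :: "'z \<times> 'a \<Rightarrow> complex" where p: "p = (\<lambda>t. \<integral>z. F z * G (z, t) \<partial>lborel)" and G: "G \<in> smooth_class mixed" by blast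
  show "p differentiable_on UNIV" unfolding p by (rule differentiable_onI_UNIV[OF superposition_has_derivative[OF F G]])
  show "rapid p" unfolding rapid_def
  proof
    fix N
    obtain C K where CK: "C \<ge> 0" "\<And>z t. (1 + norm t) ^ N * norm (G (z, t)) \<le> C * (1 + norm z) ^ K"
      using mixedE[OF smooth_class_bound[OF G]] by metis
    define J where "J = (\<integral>z. norm (F z * complex_of_real (C * (1 + norm z) ^ K)) \<partial>lborel)"
    have "slow (\<lambda>z::'z. complex_of_real (C * (1 + norm z) ^ K))"
      unfolding slow_def using CK(1) by (intro exI[of _ C] exI[of _ K]) (simp add: norm_mult norm_power del: of_real_add)
    then have i: "integrable lborel (\<lambda>z. F z * complex_of_real (C * (1 + norm z) ^ K))"
      by (intro rapid_superposition_integrable F) auto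
    have "(1 + norm t) ^ N * norm (p t) \<le> J" for t
    proof -
      have "(1 + norm t) ^ N * norm (p t) \<le> (1 + norm t) ^ N * (\<integral>z. norm (F z * G (z, t)) \<partial>lborel)"
        unfolding p by (intro mult_left_mono integral_norm_bound) auto
      also have "\<dots> = (\<integral>z. (1 + norm t) ^ N * norm (F z * G (z, t)) \<partial>lborel)" by simp
      also have "\<dots> \<le> J"
        unfolding J_def
      proof (intro integral_mono integrable_mult_right integrable_norm i rapid_superposition_integrable F mixed_param_slow[OF G])
        fix z
        have "(1 + norm t) ^ N * norm (F z * G (z, t)) = norm (F z) * ((1 + norm t) ^ N * norm (G (z, t)))"
          by (simp add: norm_mult)
        also have "\<dots> \<le> norm (F z) * norm (complex_of_real (C * (1 + norm z) ^ K))"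
          unfolding norm_of_real using CK(2)[of t z] by (intro mult_left_mono order_trans[OF _ abs_ge_self]) auto
        finally show "(1 + norm t) ^ N * norm (F z * G (z, t)) \<le> norm (F z * complex_of_real (C * (1 + norm z) ^ K))"
          by (simp only: norm_mult)
      qed
      finally show ?thesis .
    qed
    then show "\<exists>C. \<forall>t. (1 + norm t) ^ N * norm (p t) \<le> C" by blast
  qed
  fix b :: 'a assume b: "b \<in> Basis"
  show "pd b p \<in> {(\<lambda>t. \<integral>z. F z * G (z, t) \<partial>lborel) |G. G \<in> smooth_class mixed}"
    unfolding p superposition_pd[OF F G b] by (intro CollectI exI[of _ "pd (0, b) G"] conjI refl mixed_pd(1)[OF G b])
qed

lemma superposition_iter_deriv:
  fixes F :: "'z::euclidean_space \<Rightarrow> complex" and G :: "'z \<times> 'a::euclidean_space \<Rightarrow> complex"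
  assumes F: "rapid F" "F \<in> borel_measurable borel" and G: "G \<in> smooth_class mixed" and bs: "bs \<in> lists Basis"
  shows "iter_deriv bs (\<lambda>t. \<integral>z. F z * G (z, t) \<partial>lborel) = (\<lambda>t. \<integral>z. F z * iter_deriv bs (\<lambda>t. G (z, t)) t \<partial>lborel)"
  using bs
proof (induction bs rule: list.induct)
  case (Cons b bs)
  then have bs: "bs \<in> lists Basis" and b: "b \<in> Basis" by auto
  have bbs: "b # bs \<in> lists Basis" using bs b by simp
  show ?case
    unfolding iter_deriv_mixed_slice(2)[OF G bbs] unfolding iter_deriv_Cons_pd Cons.IH[OF bs] iter_deriv_mixed_slice(2)[OF G bs]
      superposition_pd[OF F iter_deriv_mixed_slice(1)[OF G bs] b] list.map iter_deriv_Cons_pd ..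
qed simp

text \<open>Replacing the parameter by a simple function turns the superposition into a finite linear
  combination, for which the claim is linearity. The parameter is approximated by simple functions
  pointwise and with at most twice its norm; the Lipschitz bounds in the parameter, together with the
  rapid decay of \<open>F\<close>, make the error tend to zero in the seminorm that controls \<open>u\<close>.\<close>

theorem tempered_superposition:
  fixes F :: "'z::euclidean_space \<Rightarrow> complex" and G :: "'z \<times> 'a::euclidean_space \<Rightarrow> complex"
  assumes u: "u \<in> tempered" and F: "rapid F" and Fm [measurable]: "F \<in> borel_measurable borel" and G: "G \<in> smooth_class mixed"
  shows "u (\<lambda>t. \<integral>z. F z * G (z, t) \<partial>lborel) = (\<integral>z. F z * u (\<lambda>t. G (z, t)) \<partial>lborel)"
proof -
  obtain s :: "nat \<Rightarrow> 'z \<Rightarrow> 'z" where s: "\<And>i. simple_function lborel (s i)"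
    "\<And>z. (\<lambda>i. s i z) \<longlonglongrightarrow> z" "\<And>i z. dist (s i z) 0 \<le> 2 * dist z 0"
    using borel_measurable_implies_sequence_metric[of "\<lambda>z::'z. z" lborel 0] by auto
  have [measurable]: "s i \<in> borel_measurable borel" for i
    using borel_measurable_simple_function[OF s(1)[of i]] by simp
  have fin: "finite (range (s i))" for i
    using simple_functionD(1)[OF s(1)[of i]] by simp
  have sn: "norm (s i z) \<le> 2 * norm z" for i z using s(3)[of i z] by simp
  have Fi: "integrable lborel F" by (rule rapid_integrable[OF F Fm])
  \<comment> \<open>The weight of the value \<open>y\<close> of the \<open>i\<close>-th simple function.\<close>
  define a where "a i y = (\<integral>z. F z * indicator (s i -` {y}) z \<partial>lborel)" for i y
  have vs [measurable]: "s i -` {y} \<in> sets borel" for i y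
  proof -
    have "s i -` {y} \<inter> space borel \<in> sets borel" by measurable
    then show ?thesis by simp
  qed
  have step: "(\<integral>z. F z * k (s i z) \<partial>lborel) = (\<Sum>y\<in>range (s i). a i y * k y)" for k :: "'z \<Rightarrow> complex" and i
  proof -
    have "k (s i z) = (\<Sum>y\<in>range (s i). indicator (s i -` {y}) z * k y)" for z
    proof -
      have "(\<Sum>y\<in>range (s i). indicator (s i -` {y}) z * k y) = (\<Sum>y\<in>{s i z}. indicator (s i -` {y}) z * k y)"
        by (rule sum.mono_neutral_right[OF fin]) auto
      then show ?thesis by simp
    qed
    then have "(\<integral>z. F z * k (s i z) \<partial>lborel) = (\<integral>z. (\<Sum>y\<in>range (s i). F z * indicator (s i -` {y}) z * k y) \<partial>lborel)"
      by (simp add: sum_distrib_left mult.assoc)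
    also have "\<dots> = (\<Sum>y\<in>range (s i). a i y * k y)"
      unfolding a_def
      by (subst Bochner_Integration.integral_sum) (auto intro!: integrable_mult_left integrable_real_mult_indicator Fi Bochner_Integration.integrable_bound[OF Fi] simp: indicator_def)
    finally show ?thesis .
  qed
  \<comment> \<open>The error of the approximation for a function of the parameter with polynomial Lipschitz constants.\<close>
  define e where "e c k i = (\<integral>z. norm (F z) * (c * (1 + norm z + norm (s i z)) ^ k * norm (z - s i z)) \<partial>lborel)" for c :: real and k i
  have dom: "norm (F z) * (c * (1 + norm z + norm (s i z)) ^ k * norm (z - s i z)) \<le> (c * 3 ^ Suc k) * ((1 + norm z) ^ Suc k * norm (F z))" if "c \<ge> 0" for c k i z
  proof -
    have "norm (z - s i z) \<le> 3 * (1 + norm z)"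
    proof -
      have "norm (z - s i z) \<le> norm z + 2 * norm z"
        by (rule order_trans[OF norm_triangle_ineq4 add_left_mono[OF sn]])
      also have "\<dots> \<le> 3 * (1 + norm z)" by simp
      finally show ?thesis .
    qed
    moreover have "1 + norm z + norm (s i z) \<le> 3 * (1 + norm z)"
      using add_left_mono[OF sn[of i z], of "1 + norm z"] by simp
    ultimately have "(1 + norm z + norm (s i z)) ^ k * norm (z - s i z) \<le> (3 * (1 + norm z)) ^ k * (3 * (1 + norm z))"
      by (intro mult_mono power_mono) auto
    also have "\<dots> = 3 ^ Suc k * (1 + norm z) ^ Suc k" by (simp only: power_mult_distrib power_Suc mult_ac)
    finally have "norm (F z) * (c * ((1 + norm z + norm (s i z)) ^ k * norm (z - s i z))) \<le> norm (F z) * (c * (3 ^ Suc k * (1 + norm z) ^ Suc k))"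
      using that by (intro mult_left_mono) auto
    then show ?thesis by (simp only: mult_ac)
  qed
  have domi: "integrable lborel (\<lambda>z. (c * 3 ^ Suc k) * ((1 + norm z) ^ Suc k * norm (F z)))" for c k
  proof -
    have "integrable lborel (\<lambda>z. complex_of_real ((1 + norm z) ^ Suc k) * F z)"
      by (rule rapid_slow_integrable[OF F, of _ 1 "Suc k"]) (auto simp: norm_mult norm_power simp del: of_real_add power_Suc)
    from integrable_norm[OF this] show ?thesis
      by (intro integrable_mult_right) (simp add: norm_mult norm_power del: of_real_add power_Suc)
  qed
  have ei: "integrable lborel (\<lambda>z. norm (F z) * (c * (1 + norm z + norm (s i z)) ^ k * norm (z - s i z)))" if "c \<ge> 0" for c k i
    using dom[OF that] that by (intro Bochner_Integration.integrable_bound[OF domi[of c k]]) (auto intro!: AE_I2 order_trans[OF _ abs_ge_self])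
  have e0: "(\<lambda>i. e c k i) \<longlonglongrightarrow> 0" if "c \<ge> 0" for c k
  proof -
    have "(\<lambda>i. e c k i) \<longlonglongrightarrow> (\<integral>z. 0 \<partial>(lborel :: 'z measure))"
      unfolding e_def
    proof (rule integral_dominated_convergence[OF _ _ domi[of c k]])
      show "AE z in lborel. (\<lambda>i. norm (F z) * (c * (1 + norm z + norm (s i z)) ^ k * norm (z - s i z))) \<longlonglongrightarrow> 0"
      proof (rule AE_I2)
        fix z
        have "(\<lambda>i. norm (F z) * (c * (1 + norm z + norm (s i z)) ^ k * norm (z - s i z))) \<longlonglongrightarrow> norm (F z) * (c * (1 + norm z + norm z) ^ k * norm (z - z))"
          by (intro tendsto_intros s(2))
        then show "(\<lambda>i. norm (F z) * (c * (1 + norm z + norm (s i z)) ^ k * norm (z - s i z))) \<longlonglongrightarrow> 0" by simp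
      qed
      show "AE z in lborel. norm (norm (F z) * (c * (1 + norm z + norm (s i z)) ^ k * norm (z - s i z))) \<le> (c * 3 ^ Suc k) * ((1 + norm z) ^ Suc k * norm (F z))" for i
        using dom[OF that] that by auto
    qed auto
    then show ?thesis by simp
  qed
  have approx: "norm ((\<integral>z. F z * h z \<partial>lborel) - (\<integral>z. F z * h (s i z) \<partial>lborel)) \<le> e c k i"
    if c: "c \<ge> 0" and le: "\<And>z z'. norm (h z - h z') \<le> c * (1 + norm z + norm z') ^ k * norm (z - z')" for h c k i
  proof -
    have [measurable]: "h \<in> borel_measurable borel"
      by (rule borel_measurable_continuous_onI[OF poly_lipschitz_continuous[OF le]])
    have le': "norm (F z * (h z - h (s i z))) \<le> norm (F z) * (c * (1 + norm z + norm (s i z)) ^ k * norm (z - s i z))" for z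
      unfolding norm_mult by (intro mult_left_mono le) auto
    have 1: "integrable lborel (\<lambda>z. F z * h z)"
      by (intro rapid_superposition_integrable F poly_lipschitz_slow[OF c le]) auto
    have 2: "integrable lborel (\<lambda>z. F z * (h z - h (s i z)))"
      using le' by (intro Bochner_Integration.integrable_bound[OF ei[OF c, of i k]]) (auto intro!: AE_I2 order_trans[OF _ abs_ge_self])
    have "integrable lborel (\<lambda>z. F z * h z - F z * (h z - h (s i z)))" using 1 2 by (rule Bochner_Integration.integrable_diff)
    then have 3: "integrable lborel (\<lambda>z. F z * h (s i z))" by (simp add: algebra_simps)
    have "(\<integral>z. F z * h z \<partial>lborel) - (\<integral>z. F z * h (s i z) \<partial>lborel) = (\<integral>z. F z * (h z - h (s i z)) \<partial>lborel)"
      using 1 3 by (simp add: right_diff_distrib)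
    also have "norm \<dots> \<le> (\<integral>z. norm (F z * (h z - h (s i z))) \<partial>lborel)" by (rule integral_norm_bound)
    also have "\<dots> \<le> e c k i"
      unfolding e_def by (intro integral_mono integrable_norm 2 ei c le')
    finally show ?thesis .
  qed
  define f where "f = (\<lambda>t. \<integral>z. F z * G (z, t) \<partial>lborel)"
  define f' where "f' i = (\<lambda>t. \<Sum>y\<in>range (s i). a i y * G (y, t))" for i
  have f: "f \<in> schwartz" unfolding f_def by (rule superposition_schwartz[OF F Fm G])
  note sum = linear_on_schwartz_sum[OF _ fin _ mixed_slice_schwartz[OF G]]
  have f': "f' i \<in> schwartz" for i unfolding f'_def by (rule sum(1)[OF linear_tempered[OF u]]) simp
  have Lf': "L (f' i) = (\<integral>z. F z * L (\<lambda>t. G (s i z, t)) \<partial>lborel)" if "linear_on_schwartz L" for L i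
    unfolding step[of "\<lambda>y. L (\<lambda>t. G (y, t))" i] f'_def by (rule sum(2)[OF that]) simp
  obtain C N where CN: "C \<ge> 0" "\<And>f. f \<in> schwartz \<Longrightarrow> norm (u f) \<le> C * schwartz_norm N f"
    using temperedE[OF u] by metis
  obtain c k where ck: "\<And>bs::'a list. c bs \<ge> 0"
    "\<And>bs z z' t. bs \<in> lists Basis \<Longrightarrow> (1 + norm t) ^ N * norm (iter_deriv bs (\<lambda>t. G (z, t)) t - iter_deriv bs (\<lambda>t. G (z', t)) t)
       \<le> c bs * (1 + norm z + norm z') ^ k bs * norm (z - z')"
    using mixed_iter_lipschitz[OF G, of N] by metis
  let ?S = "{bs. set bs \<subseteq> (Basis::'a set) \<and> length bs \<le> N}"
  have "norm (u f - u (f' i)) \<le> C * (\<Sum>bs\<in>?S. e (c bs) (k bs) i)" for i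
  proof -
    have "norm (u f - u (f' i)) = norm (u (\<lambda>t. f t - f' i t))"
      by (simp add: linear_on_schwartz_diff[OF linear_tempered[OF u] f f'])
    also have "\<dots> \<le> C * schwartz_norm N (\<lambda>t. f t - f' i t)" by (intro CN schwartz_diff f f')
    also have "\<dots> \<le> C * (\<Sum>bs\<in>?S. e (c bs) (k bs) i)"
    proof (intro mult_left_mono CN schwartz_norm_le)
      fix bs :: "'a list" and t assume bs: "bs \<in> lists Basis"
      define h where "h z = complex_of_real ((1 + norm t) ^ N) * iter_deriv bs (\<lambda>t. G (z, t)) t" for z
      have lip: "norm (h z - h z') \<le> c bs * (1 + norm z + norm z') ^ k bs * norm (z - z')" for z z'
        using ck(2)[OF bs, of t z z'] unfolding h_def right_diff_distrib[symmetric]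
        by (simp add: norm_mult norm_power del: of_real_add)
      have "iter_deriv bs (\<lambda>t. f t - f' i t) t = iter_deriv bs f t - iter_deriv bs (f' i) t"
        by (rule linear_on_schwartz_diff[OF linear_iter_deriv[OF bs] f f'])
      also have "\<dots> = (\<integral>z. F z * iter_deriv bs (\<lambda>t. G (z, t)) t \<partial>lborel) - (\<integral>z. F z * iter_deriv bs (\<lambda>t. G (s i z, t)) t \<partial>lborel)"
        unfolding Lf'[OF linear_iter_deriv[OF bs]] unfolding f_def superposition_iter_deriv[OF F Fm G bs] ..
      finally have iter: "iter_deriv bs (\<lambda>t. f t - f' i t) t = (\<integral>z. F z * iter_deriv bs (\<lambda>t. G (z, t)) t \<partial>lborel) - (\<integral>z. F z * iter_deriv bs (\<lambda>t. G (s i z, t)) t \<partial>lborel)" .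
      have "complex_of_real ((1 + norm t) ^ N) * iter_deriv bs (\<lambda>t. f t - f' i t) t = (\<integral>z. F z * h z \<partial>lborel) - (\<integral>z. F z * h (s i z) \<partial>lborel)"
      proof -
        have "(\<integral>z. F z * (complex_of_real ((1 + norm t) ^ N) * k z) \<partial>lborel) = complex_of_real ((1 + norm t) ^ N) * (\<integral>z. F z * k z \<partial>lborel)" for k
          unfolding integral_mult_right_zero[symmetric] by (simp only: mult.left_commute)
        then show ?thesis
          unfolding h_def iter by (simp only: right_diff_distrib)
      qed
      then have "(1 + norm t) ^ N * norm (iter_deriv bs (\<lambda>t. f t - f' i t) t) = norm ((\<integral>z. F z * h z \<partial>lborel) - (\<integral>z. F z * h (s i z) \<partial>lborel))"
      proof -
        assume eq: "complex_of_real ((1 + norm t) ^ N) * iter_deriv bs (\<lambda>t. f t - f' i t) t = (\<integral>z. F z * h z \<partial>lborel) - (\<integral>z. F z * h (s i z) \<partial>lborel)"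
        have "\<bar>(1 + norm t) ^ N\<bar> = (1 + norm t) ^ N" by (rule abs_of_nonneg) simp
        then show ?thesis unfolding eq[symmetric] norm_mult norm_of_real by (simp only:)
      qed
      also have "\<dots> \<le> e (c bs) (k bs) i" by (rule approx[OF ck(1) lip])
      finally show "(1 + norm t) ^ N * norm (iter_deriv bs (\<lambda>t. f t - f' i t) t) \<le> e (c bs) (k bs) i" .
    qed
    finally show ?thesis .
  qed
  note le = this
  have "(\<lambda>i. C * (\<Sum>bs\<in>?S. e (c bs) (k bs) i)) \<longlonglongrightarrow> C * (\<Sum>bs\<in>?S. 0)"
    by (intro tendsto_mult tendsto_const tendsto_sum e0 ck)
  then have lim: "(\<lambda>i. C * (\<Sum>bs\<in>?S. e (c bs) (k bs) i)) \<longlonglongrightarrow> 0" by simp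
  have "(\<lambda>i. u f - u (f' i)) \<longlonglongrightarrow> 0"
    by (rule Lim_null_comparison[OF always_eventually[OF allI[OF le]] lim])
  then have lim1: "(\<lambda>i. u f - (\<integral>z. F z * u (\<lambda>t. G (s i z, t)) \<partial>lborel)) \<longlonglongrightarrow> 0"
    unfolding Lf'[OF linear_tempered[OF u]] .
  obtain D K where DK: "D \<ge> 0"
    "\<And>z z'. norm (u (\<lambda>t. G (z, t)) - u (\<lambda>t. G (z', t))) \<le> D * (1 + norm z + norm z') ^ K * norm (z - z')"
    using tempered_family_lipschitz[OF u G] by metis
  have lim2: "(\<lambda>i. (\<integral>z. F z * u (\<lambda>t. G (z, t)) \<partial>lborel) - (\<integral>z. F z * u (\<lambda>t. G (s i z, t)) \<partial>lborel)) \<longlonglongrightarrow> 0"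
    by (rule Lim_null_comparison[OF always_eventually[OF allI[OF approx[OF DK]]] e0[OF DK(1)]])
  have "(\<lambda>i. u f - (\<integral>z. F z * u (\<lambda>t. G (z, t)) \<partial>lborel)) \<longlonglongrightarrow> 0"
    using tendsto_diff[OF lim1 lim2] by simp
  then show ?thesis unfolding f_def by (simp add: LIMSEQ_const_iff)
qed

section \<open>The short-time Fourier transform\<close>

definition stft_family :: "('a::euclidean_space \<Rightarrow> complex) \<Rightarrow> ('a \<times> 'a) \<times> 'a \<Rightarrow> complex" where
  "stft_family g = (\<lambda>p. cnj (g (snd p - fst (fst p))) * cis (- 2 * pi * (snd p \<bullet> snd (fst p))))"

lemma stft_eq_family: "stft g u z = u (\<lambda>t. stft_family g (z, t))"
  by (cases z) (simp add: stft_def stft_family_def)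

lemma stft_family_mixed:
  fixes g :: "'a::euclidean_space \<Rightarrow> complex"
  assumes g: "g \<in> schwartz"
  shows "stft_family g \<in> smooth_class mixed"
proof -
  have l1: "bounded_linear (\<lambda>p::('a \<times> 'a) \<times> 'a. snd p - fst (fst p))"
    by (intro bounded_linear_intros)
  have l2: "bounded_linear (snd :: ('a \<times> 'a) \<times> 'a \<Rightarrow> 'a)" by (rule bounded_linear_snd)
  have l3: "bounded_linear (\<lambda>p::('a \<times> 'a) \<times> 'a. snd (fst p))" by (intro bounded_linear_intros)
  have "mixed (\<lambda>p::('a \<times> 'a) \<times> 'a. f (0 + (snd p - fst (fst p))))" if f: "rapid f" for f :: "'a \<Rightarrow> complex"
    unfolding mixed_def
  proof
    fix N
    obtain C where C: "C \<ge> 0" "\<And>x. (1 + norm x) ^ N * norm (f x) \<le> C" using rapidE[OF f] by metis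
    have "(1 + norm t) ^ N * norm (f (t - fst z)) \<le> C * (1 + norm z) ^ N" for z :: "'a \<times> 'a" and t
    proof -
      have "norm t \<le> norm (t - fst z) + norm z"
        using norm_triangle_ineq[of "t - fst z" "fst z"] norm_fst_le[of "fst z" "snd z"] by simp
      then have "1 + norm t \<le> 1 + (norm (t - fst z) + norm z)" by simp
      also have "\<dots> \<le> (1 + norm (t - fst z)) * (1 + norm z)" by (simp add: algebra_simps)
      finally have "(1 + norm t) ^ N \<le> ((1 + norm (t - fst z)) * (1 + norm z)) ^ N" by (intro power_mono) auto
      then have "(1 + norm t) ^ N * norm (f (t - fst z)) \<le> ((1 + norm (t - fst z)) * (1 + norm z)) ^ N * norm (f (t - fst z))"
        by (intro mult_right_mono) auto
      also have "\<dots> = ((1 + norm (t - fst z)) ^ N * norm (f (t - fst z))) * (1 + norm z) ^ N"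
        by (simp add: power_mult_distrib mult_ac)
      also have "\<dots> \<le> C * (1 + norm z) ^ N" by (intro mult_right_mono C) auto
      finally show ?thesis .
    qed
    then show "\<exists>C K. \<forall>z t. (1 + norm t) ^ N * norm (f (0 + (snd (z, t) - fst (fst (z, t))))) \<le> C * (1 + norm (z :: 'a \<times> 'a)) ^ K"
      by (intro exI[of _ C] exI[of _ N]) simp
  qed
  from smooth_class_compose[where B' = mixed and a = 0, OF l1 additive_rapid this schwartz_cnj[OF g, unfolded schwartz_eq]]
  have "(\<lambda>p::('a \<times> 'a) \<times> 'a. cnj (g (snd p - fst (fst p)))) \<in> smooth_class mixed" by simp
  from smooth_class_mult[OF mixed_mult_slow additive_mixed this slow_class_cis[OF slow_class_inner[OF l2 l3]]]
  show ?thesis unfolding stft_family_def .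
qed

lemma stft_slow: "g \<in> schwartz \<Longrightarrow> u \<in> tempered \<Longrightarrow> slow (stft g u)"
  unfolding stft_eq_family[abs_def] by (intro tempered_family_slow stft_family_mixed)

lemma stft_measurable: "g \<in> schwartz \<Longrightarrow> u \<in> tempered \<Longrightarrow> stft g u \<in> borel_measurable borel"
  unfolding stft_eq_family[abs_def] by (intro tempered_family_measurable stft_family_mixed)

text \<open>For fixed \<open>x\<close> the integral over the frequencies is Fourier inversion of \<open>s \<mapsto> f s g (s - x)\<close> at
  \<open>t\<close>; what remains is the integral of \<open>\<bar>g (t - x)\<bar>\<^sup>2\<close> over \<open>x\<close>.\<close>

lemma stft_dual_expansion:
  fixes f g :: "'a::euclidean_space \<Rightarrow> complex"
  assumes f: "f \<in> schwartz" and g: "g \<in> schwartz"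
  shows "(\<integral>z. stft_dual g f z * stft_family g (z, t) \<partial>lborel) = f t * complex_of_real (\<integral>x. (norm (g x))\<^sup>2 \<partial>lborel)"
proof -
  have [measurable]: "f \<in> borel_measurable borel" "g \<in> borel_measurable borel"
    using f g by measurable
  have "integrable lborel (\<lambda>z. stft_dual g f z * stft_family g (z, t))"
    by (intro rapid_superposition_integrable stft_dual_rapid f g mixed_param_slow stft_family_mixed) measurable
  then have i: "integrable (lborel \<Otimes>\<^sub>M lborel) (\<lambda>z. stft_dual g f z * stft_family g (z, t))"
    by (simp add: lborel_prod)
  have k: "(\<lambda>s. f s * g (s - x)) \<in> schwartz" for x
    using slice_schwartz(1)[OF translate_product_schwartz[OF f g], of x] by simp
  have inner: "(\<integral>w. stft_dual g f (x, w) * stft_family g ((x, w), t) \<partial>lborel) = f t * complex_of_real ((norm (g (t - x)))\<^sup>2)" for x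
  proof -
    let ?k = "\<lambda>s. f s * g (s - x)"
    obtain B where B: "\<And>s. norm (?k s) \<le> B" using schwartz_bounded[OF k[of x]] by blast
    have [measurable]: "fourier ?k \<in> borel_measurable borel" by (rule fourier_measurable) measurable
    have "(\<integral>w. stft_dual g f (x, w) * stft_family g ((x, w), t) \<partial>lborel)
      = (\<integral>w. cnj (g (t - x)) * (fourier ?k (- w) * cis (2 * pi * (t \<bullet> - w))) \<partial>lborel)"
      by (simp add: stft_dual_fourier stft_family_def mult_ac)
    also have "\<dots> = cnj (g (t - x)) * (\<integral>w. fourier ?k (- w) * cis (2 * pi * (t \<bullet> - w)) \<partial>lborel)"
      by (rule integral_mult_right_zero)
    also have "(\<integral>w. fourier ?k (- w) * cis (2 * pi * (t \<bullet> - w)) \<partial>lborel) = (\<integral>w. fourier ?k w * cis (2 * pi * (t \<bullet> w)) \<partial>lborel)"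
      using lborel_integral_affine(1)[of "-1" "\<lambda>w. fourier ?k w * cis (2 * pi * (t \<bullet> w))" 0] by simp
    also have "\<dots> = ?k t"
      by (rule fourier_inversion[OF schwartz_integrable[OF k] B schwartz_isCont[OF k] schwartz_integrable[OF fourier_schwartz[OF k]]])
    finally show ?thesis by (simp add: mult_ac flip: complex_norm_square)
  qed
  have "(\<integral>z. stft_dual g f z * stft_family g (z, t) \<partial>lborel) = (\<integral>x. \<integral>w. stft_dual g f (x, w) * stft_family g ((x, w), t) \<partial>lborel \<partial>lborel)"
    using lborel_pair.integral_fst'[OF i] by (simp add: lborel_prod)
  also have "\<dots> = f t * complex_of_real (\<integral>x. (norm (g (t - x)))\<^sup>2 \<partial>lborel)"
    unfolding inner by (simp only: integral_mult_right_zero integral_complex_of_real)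
  also have "(\<integral>x. (norm (g (t - x)))\<^sup>2 \<partial>lborel) = (\<integral>x. (norm (g x))\<^sup>2 \<partial>lborel)"
    using lborel_integral_affine(1)[of "-1" "\<lambda>x. (norm (g x))\<^sup>2" t] by simp
  finally show ?thesis .
qed

text \<open>The expansion of the test function into time-frequency shifts of the window, with \<open>u\<close> applied
  under the integral sign.\<close>

theorem stft_reproducing:
  fixes f g :: "'a::euclidean_space \<Rightarrow> complex"
  assumes u: "u \<in> tempered" and f: "f \<in> schwartz" and g: "g \<in> schwartz"
  shows "complex_of_real (\<integral>x. (norm (g x))\<^sup>2 \<partial>lborel) * u f = (\<integral>z. stft g u z * stft_dual g f z \<partial>lborel)"
proof -
  let ?n = "complex_of_real (\<integral>x. (norm (g x))\<^sup>2 \<partial>lborel)"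
  have [measurable]: "f \<in> borel_measurable borel" "g \<in> borel_measurable borel"
    using f g by measurable
  have "u (\<lambda>t. ?n * f t + 0 * f t) = ?n * u f + 0 * u f"
    using linear_tempered[OF u] f unfolding linear_on_schwartz_def by blast
  then have "?n * u f = u (\<lambda>t. \<integral>z. stft_dual g f z * stft_family g (z, t) \<partial>lborel)"
    unfolding stft_dual_expansion[OF f g] by (simp add: mult.commute)
  also have "\<dots> = (\<integral>z. stft_dual g f z * u (\<lambda>t. stft_family g (z, t)) \<partial>lborel)"
    by (rule tempered_superposition[OF u stft_dual_rapid[OF f g] _ stft_family_mixed[OF g]]) measurable
  finally show ?thesis by (simp add: stft_eq_family mult.commute)
qed

lemma window_norm_pos:
  assumes g: "g \<in> schwartz" and nz: "g \<noteq> (\<lambda>_. 0)"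
  shows "(\<integral>x. (norm (g x))\<^sup>2 \<partial>lborel) > 0"
proof -
  have c: "continuous_on UNIV g" by (rule schwartz_continuous[OF g])
  have [measurable]: "g \<in> borel_measurable borel" using g by measurable
  have i: "integrable lborel (\<lambda>x. (norm (g x))\<^sup>2)"
  proof -
    have "slow g" using rapidE[OF schwartz_rapid[OF g], of 0]
      unfolding slow_def by (metis (no_types, lifting) mult_1 mult_1_right power_0)
    then have "integrable lborel (\<lambda>x. g x * g x)"
      by (intro rapid_superposition_integrable schwartz_rapid g) measurable
    from integrable_norm[OF this] show ?thesis by (simp add: norm_mult power2_eq_square)
  qed
  have "(\<integral>x. (norm (g x))\<^sup>2 \<partial>lborel) \<noteq> 0"
  proof
    assume "(\<integral>x. (norm (g x))\<^sup>2 \<partial>lborel) = 0"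
    then have "AE x in lborel. (norm (g x))\<^sup>2 = 0"
      using integral_nonneg_eq_0_iff_AE[OF i] by simp
    then have "AE x in lebesgue. g x = 0" by (simp add: AE_completion)
    then have "AE x in lebesgue. x \<in> {x. g x = 0}" by simp
    moreover have "closed {x. g x = 0}" by (intro closed_Collect_eq c continuous_intros)
    ultimately have "g x = 0" for x using mem_closed_if_AE_lebesgue by blast
    with nz show False by auto
  qed
  moreover have "(\<integral>x. (norm (g x))\<^sup>2 \<partial>lborel) \<ge> 0" by simp
  ultimately show ?thesis by linarith
qed

section \<open>From a weighted square integrable transform to a function\<close>

lemma bounded_support_integrable:
  fixes V :: "'a::euclidean_space \<Rightarrow> complex"
  assumes [measurable]: "V \<in> borel_measurable borel" and B: "\<And>z. norm (V z) \<le> B" and supp: "\<And>z. norm z > R \<Longrightarrow> V z = 0"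
  shows "integrable lborel V" and "integrable lborel (\<lambda>z. (norm (V z))\<^sup>2)"
proof -
  have B0: "B \<ge> 0" using order_trans[OF norm_ge_zero B] .
  have i: "integrable lborel (\<lambda>z::'a. b * indicator (cball 0 R) z :: real)" for b
    using emeasure_bounded_finite[of "cball (0::'a) R"] by (intro integrable_mult_right integrable_real_indicator) auto
  have le: "norm (V z) \<le> B * indicator (cball 0 R) z" for z
    using B[of z] supp[of z] by (auto simp: indicator_def not_le)
  show "integrable lborel V"
    by (rule Bochner_Integration.integrable_bound[OF i[of B]]) (use le in \<open>auto intro!: AE_I2 order_trans[OF _ abs_ge_self]\<close>)
  have le2: "(norm (V z))\<^sup>2 \<le> B\<^sup>2 * indicator (cball 0 R) z" for z
    using B[of z] supp[of z] by (cases "norm z \<le> R") (auto simp: indicator_def intro!: power_mono)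
  show "integrable lborel (\<lambda>z. (norm (V z))\<^sup>2)"
    by (rule Bochner_Integration.integrable_bound[OF i[of "B\<^sup>2"]]) (use le2 in \<open>auto intro!: AE_I2 order_trans[OF _ abs_ge_self]\<close>)
qed

lemma borel_pairI: "f \<in> borel_measurable borel \<Longrightarrow> f \<in> borel_measurable (lborel \<Otimes>\<^sub>M lborel)"
  unfolding lborel_prod by simp

text \<open>A Schur estimate. For fixed \<open>x\<close> the Bessel inequality controls the integral over the frequencies
  in \<open>L\<^sup>2\<close> of \<open>t\<close>. The kernel \<open>\<gamma> (t - x)\<close> is localized near the diagonal, where the values of the
  moderate weight \<open>p\<close> at \<open>t\<close> and \<open>x\<close> are comparable, so the Cauchy-Schwarz inequality in \<open>x\<close> finishes
  the proof with a constant that does not depend on \<open>V\<close>.\<close>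

lemma synthesis_bound:
  fixes V :: "'a::euclidean_space \<times> 'a \<Rightarrow> complex" and p :: "'a \<Rightarrow> real" and \<gamma> :: "'a \<Rightarrow> complex"
  assumes V [measurable]: "V \<in> borel_measurable borel" and B: "\<And>z. norm (V z) \<le> B" and supp: "\<And>z. norm z > R \<Longrightarrow> V z = 0"
    and [measurable]: "\<gamma> \<in> borel_measurable borel" and G: "\<And>x. norm (\<gamma> x) \<le> G"
    and [measurable]: "p \<in> borel_measurable borel" and p: "\<And>x. p x > 0" and D0: "D \<ge> 0"
    and D: "\<And>x t. p t * norm (\<gamma> (t - x)) \<le> D * p x * decay DIM('a) (t - x)"
  shows "(\<integral>\<^sup>+t. ennreal ((p t * norm (\<integral>z. V z * \<gamma> (t - fst z) * cis (2 * pi * (t \<bullet> snd z)) \<partial>lborel))\<^sup>2) \<partial>lborel)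
    \<le> ennreal (D\<^sup>2 * (\<integral>y. decay (2 * DIM('a)) (y::'a) \<partial>lborel)) * (\<integral>\<^sup>+z. ennreal ((p (fst z) * norm (V z))\<^sup>2) \<partial>lborel)"
proof -
  have [measurable]: "V \<in> borel_measurable (lborel \<Otimes>\<^sub>M lborel)" "V \<in> borel_measurable (borel \<Otimes>\<^sub>M borel)"
    using V by (auto intro: borel_pairI simp: borel_prod)
  define E where "E x t = (\<integral>w. V (x, w) * cis (2 * pi * (t \<bullet> w)) \<partial>lborel)" for x t
  have [measurable]: "(\<lambda>(x, t). E x t) \<in> borel_measurable (lborel \<Otimes>\<^sub>M lborel)"
    unfolding E_def by measurable
  have Vi: "integrable lborel V" by (rule bounded_support_integrable[OF V B supp])
  have Vx [measurable]: "(\<lambda>w. V (x, w)) \<in> borel_measurable borel" for x by measurable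
  have Vxs: "V (x, w) = 0" if "norm w > R" for x w
    by (rule supp) (use that norm_snd_le[of w x] in linarith)
  note Vxi = bounded_support_integrable[OF Vx B Vxs]
  have h: "(\<integral>z. V z * \<gamma> (t - fst z) * cis (2 * pi * (t \<bullet> snd z)) \<partial>lborel) = (\<integral>x. \<gamma> (t - x) * E x t \<partial>lborel)" for t
  proof -
    have "integrable lborel (\<lambda>z. V z * \<gamma> (t - fst z) * cis (2 * pi * (t \<bullet> snd z)))"
    proof (rule Bochner_Integration.integrable_bound[OF integrable_mult_left[OF Vi, of "complex_of_real G"]])
      have "(\<lambda>z. V z * \<gamma> (t - fst z) * cis (2 * pi * (t \<bullet> snd z))) \<in> borel_measurable (lborel \<Otimes>\<^sub>M lborel)"
        by measurable
      then show "(\<lambda>z. V z * \<gamma> (t - fst z) * cis (2 * pi * (t \<bullet> snd z))) \<in> borel_measurable lborel" by (simp add: lborel_prod)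
      show "AE z in lborel. norm (V z * \<gamma> (t - fst z) * cis (2 * pi * (t \<bullet> snd z))) \<le> norm (V z * complex_of_real G)"
        by (intro AE_I2) (auto simp: norm_mult intro!: mult_left_mono order_trans[OF G abs_ge_self])
    qed
    then have i: "integrable (lborel \<Otimes>\<^sub>M lborel) (\<lambda>z. V z * \<gamma> (t - fst z) * cis (2 * pi * (t \<bullet> snd z)))"
      by (simp add: lborel_prod)
    have "(\<integral>z. V z * \<gamma> (t - fst z) * cis (2 * pi * (t \<bullet> snd z)) \<partial>lborel) = (\<integral>x. \<integral>w. \<gamma> (t - x) * (V (x, w) * cis (2 * pi * (t \<bullet> w))) \<partial>lborel \<partial>lborel)"
      using lborel_pair.integral_fst'[OF i] by (simp add: lborel_prod mult_ac)
    then show ?thesis by (simp add: E_def)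
  qed
  define J where "J = (\<integral>y. decay (2 * DIM('a)) (y::'a) \<partial>lborel)"
  have J0: "J \<ge> 0" by (simp add: J_def)
  have Jn: "(\<integral>\<^sup>+y. ennreal (decay (2 * DIM('a)) (y::'a)) \<partial>lborel) = ennreal J"
    unfolding J_def by (intro nn_integral_eq_integral integrable_decay) auto
  let ?C = "ennreal (D\<^sup>2 * J)"
  have pt: "ennreal ((p t * norm (\<integral>x. \<gamma> (t - x) * E x t \<partial>lborel))\<^sup>2) \<le> ?C * (\<integral>\<^sup>+x. ennreal ((p x * norm (E x t))\<^sup>2) \<partial>lborel)" for t
  proof -
    have "ennreal (p t * norm (\<integral>x. \<gamma> (t - x) * E x t \<partial>lborel)) = ennreal (p t) * ennreal (norm (\<integral>x. \<gamma> (t - x) * E x t \<partial>lborel))"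
      using p[of t] by (simp add: ennreal_mult)
    also have "\<dots> \<le> ennreal (p t) * (\<integral>\<^sup>+x. ennreal (norm (\<gamma> (t - x) * E x t)) \<partial>lborel)"
      by (intro mult_left_mono norm_integral_le_nn_integral) auto
    also have "\<dots> = (\<integral>\<^sup>+x. ennreal (p t) * ennreal (norm (\<gamma> (t - x) * E x t)) \<partial>lborel)"
      by (rule nn_integral_cmult[symmetric]) measurable
    also have "\<dots> \<le> (\<integral>\<^sup>+x. ennreal (D * decay DIM('a) (t - x)) * ennreal (p x * norm (E x t)) \<partial>lborel)"
    proof (rule nn_integral_mono)
      fix x
      have "p t * norm (\<gamma> (t - x) * E x t) \<le> (D * decay DIM('a) (t - x)) * (p x * norm (E x t))"
        using mult_right_mono[OF D[of t x] norm_ge_zero[of "E x t"]] by (simp add: norm_mult mult_ac)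
      then show "ennreal (p t) * ennreal (norm (\<gamma> (t - x) * E x t)) \<le> ennreal (D * decay DIM('a) (t - x)) * ennreal (p x * norm (E x t))"
        using p[of t] p[of x] D0 by (simp add: ennreal_mult[symmetric] less_imp_le)
    qed
    finally have "(ennreal (p t * norm (\<integral>x. \<gamma> (t - x) * E x t \<partial>lborel)))\<^sup>2 \<le> (\<integral>\<^sup>+x. ennreal (D * decay DIM('a) (t - x)) * ennreal (p x * norm (E x t)) \<partial>lborel)\<^sup>2"
      by (rule power_mono) simp
    also have "\<dots> \<le> (\<integral>\<^sup>+x. (ennreal (D * decay DIM('a) (t - x)))\<^sup>2 \<partial>lborel) * (\<integral>\<^sup>+x. (ennreal (p x * norm (E x t)))\<^sup>2 \<partial>lborel)"
      by (rule Cauchy_Schwarz_nn_integral) measurable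
    also have "(\<integral>\<^sup>+x. (ennreal (D * decay DIM('a) (t - x)))\<^sup>2 \<partial>lborel) = (\<integral>\<^sup>+x. ennreal (D\<^sup>2) * ennreal (decay (2 * DIM('a)) (t - x)) \<partial>lborel)"
    proof (rule nn_integral_cong)
      fix x
      have "(decay DIM('a) (t - x))\<^sup>2 = decay (2 * DIM('a)) (t - x)"
        by (simp add: decay_def power_inverse power_mult mult.commute)
      then show "(ennreal (D * decay DIM('a) (t - x)))\<^sup>2 = ennreal (D\<^sup>2) * ennreal (decay (2 * DIM('a)) (t - x))"
        using D0 by (simp add: ennreal_power ennreal_mult[symmetric] power_mult_distrib)
    qed
    also have "\<dots> = ennreal (D\<^sup>2) * (\<integral>\<^sup>+x. ennreal (decay (2 * DIM('a)) (t - x)) \<partial>lborel)"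
      by (rule nn_integral_cmult) measurable
    also have "(\<integral>\<^sup>+x. ennreal (decay (2 * DIM('a)) (t - x)) \<partial>lborel) = ennreal J"
      using lborel_nn_integral_reflect[of "\<lambda>y. ennreal (decay (2 * DIM('a)) y)" t] Jn by simp
    finally show ?thesis using p J0 by (simp add: ennreal_power ennreal_mult[symmetric] less_imp_le)
  qed
  have "(\<integral>\<^sup>+t. ennreal ((p t * norm (\<integral>z. V z * \<gamma> (t - fst z) * cis (2 * pi * (t \<bullet> snd z)) \<partial>lborel))\<^sup>2) \<partial>lborel)
    \<le> (\<integral>\<^sup>+t. ?C * (\<integral>\<^sup>+x. ennreal ((p x * norm (E x t))\<^sup>2) \<partial>lborel) \<partial>lborel)"
    unfolding h by (intro nn_integral_mono pt)
  also have "\<dots> = ?C * (\<integral>\<^sup>+t. \<integral>\<^sup>+x. ennreal ((p x * norm (E x t))\<^sup>2) \<partial>lborel \<partial>lborel)"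
    by (rule nn_integral_cmult) measurable
  also have "(\<integral>\<^sup>+t. \<integral>\<^sup>+x. ennreal ((p x * norm (E x t))\<^sup>2) \<partial>lborel \<partial>lborel) = (\<integral>\<^sup>+x. \<integral>\<^sup>+t. ennreal ((p x * norm (E x t))\<^sup>2) \<partial>lborel \<partial>lborel)"
    by (rule lborel_pair.Fubini') measurable
  also have "\<dots> \<le> (\<integral>\<^sup>+x. \<integral>\<^sup>+w. ennreal ((p x * norm (V (x, w)))\<^sup>2) \<partial>lborel \<partial>lborel)"
  proof (rule nn_integral_mono)
    fix x
    have Em: "(\<lambda>t. E x t) \<in> borel_measurable borel" unfolding E_def by measurable
    have Ef: "E x t = fourier (\<lambda>w. V (x, w)) (0 - t)" for t
      by (simp add: E_def fourier_def inner_commute)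
    have fm [measurable]: "fourier (\<lambda>w. V (x, w)) \<in> borel_measurable borel" by (rule fourier_measurable[OF Vx])
    have "(\<integral>\<^sup>+t. ennreal ((p x * norm (E x t))\<^sup>2) \<partial>lborel) = ennreal ((p x)\<^sup>2) * (\<integral>\<^sup>+t. ennreal ((norm (E x t))\<^sup>2) \<partial>lborel)"
      using Em by (subst nn_integral_cmult[symmetric]) (auto simp: power_mult_distrib ennreal_mult)
    also have "(\<integral>\<^sup>+t. ennreal ((norm (E x t))\<^sup>2) \<partial>lborel) = (\<integral>\<^sup>+t. ennreal ((norm (fourier (\<lambda>w. V (x, w)) t))\<^sup>2) \<partial>lborel)"
      unfolding Ef by (rule lborel_nn_integral_reflect[of "\<lambda>t. ennreal ((norm (fourier (\<lambda>w. V (x, w)) t))\<^sup>2)"]) measurable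
    also have "\<dots> \<le> (\<integral>\<^sup>+w. ennreal ((norm (V (x, w)))\<^sup>2) \<partial>lborel)"
      by (rule fourier_bessel[OF Vxi])
    also have "ennreal ((p x)\<^sup>2) * (\<integral>\<^sup>+w. ennreal ((norm (V (x, w)))\<^sup>2) \<partial>lborel) = (\<integral>\<^sup>+w. ennreal ((p x * norm (V (x, w)))\<^sup>2) \<partial>lborel)"
      by (subst nn_integral_cmult[symmetric]) (auto simp: power_mult_distrib ennreal_mult)
    finally show "(\<integral>\<^sup>+t. ennreal ((p x * norm (E x t))\<^sup>2) \<partial>lborel) \<le> (\<integral>\<^sup>+w. ennreal ((p x * norm (V (x, w)))\<^sup>2) \<partial>lborel)"
      by (simp add: mult_left_mono)
  qed
  also have "\<dots> = (\<integral>\<^sup>+z. ennreal ((p (fst z) * norm (V z))\<^sup>2) \<partial>(lborel \<Otimes>\<^sub>M lborel))"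
    using lborel.nn_integral_fst[of "\<lambda>z. ennreal ((p (fst z) * norm (V z))\<^sup>2)" lborel] by simp
  finally show ?thesis by (simp add: lborel_prod J_def mult_left_mono)
qed

lemma synthesis_duality:
  fixes V :: "'a::euclidean_space \<times> 'a \<Rightarrow> complex" and \<gamma> f :: "'a \<Rightarrow> complex"
  assumes V [measurable]: "V \<in> borel_measurable borel" and Vi: "integrable lborel V"
    and [measurable]: "\<gamma> \<in> borel_measurable borel" and G: "\<And>x. norm (\<gamma> x) \<le> G" and f: "integrable lborel f"
  shows "integrable lborel (\<lambda>t. (\<integral>z. V z * \<gamma> (t - fst z) * cis (2 * pi * (t \<bullet> snd z)) \<partial>lborel) * f t)"
    and "(\<integral>t. (\<integral>z. V z * \<gamma> (t - fst z) * cis (2 * pi * (t \<bullet> snd z)) \<partial>lborel) * f t \<partial>lborel) = (\<integral>z. V z * stft_dual \<gamma> f z \<partial>lborel)"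
proof -
  have [measurable]: "f \<in> borel_measurable borel" using borel_measurable_integrable[OF f] by simp
  let ?H = "\<lambda>(t::'a) (z::'a \<times> 'a). V z * \<gamma> (t - fst z) * cis (2 * pi * (t \<bullet> snd z)) * f t"
  have [measurable]: "(\<lambda>z::'a \<times> ('a \<times> 'a). fst (snd z)) \<in> borel_measurable (borel \<Otimes>\<^sub>M borel)"
      "(\<lambda>z::'a \<times> ('a \<times> 'a). snd (snd z)) \<in> borel_measurable (borel \<Otimes>\<^sub>M borel)"
    unfolding borel_prod by (intro borel_measurable_continuous_onI continuous_intros)+
  have m: "case_prod ?H \<in> borel_measurable (lborel \<Otimes>\<^sub>M lborel)"
    unfolding split_beta by measurable
  have i: "integrable (lborel \<Otimes>\<^sub>M lborel) (case_prod ?H)"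
  proof (rule integrable_pair_bound[OF f integrable_mult_left[OF Vi, of "complex_of_real G"] m])
    fix t :: 'a and z :: "'a \<times> 'a"
    have "norm (V z) * norm (\<gamma> (t - fst z)) * norm (f t) \<le> norm (V z) * \<bar>G\<bar> * norm (f t)"
      by (intro mult_right_mono mult_left_mono order_trans[OF G abs_ge_self]) auto
    then show "norm (?H t z) \<le> norm (f t) * norm (V z * complex_of_real G)"
      by (simp add: norm_mult mult.commute)
  qed
  show "integrable lborel (\<lambda>t. (\<integral>z. V z * \<gamma> (t - fst z) * cis (2 * pi * (t \<bullet> snd z)) \<partial>lborel) * f t)"
    using lborel_pair.integrable_fst[OF i] by simp
  have "(\<integral>t. (\<integral>z. V z * \<gamma> (t - fst z) * cis (2 * pi * (t \<bullet> snd z)) \<partial>lborel) * f t \<partial>lborel) = (\<integral>t. \<integral>z. ?H t z \<partial>lborel \<partial>lborel)"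
    by simp
  also have "\<dots> = (\<integral>z. \<integral>t. ?H t z \<partial>lborel \<partial>lborel)"
    using lborel_pair.Fubini_integral[OF i] by simp
  also have "\<dots> = (\<integral>z. V z * stft_dual \<gamma> f z \<partial>lborel)"
  proof (rule Bochner_Integration.integral_cong[OF refl])
    fix z
    have "(\<integral>t. ?H t z \<partial>lborel) = (\<integral>t. V z * (f t * \<gamma> (t - fst z) * cis (2 * pi * (t \<bullet> snd z))) \<partial>lborel)"
      by (simp only: mult_ac)
    then show "(\<integral>t. ?H t z \<partial>lborel) = V z * stft_dual \<gamma> f z"
      by (simp add: stft_dual_def split_beta)
  qed
  finally show "(\<integral>t. (\<integral>z. V z * \<gamma> (t - fst z) * cis (2 * pi * (t \<bullet> snd z)) \<partial>lborel) * f t \<partial>lborel) = (\<integral>z. V z * stft_dual \<gamma> f z \<partial>lborel)" .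
qed

text \<open>Square summability alone does not make a series converge; with the weights \<open>4 ^ k\<close> it does.\<close>

lemma geometric_square_bound:
  fixes a :: "nat \<Rightarrow> real"
  shows "(\<Sum>k<n. a k)\<^sup>2 \<le> 2 * (\<Sum>k<n. 4 ^ k * (a k)\<^sup>2)"
proof -
  have "(\<Sum>k<n. (1/2) ^ k * (2 ^ k * a k))\<^sup>2 \<le> (\<Sum>k<n. ((1/2) ^ k)\<^sup>2) * (\<Sum>k<n. (2 ^ k * a k)\<^sup>2)"
    by (rule Cauchy_Schwarz_ineq_sum)
  moreover have "(1/2) ^ k * (2 ^ k * a k) = a k" for k
    by (simp add: power_divide)
  moreover have "(2 ^ k * a k)\<^sup>2 = 4 ^ k * (a k)\<^sup>2" for k
  proof -
    have "((2::real) ^ k)\<^sup>2 = (2\<^sup>2) ^ k" by (simp only: power_mult[symmetric] mult.commute)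
    then show ?thesis by (simp add: power_mult_distrib)
  qed
  moreover have "(\<Sum>k<n. ((1/2::real) ^ k)\<^sup>2) \<le> 2"
  proof -
    have "(\<Sum>k<n. ((1/2::real) ^ k)\<^sup>2) \<le> (\<Sum>k<n. (1/2) ^ k)"
      by (intro sum_mono) (simp add: power2_eq_square mult_left_le power_le_one)
    also have "\<dots> \<le> (\<Sum>k. (1/2::real) ^ k)"
      by (intro sum_le_suminf summable_geometric) auto
    also have "\<dots> = 2" by (subst suminf_geometric) auto
    finally show ?thesis .
  qed
  moreover have "(\<Sum>k<n. 4 ^ k * (a k)\<^sup>2) \<ge> 0" by (intro sum_nonneg) simp
  ultimately have "(\<Sum>k<n. a k)\<^sup>2 \<le> (\<Sum>k<n. ((1/2) ^ k)\<^sup>2) * (\<Sum>k<n. 4 ^ k * (a k)\<^sup>2)"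
      and "(\<Sum>k<n. ((1/2::real) ^ k)\<^sup>2) * (\<Sum>k<n. 4 ^ k * (a k)\<^sup>2) \<le> 2 * (\<Sum>k<n. 4 ^ k * (a k)\<^sup>2)"
    by (simp_all only: mult_right_mono)
  then show ?thesis by (rule order_trans)
qed

text \<open>Integrating \<open>U\<close> against the kernel over all of phase space need not converge absolutely. It does
  over bounded shells, where \<open>synthesis_bound\<close> applies. If the shells are chosen so that their energies
  decay geometrically, the resulting functions sum up almost everywhere, with a square integrable
  majorant for the partial sums.\<close>

theorem L2_representation:
  fixes U :: "'a::euclidean_space \<times> 'a \<Rightarrow> complex" and p :: "'a \<Rightarrow> real" and \<gamma> :: "'a \<Rightarrow> complex"
  assumes Um [measurable]: "U \<in> borel_measurable borel" and U: "slow U"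
    and pm [measurable]: "p \<in> borel_measurable borel" and pp: "\<And>x. p x > 0"
    and pmod: "\<And>x t. p t \<le> Cp * p x * (1 + norm (t - x)) ^ n"
    and \<gamma>: "\<gamma> \<in> schwartz"
    and L2: "integrable lborel (\<lambda>z. (p (fst z) * norm (U z))\<^sup>2)"
  shows "\<exists>h. h \<in> borel_measurable borel \<and> integrable lborel (\<lambda>t. (p t * norm (h t))\<^sup>2) \<and>
    (\<forall>f\<in>schwartz. integrable lborel (\<lambda>t. h t * f t) \<and> (\<integral>t. h t * f t \<partial>lborel) = (\<integral>z. U z * stft_dual \<gamma> f z \<partial>lborel))"
proof -
  have [measurable]: "\<gamma> \<in> borel_measurable borel" using \<gamma> by measurable
  have [measurable]: "(\<lambda>z::'a \<times> 'a. p (fst z)) \<in> borel_measurable borel"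
  proof -
    have "(fst :: 'a \<times> 'a \<Rightarrow> 'a) \<in> borel_measurable borel"
      by (intro borel_measurable_continuous_onI continuous_intros)
    then show ?thesis by measurable
  qed
  obtain G where G: "\<And>x. norm (\<gamma> x) \<le> G" using schwartz_bounded[OF \<gamma>] by blast
  have Cp: "Cp > 0"
  proof (rule ccontr)
    assume "\<not> Cp > 0"
    then have "Cp * p 0 * (1 + norm (0 - 0::'a)) ^ n \<le> 0" using pp[of 0] by (simp add: mult_nonpos_nonneg)
    with pmod[of 0 0] pp[of 0] show False by linarith
  qed
  \<comment> \<open>The moderateness of the weight is absorbed by the rapid decay of the window.\<close>
  obtain C1 where C1: "C1 \<ge> 0" "\<And>x. norm (\<gamma> x) \<le> C1 * decay (n + DIM('a)) x"
    using rapid_bound_decay[OF schwartz_rapid[OF \<gamma>]] by metis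
  define D where "D = Cp * C1"
  have D0: "D \<ge> 0" using Cp C1 by (simp add: D_def)
  have D: "p t * norm (\<gamma> (t - x)) \<le> D * p x * decay DIM('a) (t - x)" for x t
  proof -
    have "p t * norm (\<gamma> (t - x)) \<le> (Cp * p x * (1 + norm (t - x)) ^ n) * (C1 * decay (n + DIM('a)) (t - x))"
      using pp[of x] Cp by (intro mult_mono pmod C1) auto
    also have "\<dots> = D * p x * ((1 + norm (t - x)) ^ n * decay (n + DIM('a)) (t - x))" by (simp add: D_def)
    finally show ?thesis unfolding decay_power .
  qed
  define c0 where "c0 = D\<^sup>2 * (\<integral>y. decay (2 * DIM('a)) (y::'a) \<partial>lborel)"
  have c0: "c0 \<ge> 0" by (simp add: c0_def)
  define N where "N z = (p (fst z) * norm (U z))\<^sup>2" for z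
  have Ni: "integrable lborel N" using L2 by (simp add: N_def[abs_def])
  have N0: "N z \<ge> 0" for z by (simp add: N_def)
  have [measurable]: "N \<in> borel_measurable borel" unfolding N_def by measurable
  \<comment> \<open>The tails are made to decay like \<open>8 ^ - k\<close>, which beats the factor \<open>4 ^ k\<close> of \<open>geometric_square_bound\<close>.\<close>
  have "\<exists>r::nat. (\<integral>z. N z * indicator {z. real r \<le> norm z} z \<partial>lborel) \<le> (1/8) ^ k" for k
  proof -
    have "(\<lambda>r::nat. \<integral>z. N z * indicator {z. real r \<le> norm z} z \<partial>lborel) \<longlonglongrightarrow> (\<integral>z. 0 \<partial>(lborel :: ('a \<times> 'a) measure))"
    proof (rule integral_dominated_convergence[OF _ _ Ni])
      show "AE z in lborel. (\<lambda>r::nat. N z * indicator {z. real r \<le> norm z} z) \<longlonglongrightarrow> 0"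
      proof (rule AE_I2)
        fix z :: "'a \<times> 'a"
        obtain r0 :: nat where r0: "norm z < real r0" using reals_Archimedean2 by blast
        then have "\<forall>r\<ge>r0. N z * indicator {z. real r \<le> norm z} z = 0" by (auto simp: indicator_def)
        then show "(\<lambda>r::nat. N z * indicator {z. real r \<le> norm z} z) \<longlonglongrightarrow> 0"
          by (intro tendsto_eventually) (auto simp: eventually_sequentially)
      qed
    qed (auto simp: N0 indicator_def)
    then have "eventually (\<lambda>r::nat. (\<integral>z. N z * indicator {z. real r \<le> norm z} z \<partial>lborel) < (1/8) ^ k) sequentially"
      by (intro order_tendstoD(2)) auto
    then show ?thesis by (auto simp: eventually_sequentially intro: less_imp_le)
  qed
  then obtain \<rho> :: "nat \<Rightarrow> nat" where \<rho>: "\<And>k. (\<integral>z. N z * indicator {z. real (\<rho> k) \<le> norm z} z \<partial>lborel) \<le> (1/8) ^ k"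
    by metis
  \<comment> \<open>Adding \<open>k\<close> and all earlier radii makes the radii increase to infinity.\<close>
  define R where "R k = k + (\<Sum>j\<le>k. \<rho> j)" for k
  have R1: "k \<le> R k" and R2: "\<rho> k \<le> R k" and R3: "R k \<le> R (Suc k)" for k
    using member_le_sum[of k "{..k}" \<rho>] by (auto simp: R_def)
  define S where "S k = (case k of 0 \<Rightarrow> {z::'a \<times> 'a. norm z < real (R 0)} | Suc j \<Rightarrow> {z. real (R j) \<le> norm z \<and> norm z < real (R (Suc j))})" for k
  have [measurable]: "S k \<in> sets borel" for k
    unfolding S_def by (cases k) auto
  have Sle: "norm z \<le> real (R k)" if "z \<in> S k" for k z
    using that by (cases k) (auto simp: S_def)
  have Ssum: "(\<Sum>k<Suc m. indicator (S k) z) = (indicator {z. norm z < real (R m)} z :: complex)" for m z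
  proof (induction m)
    case (Suc m)
    have "(\<Sum>k<Suc (Suc m). indicator (S k) z) = (indicator {z. norm z < real (R m)} z + indicator (S (Suc m)) z :: complex)"
      using Suc by simp
    then show ?case using R3[of m] by (auto simp: S_def indicator_def)
  qed (simp add: S_def)
  define V where "V k z = U z * indicator (S k) z" for k z
  have Vm [measurable]: "V k \<in> borel_measurable borel" for k unfolding V_def by measurable
  obtain CU KU where CU: "CU \<ge> 0" "\<And>z. norm (U z) \<le> CU * (1 + norm z) ^ KU" using slowE[OF U] by metis
  have VB: "norm (V k z) \<le> CU * (1 + real (R k)) ^ KU" for k z
  proof (cases "z \<in> S k")
    case True
    then have "norm (V k z) \<le> CU * (1 + norm z) ^ KU" using CU(2)[of z] by (simp add: V_def)
    also have "\<dots> \<le> CU * (1 + real (R k)) ^ KU" using Sle[OF True] by (intro mult_left_mono power_mono CU) auto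
    finally show ?thesis .
  qed (simp add: V_def CU(1))
  have Vs: "V k z = 0" if "norm z > real (R k)" for k z
    using that Sle[of z k] by (cases "z \<in> S k") (auto simp: V_def)
  have Vi: "integrable lborel (V k)" for k by (rule bounded_support_integrable[OF Vm VB Vs])
  define h where "h k t = (\<integral>z. V k z * \<gamma> (t - fst z) * cis (2 * pi * (t \<bullet> snd z)) \<partial>lborel)" for k t
  have hm [measurable]: "h k \<in> borel_measurable borel" for k
  proof -
    have [measurable]: "(\<lambda>z::'a \<times> ('a \<times> 'a). fst (snd z)) \<in> borel_measurable (borel \<Otimes>\<^sub>M borel)"
      "(\<lambda>z::'a \<times> ('a \<times> 'a). snd (snd z)) \<in> borel_measurable (borel \<Otimes>\<^sub>M borel)"
      unfolding borel_prod by (intro borel_measurable_continuous_onI continuous_intros)+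
    show ?thesis unfolding h_def[abs_def]
      by (rule lborel.borel_measurable_lebesgue_integral[of "\<lambda>t z. V k z * \<gamma> (t - fst z) * cis (2 * pi * (t \<bullet> snd z))" borel])
        (unfold split_beta, measurable)
  qed
  \<comment> \<open>The value 8 compensates the shift by one between shells and tails; the integral covers the innermost ball.\<close>
  define A where "A = max (\<integral>z. N z \<partial>lborel) 8"
  have A: "A \<ge> 8" "(\<integral>z. N z \<partial>lborel) \<le> A" by (auto simp: A_def)
  have energy: "(\<integral>\<^sup>+z. ennreal ((p (fst z) * norm (V k z))\<^sup>2) \<partial>lborel) \<le> ennreal (A * (1/8) ^ k)" for k
  proof -
    have i: "integrable lborel (\<lambda>z. N z * indicator (T :: ('a \<times> 'a) set) z)" if "T \<in> sets borel" for T
      by (rule Bochner_Integration.integrable_bound[OF Ni]) (use that in \<open>auto simp: indicator_def\<close>)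
    have "(p (fst z) * norm (V k z))\<^sup>2 = N z * indicator (S k) z" for z
      by (simp add: V_def N_def indicator_def)
    then have "(\<integral>\<^sup>+z. ennreal ((p (fst z) * norm (V k z))\<^sup>2) \<partial>lborel) = ennreal (\<integral>z. N z * indicator (S k) z \<partial>lborel)"
      by (simp add: nn_integral_eq_integral i N0)
    also have "(\<integral>z. N z * indicator (S k) z \<partial>lborel) \<le> A * (1/8) ^ k"
    proof (cases k)
      case 0
      have "(\<integral>z. N z * indicator (S k) z \<partial>lborel) \<le> (\<integral>z. N z \<partial>lborel)"
        by (intro integral_mono i Ni) (auto simp: indicator_def N0)
      then show ?thesis using A 0 by simp
    next
      case (Suc j)
      have "(\<integral>z. N z * indicator (S k) z \<partial>lborel) \<le> (\<integral>z. N z * indicator {z. real (\<rho> j) \<le> norm z} z \<partial>lborel)"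
        using R2[of j] by (intro integral_mono i) (auto simp: indicator_def N0 S_def Suc)
      also have "\<dots> \<le> (1/8) ^ j" by (rule \<rho>)
      also have "\<dots> \<le> A * (1/8) ^ k" using A by (simp add: Suc)
      finally show ?thesis .
    qed
    finally show ?thesis by (simp add: ennreal_leI)
  qed
  define Q where "Q t = (\<Sum>k. ennreal (4 ^ k * (p t * norm (h k t))\<^sup>2))" for t
  have [measurable]: "Q \<in> borel_measurable borel" unfolding Q_def by measurable
  have "(\<integral>\<^sup>+t. Q t \<partial>lborel) = (\<Sum>k. \<integral>\<^sup>+t. ennreal (4 ^ k * (p t * norm (h k t))\<^sup>2) \<partial>lborel)"
    unfolding Q_def by (rule nn_integral_suminf) measurable
  also have "\<dots> \<le> (\<Sum>k. ennreal (c0 * A * (1/2) ^ k))"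
  proof (intro suminf_le allI summableI)
    fix k
    have "(\<integral>\<^sup>+t. ennreal (4 ^ k * (p t * norm (h k t))\<^sup>2) \<partial>lborel) = (\<integral>\<^sup>+t. ennreal (4 ^ k) * ennreal ((p t * norm (h k t))\<^sup>2) \<partial>lborel)"
      by (simp add: ennreal_mult)
    also have "\<dots> = ennreal (4 ^ k) * (\<integral>\<^sup>+t. ennreal ((p t * norm (h k t))\<^sup>2) \<partial>lborel)"
      by (rule nn_integral_cmult) measurable
    also have "\<dots> \<le> ennreal (4 ^ k) * (ennreal c0 * ennreal (A * (1/8) ^ k))"
    proof (rule mult_left_mono)
      have "(\<integral>\<^sup>+t. ennreal ((p t * norm (h k t))\<^sup>2) \<partial>lborel) \<le> ennreal c0 * (\<integral>\<^sup>+z. ennreal ((p (fst z) * norm (V k z))\<^sup>2) \<partial>lborel)"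
        unfolding h_def c0_def by (rule synthesis_bound[OF Vm VB Vs _ G pm pp D0 D]) measurable
      also have "\<dots> \<le> ennreal c0 * ennreal (A * (1/8) ^ k)" by (intro mult_left_mono energy) simp
      finally show "(\<integral>\<^sup>+t. ennreal ((p t * norm (h k t))\<^sup>2) \<partial>lborel) \<le> ennreal c0 * ennreal (A * (1/8) ^ k)" .
    qed simp
    also have "\<dots> = ennreal (4 ^ k * (c0 * (A * (1/8) ^ k)))"
      using A c0 by (simp add: ennreal_mult)
    also have "4 ^ k * (c0 * (A * (1/8) ^ k)) = c0 * A * (4 ^ k * (1/8) ^ k)" by simp
    also have "(4::real) ^ k * (1/8) ^ k = (1/2) ^ k" by (simp add: power_mult_distrib[symmetric])
    finally show "(\<integral>\<^sup>+t. ennreal (4 ^ k * (p t * norm (h k t))\<^sup>2) \<partial>lborel) \<le> ennreal (c0 * A * (1/2) ^ k)" .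
  qed
  also have "\<dots> < \<infinity>"
  proof -
    have "summable (\<lambda>k. c0 * A * (1/2) ^ k)" by (intro summable_mult summable_geometric) simp
    then have "(\<Sum>k. ennreal (c0 * A * (1/2) ^ k)) = ennreal (\<Sum>k. c0 * A * (1/2) ^ k)"
      using A c0 by (intro suminf_ennreal_eq) (auto simp: summable_sums)
    then show ?thesis by simp
  qed
  finally have Qfin: "(\<integral>\<^sup>+t. Q t \<partial>lborel) < \<infinity>" .
  \<comment> \<open>The majorant of the squares of all partial sums.\<close>
  define q where "q t = enn2real (Q t)" for t
  have [measurable]: "q \<in> borel_measurable borel" unfolding q_def by measurable
  have q0: "q t \<ge> 0" for t by (simp add: q_def)
  have AEQ: "AE t in lborel. Q t \<noteq> \<infinity>"
    by (rule nn_integral_PInf_AE) (use Qfin in auto)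
  have qi: "integrable lborel q"
  proof (rule integrableI_bounded)
    have "(\<integral>\<^sup>+t. ennreal (norm (q t)) \<partial>lborel) \<le> (\<integral>\<^sup>+t. Q t \<partial>lborel)"
      by (intro nn_integral_mono) (simp add: q_def ennreal_enn2real_if)
    then show "(\<integral>\<^sup>+t. ennreal (norm (q t)) \<partial>lborel) < \<infinity>" using Qfin by (rule le_less_trans)
  qed simp
  have part: "(p t * (\<Sum>k<m. norm (h k t)))\<^sup>2 \<le> 2 * q t" if Qt: "Q t \<noteq> \<infinity>" for t m
  proof -
    have "ennreal (\<Sum>k<m. 4 ^ k * (p t * norm (h k t))\<^sup>2) = (\<Sum>k<m. ennreal (4 ^ k * (p t * norm (h k t))\<^sup>2))"
      by (rule sum_ennreal[symmetric]) simp
    also have "\<dots> \<le> Q t" unfolding Q_def by (intro sum_le_suminf summableI) auto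
    also have "Q t = ennreal (q t)" using Qt by (simp add: q_def less_top)
    finally have "(\<Sum>k<m. 4 ^ k * (p t * norm (h k t))\<^sup>2) \<le> q t" using q0 by (simp add: ennreal_le_iff)
    then have "2 * (\<Sum>k<m. 4 ^ k * (p t * norm (h k t))\<^sup>2) \<le> 2 * q t" by (rule mult_left_mono) simp
    moreover have "(p t * (\<Sum>k<m. norm (h k t)))\<^sup>2 \<le> 2 * (\<Sum>k<m. 4 ^ k * (p t * norm (h k t))\<^sup>2)"
      unfolding sum_distrib_left[of "p t" "\<lambda>k. norm (h k t)" "{..<m}"]
      by (rule geometric_square_bound)
    ultimately show ?thesis by (rule order_trans[rotated])
  qed
  have summ: "summable (\<lambda>k. norm (h k t))" if Qt: "Q t \<noteq> \<infinity>" for t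
  proof (rule bounded_imp_summable)
    show "(\<Sum>k\<le>m. norm (h k t)) \<le> sqrt (2 * q t) / p t" for m
    proof -
      have "p t * (\<Sum>k<Suc m. norm (h k t)) \<le> sqrt (2 * q t)"
        by (rule real_le_rsqrt[OF part[OF Qt]])
      then have "(\<Sum>k<Suc m. norm (h k t)) * p t \<le> sqrt (2 * q t)" by (subst mult.commute)
      then show ?thesis unfolding pos_le_divide_eq[OF pp[of t]] lessThan_Suc_atMost .
    qed
  qed simp
  define H where "H t = (\<Sum>k. h k t)" for t
  have Hm [measurable]: "H \<in> borel_measurable borel" unfolding H_def by measurable
  have conv: "(\<lambda>m. \<Sum>k<m. h k t) \<longlonglongrightarrow> H t" if Qt: "Q t \<noteq> \<infinity>" for t
    unfolding H_def by (rule summable_LIMSEQ[OF summable_norm_cancel[OF summ[OF Qt]]])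
  have partn: "(p t * norm (\<Sum>k<m. h k t))\<^sup>2 \<le> 2 * q t" if Qt: "Q t \<noteq> \<infinity>" for t m
  proof -
    have "p t * norm (\<Sum>k<m. h k t) \<le> p t * (\<Sum>k<m. norm (h k t))"
      using pp[of t] by (intro mult_left_mono norm_sum) auto
    then have "(p t * norm (\<Sum>k<m. h k t))\<^sup>2 \<le> (p t * (\<Sum>k<m. norm (h k t)))\<^sup>2"
      using pp[of t] by (intro power_mono) auto
    with part[OF Qt, of m] show ?thesis by linarith
  qed
  have Hle: "(p t * norm (H t))\<^sup>2 \<le> 2 * q t" if Qt: "Q t \<noteq> \<infinity>" for t
  proof (rule LIMSEQ_le_const2)
    show "(\<lambda>m. (p t * norm (\<Sum>k<m. h k t))\<^sup>2) \<longlonglongrightarrow> (p t * norm (H t))\<^sup>2"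
      by (intro tendsto_intros conv[OF Qt])
  qed (use partn[OF Qt] in auto)
  have H2: "integrable lborel (\<lambda>t. (p t * norm (H t))\<^sup>2)"
  proof (rule Bochner_Integration.integrable_bound[OF integrable_mult_right[OF qi, of 2]])
    show "AE t in lborel. norm ((p t * norm (H t))\<^sup>2) \<le> norm (2 * q t)"
      using AEQ by eventually_elim (use Hle q0 in auto)
  qed measurable
  have main: "integrable lborel (\<lambda>t. H t * f t) \<and> (\<integral>t. H t * f t \<partial>lborel) = (\<integral>z. U z * stft_dual \<gamma> f z \<partial>lborel)"
    if f: "f \<in> schwartz" for f
  proof -
    have [measurable]: "f \<in> borel_measurable borel" using f by measurable
    have fi: "integrable lborel f" by (rule schwartz_integrable[OF f])
    have fp: "integrable lborel (\<lambda>t. (norm (f t) / p t)\<^sup>2)"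
    proof -
      have "slow f" using rapidE[OF schwartz_rapid[OF f], of 0]
        unfolding slow_def by (metis (no_types, lifting) mult_1 mult_1_right power_0)
      then have ff: "rapid (\<lambda>t. f t * f t)" by (rule rapid_mult_slow[OF schwartz_rapid[OF f]])
      have "norm (complex_of_real ((norm (f t) / p t)\<^sup>2)) \<le> (Cp / p 0)\<^sup>2 * (1 + norm t) ^ (2 * n) * norm (f t * f t)" for t
      proof -
        have "p 0 \<le> Cp * p t * (1 + norm t) ^ n" using pmod[of 0 t] by simp
        then have "1 / p t \<le> Cp / p 0 * (1 + norm t) ^ n"
          using pp[of 0] pp[of t] by (simp add: field_simps)
        then have "norm (f t) * (1 / p t) \<le> norm (f t) * (Cp / p 0 * (1 + norm t) ^ n)" by (intro mult_left_mono) auto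
        then have "(norm (f t) * (1 / p t))\<^sup>2 \<le> (norm (f t) * (Cp / p 0 * (1 + norm t) ^ n))\<^sup>2"
          using pp[of t] by (intro power_mono) auto
        also have "\<dots> = (Cp / p 0)\<^sup>2 * (1 + norm t) ^ (2 * n) * norm (f t * f t)"
          unfolding mult_2 power_add norm_mult power2_eq_square by (simp only: mult_ac)
        finally show ?thesis unfolding norm_of_real abs_power2 by (simp only: times_divide_eq_right mult_1_right)
      qed
      from rapid_slow_integrable[OF ff this]
      have "integrable lborel (\<lambda>t. complex_of_real ((norm (f t) / p t)\<^sup>2))" by simp
      from integrable_Re[OF this] show ?thesis unfolding Re_complex_of_real .
    qed
    let ?w = "\<lambda>t. 2 * q t + (norm (f t) / p t)\<^sup>2"
    have wi: "integrable lborel ?w" by (intro Bochner_Integration.integrable_add integrable_mult_right qi fp)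
    have lim: "AE t in lborel. (\<lambda>m. (\<Sum>k<Suc m. h k t) * f t) \<longlonglongrightarrow> H t * f t"
      using AEQ by eventually_elim (intro tendsto_mult tendsto_const LIMSEQ_Suc[OF conv])
    have bd: "AE t in lborel. norm ((\<Sum>k<Suc m. h k t) * f t) \<le> ?w t" for m
      using AEQ
    proof eventually_elim
      fix t assume Qt: "Q t \<noteq> \<infinity>"
      let ?a = "p t * norm (\<Sum>k<Suc m. h k t)" and ?b = "norm (f t) / p t"
      have "norm ((\<Sum>k<Suc m. h k t) * f t) = ?a * ?b"
        using pp[of t] by (simp add: norm_mult)
      also have "\<dots> \<le> ?a\<^sup>2 + ?b\<^sup>2"
      proof -
        have "?a * ?b \<ge> 0" using pp[of t] by simp
        then show ?thesis using sum_squares_bound[of ?a ?b] by linarith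
      qed
      also have "\<dots> \<le> ?w t" by (intro add_right_mono partn[OF Qt])
      finally show "norm ((\<Sum>k<Suc m. h k t) * f t) \<le> ?w t" .
    qed
    have Hfm: "(\<lambda>t. H t * f t) \<in> borel_measurable lborel" by measurable
    have hfm: "(\<lambda>t. (\<Sum>k<Suc m. h k t) * f t) \<in> borel_measurable lborel" for m by measurable
    have int: "integrable lborel (\<lambda>t. H t * f t)"
      by (rule integrable_dominated_convergence[OF Hfm hfm wi lim bd])
    have lim1: "(\<lambda>m. \<integral>t. (\<Sum>k<Suc m. h k t) * f t \<partial>lborel) \<longlonglongrightarrow> (\<integral>t. H t * f t \<partial>lborel)"
      by (rule integral_dominated_convergence[OF Hfm hfm wi lim bd])
    have \<gamma>m: "\<gamma> \<in> borel_measurable borel" by measurable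
    note dual = synthesis_duality[OF Vm Vi \<gamma>m G fi, folded h_def]
    have [measurable]: "stft_dual \<gamma> f \<in> borel_measurable borel" by (rule stft_dual_measurable) measurable
    have Ui: "integrable lborel (\<lambda>z. U z * stft_dual \<gamma> f z)"
      using rapid_superposition_integrable[OF stft_dual_rapid[OF f \<gamma>] _ U Um] by (simp add: mult.commute)
    have dual_i: "integrable lborel (\<lambda>z. V k z * stft_dual \<gamma> f z)" for k
      by (rule Bochner_Integration.integrable_bound[OF Ui]) (auto simp: V_def indicator_def)
    have eq: "(\<integral>t. (\<Sum>k<Suc m. h k t) * f t \<partial>lborel) = (\<integral>z. indicator {z. norm z < real (R m)} z * (U z * stft_dual \<gamma> f z) \<partial>lborel)" for m
    proof -
      have "(\<integral>t. (\<Sum>k<Suc m. h k t) * f t \<partial>lborel) = (\<Sum>k<Suc m. \<integral>t. h k t * f t \<partial>lborel)"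
        unfolding sum_distrib_right by (rule Bochner_Integration.integral_sum) (rule dual(1))
      also have "\<dots> = (\<Sum>k<Suc m. \<integral>z. V k z * stft_dual \<gamma> f z \<partial>lborel)"
        by (intro sum.cong refl dual(2))
      also have "\<dots> = (\<integral>z. (\<Sum>k<Suc m. V k z * stft_dual \<gamma> f z) \<partial>lborel)"
        by (rule Bochner_Integration.integral_sum[symmetric]) (rule dual_i)
      also have "(\<lambda>z. \<Sum>k<Suc m. V k z * stft_dual \<gamma> f z) = (\<lambda>z. indicator {z. norm z < real (R m)} z * (U z * stft_dual \<gamma> f z))"
      proof
        fix z
        have "(\<Sum>k<Suc m. V k z * stft_dual \<gamma> f z) = (\<Sum>k<Suc m. indicator (S k) z) * (U z * stft_dual \<gamma> f z)"
          unfolding sum_distrib_right V_def by (intro sum.cong refl) (simp only: mult_ac)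
        then show "(\<Sum>k<Suc m. V k z * stft_dual \<gamma> f z) = indicator {z. norm z < real (R m)} z * (U z * stft_dual \<gamma> f z)"
          unfolding Ssum .
      qed
      finally show ?thesis .
    qed
    have "(\<lambda>m. \<integral>z. indicator {z. norm z < real (R m)} z * (U z * stft_dual \<gamma> f z) \<partial>lborel) \<longlonglongrightarrow> (\<integral>z. U z * stft_dual \<gamma> f z \<partial>lborel)"
    proof (rule integral_dominated_convergence[OF _ _ integrable_norm[OF Ui]])
      show "AE z in lborel. (\<lambda>m. indicator {z. norm z < real (R m)} z * (U z * stft_dual \<gamma> f z)) \<longlonglongrightarrow> U z * stft_dual \<gamma> f z"
      proof (rule AE_I2)
        fix z :: "'a \<times> 'a"
        obtain r0 :: nat where r0: "norm z < real r0" using reals_Archimedean2 by blast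
        have "norm z < real (R r)" if "r \<ge> r0" for r
          using r0 that R1[of r] by linarith
        then have "\<forall>r\<ge>r0. indicator {z. norm z < real (R r)} z * (U z * stft_dual \<gamma> f z) = U z * stft_dual \<gamma> f z" by simp
        then show "(\<lambda>m. indicator {z. norm z < real (R m)} z * (U z * stft_dual \<gamma> f z)) \<longlonglongrightarrow> U z * stft_dual \<gamma> f z"
          by (intro tendsto_eventually) (auto simp: eventually_sequentially)
      qed
    qed (auto simp: indicator_def)
    then have "(\<integral>t. H t * f t \<partial>lborel) = (\<integral>z. U z * stft_dual \<gamma> f z \<partial>lborel)"
      using lim1 unfolding eq by (rule LIMSEQ_unique[rotated])
    with int show ?thesis by blast
  qed
  show ?thesis using Hm H2 main by blast
qed

section \<open>Uniqueness of the representing function\<close>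

lemma gauss_schwartz: "(\<lambda>x::'a::euclidean_space. complex_of_real (gauss x)) \<in> schwartz"
proof -
  let ?Q = "\<lambda>x::'a. (- 1 / 2) * complex_of_real (x \<bullet> x)"
  have Q: "?Q \<in> smooth_class slow"
    by (rule smooth_class_cmult[OF additive_slow slow_class_inner[OF bounded_linear_ident bounded_linear_ident]])
  have eq: "exp (?Q x) = complex_of_real (gauss x)" for x
    by (simp add: gauss_def dot_square_norm flip: exp_of_real)
  \<comment> \<open>From \<open>1 + r \<le> exp r\<close> and \<open>M r \<le> (M\<^sup>2 + r\<^sup>2) / 2\<close>.\<close>
  have le: "(1 + r) ^ M * exp (- r\<^sup>2 / 2) \<le> exp ((real M)\<^sup>2 / 2)" if "r \<ge> 0" for r :: real and M
  proof -
    have "(1 + r) ^ M \<le> exp r ^ M" using that by (intro power_mono) auto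
    also have "\<dots> = exp (real M * r)" by (simp add: exp_of_nat_mult)
    finally have "(1 + r) ^ M * exp (- r\<^sup>2 / 2) \<le> exp (real M * r) * exp (- r\<^sup>2 / 2)"
      by (intro mult_right_mono) auto
    also have "\<dots> = exp (real M * r - r\<^sup>2 / 2)" by (simp add: exp_add[symmetric])
    also have "\<dots> \<le> exp ((real M)\<^sup>2 / 2)"
      using sum_squares_bound[of "real M" r] by simp
    finally show ?thesis .
  qed
  have "(\<lambda>x. 1 * exp (?Q x)) \<in> smooth_class rapid"
  proof (rule smooth_class_exp[OF Q _ slow_class_const])
    fix a :: "'a \<Rightarrow> complex" assume "a \<in> smooth_class slow"
    then have a: "slow a" by (rule smooth_class_bound)
    have "rapid (\<lambda>x::'a. complex_of_real (gauss x))"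
      unfolding rapid_def gauss_def using le[OF norm_ge_zero] by (auto simp: norm_of_real)
    from rapid_mult_slow[OF this a] show "rapid (\<lambda>x. a x * exp (?Q x))"
      unfolding eq by (simp add: mult.commute)
  qed
  then show ?thesis unfolding eq schwartz_eq by simp
qed

text \<open>The sets over which \<open>f\<close> has integral zero form a Dynkin system, and boxes are a generator of the
  Borel sets that is stable under intersections.\<close>

lemma box_integrals_determine:
  fixes f :: "'a::euclidean_space \<Rightarrow> real"
  assumes f: "integrable lborel f" and box: "\<And>a b. (\<integral>x. indicator (box a b) x * f x \<partial>lborel) = 0"
  shows "AE x in lborel. f x = 0"
proof -
  have [measurable]: "f \<in> borel_measurable borel" using borel_measurable_integrable[OF f] by simp
  have i: "integrable lborel (\<lambda>x. indicator A x * f x)" if "A \<in> sets borel" for A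
    by (rule Bochner_Integration.integrable_bound[OF f]) (use that in \<open>auto simp: indicator_def\<close>)
  have whole: "(\<integral>x. f x \<partial>lborel) = 0"
  proof -
    let ?B = "\<lambda>i::nat. box (- (real i *\<^sub>R One)) (real i *\<^sub>R (One::'a))"
    have "(\<lambda>i. \<integral>x. indicator (?B i) x * f x \<partial>lborel) \<longlonglongrightarrow> (\<integral>x. f x \<partial>lborel)"
    proof (rule integral_dominated_convergence[OF _ _ integrable_norm[OF f]])
      show "AE x in lborel. (\<lambda>i. indicator (?B i) x * f x) \<longlonglongrightarrow> f x"
      proof (rule AE_I2)
        fix x :: 'a
        obtain i0 where i0: "x \<in> ?B i0" using UN_box_eq_UNIV by blast
        have "x \<in> ?B i" if "i \<ge> i0" for i
        proof -
          have "?B i0 \<subseteq> ?B i" using that by (intro subset_box_imp) (auto simp: inner_minus_left)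
          then show ?thesis using i0 by blast
        qed
        then have "\<forall>i\<ge>i0. indicator (?B i) x * f x = f x" by (simp add: indicator_def)
        then show "(\<lambda>i. indicator (?B i) x * f x) \<longlonglongrightarrow> f x"
          by (intro tendsto_eventually) (auto simp: eventually_sequentially)
      qed
    qed (auto simp: indicator_def)
    then show ?thesis unfolding box by (simp add: LIMSEQ_const_iff)
  qed
  let ?G = "range (\<lambda>(a, b). box a b :: 'a set)"
  have "(\<integral>x. indicator A x * f x \<partial>lborel) = 0" if "A \<in> sets borel" for A
  proof -
    have A: "A \<in> sigma_sets UNIV ?G" using that by (subst (asm) borel_eq_box) simp
    have G: "Int_stable ?G"
      by (auto simp: Int_stable_def box_Int_box)
    have "?G \<subseteq> Pow UNIV" by simp
    from G this A show ?thesis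
    proof (induction rule: sigma_sets_induct_disjoint)
      case (compl A)
      have A: "A \<in> sets borel" using compl(1) by (subst borel_eq_box) simp
      have "(\<integral>x. indicator (UNIV - A) x * f x \<partial>lborel) = (\<integral>x. f x - indicator A x * f x \<partial>lborel)"
        by (intro Bochner_Integration.integral_cong) (auto simp: indicator_def)
      then show ?case using compl(2) whole f i[OF A] by simp
    next
      case (union A)
      have A [measurable]: "A i \<in> sets borel" for i
        using union(2) by (subst borel_eq_box) auto
      have "(\<lambda>n. \<integral>x. (\<Sum>i<n. indicator (A i) x * f x) \<partial>lborel) \<longlonglongrightarrow> (\<integral>x. indicator (\<Union>i. A i) x * f x \<partial>lborel)"
      proof (rule integral_dominated_convergence[OF _ _ integrable_norm[OF f]])
        have s: "(\<Sum>i<n. indicator (A i) x) = (indicator (\<Union>i<n. A i) x :: real)" for n x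
          using union(1) by (intro indicator_UN_disjoint[symmetric]) (auto simp: disjoint_family_on_def)
        show "AE x in lborel. (\<lambda>n. \<Sum>i<n. indicator (A i) x * f x) \<longlonglongrightarrow> indicator (\<Union>i. A i) x * f x"
          unfolding sum_distrib_right[symmetric] s
          by (intro AE_I2 tendsto_mult tendsto_const LIMSEQ_indicator_UN)
        show "AE x in lborel. norm (\<Sum>i<n. indicator (A i) x * f x) \<le> norm (f x)" for n
          unfolding sum_distrib_right[symmetric] s by (auto simp: indicator_def)
      qed measurable
      moreover have "(\<integral>x. (\<Sum>i<n. indicator (A i) x * f x) \<partial>lborel) = 0" for n
        using union(3) by (subst Bochner_Integration.integral_sum) (auto intro: i A)
      ultimately show ?case by (simp add: LIMSEQ_const_iff)
    qed (auto simp: box)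
  qed
  then have "AE x in lborel. f x = (\<lambda>x. 0) x"
    by (intro density_unique_real f) (auto simp: set_lebesgue_integral_def)
  then show ?thesis by simp
qed

text \<open>After multiplication by a Gaussian, \<open>d\<close> is integrable and its Fourier transform vanishes. Hence it
  integrates to zero against every Gaussian average of the indicator of a box, and these averages
  converge to the indicator off the boundary of the box.\<close>

theorem schwartz_annihilator:
  fixes d :: "'a::euclidean_space \<Rightarrow> complex"
  assumes [measurable]: "d \<in> borel_measurable borel"
    and d: "\<And>f. f \<in> schwartz \<Longrightarrow> integrable lborel (\<lambda>x. d x * f x)" "\<And>f. f \<in> schwartz \<Longrightarrow> (\<integral>x. d x * f x \<partial>lborel) = 0"
  shows "AE x in lborel. d x = 0"
proof -
  define d1 where "d1 x = d x * complex_of_real (gauss x)" for x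
  have [measurable]: "d1 \<in> borel_measurable borel" unfolding d1_def by measurable
  have d1: "integrable lborel d1" unfolding d1_def by (rule d(1)[OF gauss_schwartz])
  have ft: "(\<integral>t. d1 t * cis (2 * pi * (t \<bullet> w)) \<partial>lborel) = 0" for w
    using d(2)[OF schwartz_modulate[OF gauss_schwartz, of "2 * pi" w]] by (simp add: d1_def mult.assoc)
  have box: "(\<integral>t. d1 t * indicator (box a b) t \<partial>lborel) = 0" for a b
  proof -
    let ?k = "indicator (box a b) :: 'a \<Rightarrow> complex"
    have k: "integrable lborel ?k"
    proof -
      have "integrable lborel (indicator (box a b) :: 'a \<Rightarrow> real)"
        using emeasure_lborel_box_finite[of a b] by (intro integrable_real_indicator) simp_all
      then have "integrable lborel (\<lambda>x. complex_of_real (indicator (box a b) x))" by (rule integrable_of_real)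
      moreover have "(\<lambda>x. complex_of_real (indicator (box a b) x)) = ?k" by (auto simp: indicator_def)
      ultimately show ?thesis by simp
    qed
    define avg where "avg n t = (\<integral>x. complex_of_real (gauss_density x) * ?k (t - (1 / real (Suc n)) *\<^sub>R x) \<partial>lborel)" for n t
    have avg1: "norm (avg n t) \<le> 1" for n t
    proof -
      have "norm (avg n t) \<le> (\<integral>x. norm (complex_of_real (gauss_density x) * ?k (t - (1 / real (Suc n)) *\<^sub>R x)) \<partial>lborel)"
        unfolding avg_def by (rule integral_norm_bound)
      also have "\<dots> \<le> (\<integral>x. gauss_density (x::'a) \<partial>lborel)"
        by (rule integral_mono'[OF gauss_density_integral(1)])
          (auto simp: norm_mult indicator_def intro!: less_imp_le[OF gauss_density_pos])
      finally show ?thesis by (simp add: gauss_density_integral(2))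
    qed
    have [measurable]: "avg n \<in> borel_measurable borel" for n unfolding avg_def by measurable
    \<comment> \<open>On the Fourier side the average is a superposition of characters, each of which \<open>d1\<close> annihilates.\<close>
    have zero: "(\<integral>t. d1 t * avg n t \<partial>lborel) = 0" for n
    proof -
      let ?g = "\<lambda>w. complex_of_real (gauss ((2 * pi * (1 / real (Suc n))) *\<^sub>R w)) * fourier ?k w"
      have gi: "integrable lborel ?g"
      proof (rule Bochner_Integration.integrable_bound)
        show "integrable lborel (\<lambda>w::'a. complex_of_real (gauss ((2 * pi * (1 / real (Suc n))) *\<^sub>R w)) * complex_of_real (\<integral>x. norm (?k x) \<partial>lborel))"
          using gauss_scaled_fourier(1)[of "1 / real (Suc n)" "0::'a"] by (intro integrable_mult_left) simp
        show "AE w in lborel. norm (?g w) \<le> norm (complex_of_real (gauss ((2 * pi * (1 / real (Suc n))) *\<^sub>R w)) * complex_of_real (\<integral>x. norm (?k x) \<partial>lborel))"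
          unfolding norm_mult norm_of_real
          by (intro AE_I2 mult_left_mono order_trans[OF fourier_bound abs_ge_self] abs_ge_zero)
        have [measurable]: "fourier ?k \<in> borel_measurable borel" by (rule fourier_measurable) measurable
        show "?g \<in> borel_measurable lborel" by measurable
      qed
      have [measurable]: "fourier ?k \<in> borel_measurable borel" by (rule fourier_measurable) measurable
      let ?H = "\<lambda>t w. d1 t * (?g w * cis (2 * pi * (t \<bullet> w)))"
      have i: "integrable (lborel \<Otimes>\<^sub>M lborel) (case_prod ?H)"
        by (rule integrable_pair_bound[OF d1 gi]) (measurable, auto simp: norm_mult)
      have "(\<integral>t. d1 t * avg n t \<partial>lborel) = (\<integral>t. \<integral>w. ?H t w \<partial>lborel \<partial>lborel)"
        unfolding avg_def by (subst gauss_smoothing[OF k, symmetric]) (simp_all add: mult.assoc)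
      also have "\<dots> = (\<integral>w. \<integral>t. ?H t w \<partial>lborel \<partial>lborel)"
        using lborel_pair.Fubini_integral[OF i] by simp
      also have "\<dots> = (\<integral>w. ?g w * (\<integral>t. d1 t * cis (2 * pi * (t \<bullet> w)) \<partial>lborel) \<partial>lborel)"
        unfolding integral_mult_right_zero[symmetric] by (simp add: mult_ac)
      finally show ?thesis by (simp add: ft)
    qed
    have "(\<lambda>n. \<integral>t. d1 t * avg n t \<partial>lborel) \<longlonglongrightarrow> (\<integral>t. d1 t * ?k t \<partial>lborel)"
    proof (rule integral_dominated_convergence[OF _ _ integrable_norm[OF d1]])
      have "AE t in lebesgue. t \<notin> cbox a b - box a b"
        using negligible_frontier_interval[of a b] by (intro AE_not_in) (simp add: negligible_iff_null_sets)
      then have "AE t in lborel. t \<notin> cbox a b - box a b" by (simp only: AE_completion_iff)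
      then show "AE t in lborel. (\<lambda>n. d1 t * avg n t) \<longlonglongrightarrow> d1 t * ?k t"
      proof eventually_elim
        fix t assume t: "t \<notin> cbox a b - box a b"
        have "isCont (indicator (box a b) :: 'a \<Rightarrow> real) t"
          unfolding isCont_indicator using t by (auto simp: frontier_box)
        then have "isCont (\<lambda>x. complex_of_real (indicator (box a b) x)) t" by (rule continuous_of_real)
        moreover have "(\<lambda>x. complex_of_real (indicator (box a b) x)) = ?k" by (auto simp: indicator_def)
        ultimately have cont: "isCont ?k t" by (simp only:)
        have "(\<lambda>n. avg n t) \<longlonglongrightarrow> ?k t"
          unfolding avg_def by (rule gauss_average_tendsto[OF _ _ cont, of 1]) (measurable, simp add: indicator_def)
        then show "(\<lambda>n. d1 t * avg n t) \<longlonglongrightarrow> d1 t * ?k t" by (intro tendsto_mult tendsto_const)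
      qed
      show "AE t in lborel. norm (d1 t * avg n t) \<le> norm (d1 t)" for n
        using avg1 by (auto simp: norm_mult intro!: mult_right_le_one_le)
    qed measurable
    then show ?thesis unfolding zero by (simp add: LIMSEQ_const_iff)
  qed
  have i: "integrable lborel (\<lambda>t. d1 t * indicator (box a b) t)" for a b
    by (rule Bochner_Integration.integrable_bound[OF d1]) (auto simp: indicator_def)
  have Re: "(\<integral>t. indicator (box a b) t * Re (d1 t) \<partial>lborel) = 0" for a b
  proof -
    have "(\<integral>t. Re (d1 t * indicator (box a b) t) \<partial>lborel) = Re (\<integral>t. d1 t * indicator (box a b) t \<partial>lborel)"
      by (rule integral_Re[OF i])
    moreover have "Re (d1 t * indicator (box a b) t) = indicator (box a b) t * Re (d1 t)" for t by (simp add: indicator_def)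
    ultimately show ?thesis by (simp add: box)
  qed
  have Im: "(\<integral>t. indicator (box a b) t * Im (d1 t) \<partial>lborel) = 0" for a b
  proof -
    have "(\<integral>t. Im (d1 t * indicator (box a b) t) \<partial>lborel) = Im (\<integral>t. d1 t * indicator (box a b) t \<partial>lborel)"
      by (rule integral_Im[OF i])
    moreover have "Im (d1 t * indicator (box a b) t) = indicator (box a b) t * Im (d1 t)" for t by (simp add: indicator_def)
    ultimately show ?thesis by (simp add: box)
  qed
  have "AE t in lborel. Re (d1 t) = 0" by (rule box_integrals_determine[OF integrable_Re[OF d1] Re])
  moreover have "AE t in lborel. Im (d1 t) = 0" by (rule box_integrals_determine[OF integrable_Im[OF d1] Im])
  ultimately show ?thesis
  proof eventually_elim
    fix t assume "Re (d1 t) = 0" "Im (d1 t) = 0"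
    then have "d1 t = 0" by (simp add: complex_eq_iff)
    then show "d t = 0" using gauss_pos[of t] by (simp add: d1_def)
  qed
qed

lemma represents_unique:
  assumes "represents h u" "represents k u"
  shows "AE x in lborel. h x = k x"
proof -
  have m [measurable]: "h \<in> borel_measurable borel" "k \<in> borel_measurable borel"
    and h: "\<And>f. f \<in> schwartz \<Longrightarrow> integrable lborel (\<lambda>x. h x * f x) \<and> u f = (\<integral>x. h x * f x \<partial>lborel)"
    and k: "\<And>f. f \<in> schwartz \<Longrightarrow> integrable lborel (\<lambda>x. k x * f x) \<and> u f = (\<integral>x. k x * f x \<partial>lborel)"
    using assms by (auto simp: represents_def)
  have "AE x in lborel. h x - k x = 0"
  proof (rule schwartz_annihilator)
    fix f :: "'a \<Rightarrow> complex" assume f: "f \<in> schwartz"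
    show "integrable lborel (\<lambda>x. (h x - k x) * f x)" using h[OF f] k[OF f] by (simp add: left_diff_distrib)
    show "(\<integral>x. (h x - k x) * f x \<partial>lborel) = 0" using h[OF f] k[OF f] by (simp add: left_diff_distrib)
  qed measurable
  then show ?thesis by simp
qed

lemma represents_dist_fun: "represents h u \<Longrightarrow> represents (dist_fun u) u"
  unfolding dist_fun_def by (rule someI[where P = "\<lambda>h. represents h u"])

lemma represents_lincomb:
  assumes "represents h u" "represents k v"
  shows "represents (\<lambda>x. a * h x + b * k x) (lincomb a u b v)"
  using assms by (auto simp: represents_def lincomb_def distrib_right mult.assoc)

lemma dist_fun_lincomb:
  assumes "represents h u" "represents k v"
  shows "AE x in lborel. dist_fun (lincomb a u b v) x = a * dist_fun u x + b * dist_fun v x"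
  by (rule represents_unique[OF represents_dist_fun[OF represents_lincomb[OF assms]]
        represents_lincomb[OF represents_dist_fun[OF assms(1)] represents_dist_fun[OF assms(2)]]])

section \<open>Minimizers and Hermitian forms\<close>

text \<open>By homogeneity, \<open>R = Q - (F f0 + 1) P\<close> is nonnegative on the diagonal, and it vanishes at \<open>f0\<close>;
  so \<open>f0\<close> lies in the kernel of \<open>R\<close>. As \<open>P u v = Q (A u) v\<close>, this says that \<open>f0 - (F f0 + 1) A f0\<close> is
  \<open>Q\<close>-orthogonal to everything, in particular to itself. For an eigenvector \<open>u\<close> with eigenvalue \<open>\<mu>\<close>
  the same relation gives \<open>\<mu> P u u = Q u u\<close>, a quotient of real numbers that \<open>f0\<close> minimizes.\<close>

lemma minimizer_is_ground_state:
  fixes M :: "('a::euclidean_space) functional set" and P Q :: "'a functional \<Rightarrow> 'a functional \<Rightarrow> complex"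
    and F :: "'a functional \<Rightarrow> real" and A :: "'a functional \<Rightarrow> 'a functional"
  assumes M: "\<And>u v a b. u \<in> M \<Longrightarrow> v \<in> M \<Longrightarrow> lincomb a u b v \<in> M"
    and Pl: "\<And>u v w a b. u \<in> M \<Longrightarrow> v \<in> M \<Longrightarrow> w \<in> M \<Longrightarrow> P (lincomb a u b v) w = a * P u w + b * P v w"
    and Ph: "\<And>u v. u \<in> M \<Longrightarrow> v \<in> M \<Longrightarrow> P v u = cnj (P u v)"
    and Ql: "\<And>u v w a b. u \<in> M \<Longrightarrow> v \<in> M \<Longrightarrow> w \<in> M \<Longrightarrow> Q (lincomb a u b v) w = a * Q u w + b * Q v w"
    and Qh: "\<And>u v. u \<in> M \<Longrightarrow> v \<in> M \<Longrightarrow> Q v u = cnj (Q u v)"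
    and QF: "\<And>u. u \<in> M \<Longrightarrow> Q u u = P u u + complex_of_real (F u)"
    and F0: "\<And>u. u \<in> M \<Longrightarrow> F u \<ge> 0"
    and P0: "\<And>u. u \<in> M \<Longrightarrow> Re (P u u) \<ge> 0"
    and Pd: "\<And>u. u \<in> M \<Longrightarrow> P u u = 0 \<Longrightarrow> u = (\<lambda>_. 0)"
    and AM: "\<And>u. u \<in> M \<Longrightarrow> A u \<in> M"
    and Al: "\<And>u v a b. u \<in> M \<Longrightarrow> v \<in> M \<Longrightarrow> A (lincomb a u b v) = lincomb a (A u) b (A v)"
    and PA: "\<And>u v. u \<in> M \<Longrightarrow> v \<in> M \<Longrightarrow> P u v = Q (A u) v"
    and f0: "f0 \<in> M" "P f0 f0 = 1"
    and min: "\<And>f. f \<in> M \<Longrightarrow> P f f = 1 \<Longrightarrow> F f0 \<le> F f"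
  shows "eigenvector (A ` M) (inv_into M A) (complex_of_real (F f0 + 1)) f0 \<and>
    (\<forall>\<mu>. eigenvalue (A ` M) (inv_into M A) \<mu> \<longrightarrow> \<mu> \<in> \<real> \<and> F f0 + 1 \<le> Re \<mu>)"
proof -
  define l where "l = F f0"
  have l0: "l \<ge> 0" unfolding l_def by (rule F0[OF f0(1)])
  have Pr: "P w (lincomb a u b v) = cnj a * P w u + cnj b * P w v" if "u \<in> M" "v \<in> M" "w \<in> M" for a b u v w
    using Ph[OF M[OF that(1,2)] that(3)] Pl[OF that] Ph[OF that(1,3)] Ph[OF that(2,3)] by simp
  have Qr: "Q w (lincomb a u b v) = cnj a * Q w u + cnj b * Q w v" if "u \<in> M" "v \<in> M" "w \<in> M" for a b u v w
    using Qh[OF M[OF that(1,2)] that(3)] Ql[OF that] Qh[OF that(1,3)] Qh[OF that(2,3)] by simp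
  have Preal: "P u u = complex_of_real (Re (P u u))" if "u \<in> M" for u
    using Ph[OF that that] by (simp add: complex_eq_iff)
  have bound: "l * Re (P u u) \<le> F u" if u: "u \<in> M" for u
  proof (cases "Re (P u u) = 0")
    case True
    then show ?thesis using F0[OF u] by simp
  next
    case False
    define c where "c = Re (P u u)"
    have c: "c > 0" using False P0[OF u] by (simp add: c_def)
    define r where "r = complex_of_real (1 / sqrt c)"
    have r: "r * cnj r = complex_of_real (1 / c)"
      using c by (simp add: r_def flip: of_real_mult)
    define w where "w = lincomb r u 0 u"
    have w: "w \<in> M" unfolding w_def by (rule M[OF u u])
    have Pw: "P w w = complex_of_real (1 / c) * P u u"
      unfolding r[symmetric] w_def using u M[OF u u] by (simp add: Pl Pr mult_ac)
    have Qw: "Q w w = complex_of_real (1 / c) * Q u u"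
      unfolding r[symmetric] w_def using u M[OF u u] by (simp add: Ql Qr mult_ac)
    have P1: "P w w = 1"
    proof -
      have Pu: "P u u = complex_of_real c" unfolding c_def by (rule Preal[OF u])
      show ?thesis unfolding Pw Pu using c by simp
    qed
    have "complex_of_real (F w) = complex_of_real (1 / c) * complex_of_real (F u)"
      using QF[OF w] QF[OF u] unfolding Qw Pw by (simp add: distrib_left)
    then have "complex_of_real (F w) = complex_of_real (1 / c * F u)" by (simp only: of_real_mult)
    then have "F w = 1 / c * F u" by (simp only: of_real_eq_iff)
    with min[OF w P1] c show ?thesis by (simp add: l_def c_def field_simps)
  qed
  define R where "R u v = Q u v - complex_of_real (l + 1) * P u v" for u v
  have Rl: "R (lincomb a u b v) w = a * R u w + b * R v w" if "u \<in> M" "v \<in> M" "w \<in> M" for a b u v w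
    using that by (simp add: R_def Pl Ql algebra_simps)
  have Rr: "R w (lincomb a u b v) = cnj a * R w u + cnj b * R w v" if "u \<in> M" "v \<in> M" "w \<in> M" for a b u v w
    using that by (simp add: R_def Pr Qr algebra_simps)
  have Rh: "R v u = cnj (R u v)" if "u \<in> M" "v \<in> M" for u v
    using Ph[OF that] Qh[OF that] by (simp add: R_def)
  have Rpos: "Re (R u u) \<ge> 0" if u: "u \<in> M" for u
    using bound[OF u] unfolding R_def QF[OF u] by (simp add: algebra_simps)
  have R00: "R f0 f0 = 0"
    unfolding R_def QF[OF f0(1)] f0(2) l_def by simp
  have R0: "R f0 v = 0" if v: "v \<in> M" for v
  proof (rule ccontr)
    define z where "z = R f0 v"
    assume "R f0 v \<noteq> 0"
    then have z: "(norm z)\<^sup>2 > 0" by (simp add: z_def)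
    define c where "c = Re (R v v)"
    have c: "c \<ge> 0" unfolding c_def by (rule Rpos[OF v])
    \<comment> \<open>At \<open>f0 + t z v\<close> the form equals \<open>(2 t + t\<^sup>2 c) \<bar>z\<bar>\<^sup>2\<close>, negative for small negative \<open>t\<close>; this choice also works for \<open>c = 0\<close>.\<close>
    define t where "t = - 1 / (c + 1)"
    define w where "w = lincomb 1 f0 (complex_of_real t * z) v"
    have w: "w \<in> M" unfolding w_def by (rule M[OF f0(1) v])
    have "R w w = cnj (complex_of_real t * z) * z + complex_of_real t * z * (cnj z + cnj (complex_of_real t * z) * R v v)"
      unfolding w_def using f0(1) v M[OF f0(1) v] by (simp add: Rl Rr R00 Rh[OF f0(1) v] z_def[symmetric] algebra_simps)
    also have "\<dots> = complex_of_real (2 * t * (norm z)\<^sup>2) + complex_of_real (t\<^sup>2 * (norm z)\<^sup>2) * R v v"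
      by (simp add: complex_norm_square[unfolded of_real_power] power2_eq_square[of t] algebra_simps)
    finally have "Re (R w w) = (2 * t + t\<^sup>2 * c) * (norm z)\<^sup>2"
      by (simp add: c_def algebra_simps del: of_real_mult of_real_power)
    with Rpos[OF w] z have "2 * t + t\<^sup>2 * c \<ge> 0" by (simp add: zero_le_mult_iff)
    moreover have "t < 0" using c by (simp add: t_def)
    moreover have "t * c > - 1" using c by (simp add: t_def field_simps)
    then have "2 + t * c > 0" by simp
    moreover have "2 * t + t\<^sup>2 * c = t * (2 + t * c)" by (simp add: power2_eq_square algebra_simps)
    ultimately have "2 * t + t\<^sup>2 * c < 0" using mult_neg_pos by metis
    with \<open>2 * t + t\<^sup>2 * c \<ge> 0\<close> show False by simp
  qed
  have Qzero: "u = (\<lambda>_. 0)" if u: "u \<in> M" and "Q u u = 0" for u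
  proof -
    have "Re (P u u) + F u = 0" using QF[OF u] that(2) by (metis Re_complex_of_real plus_complex.simps(1) zero_complex.simps(1))
    then have "Re (P u u) = 0" using P0[OF u] F0[OF u] by linarith
    then show ?thesis using Preal[OF u] Pd[OF u] by simp
  qed
  let ?L = "complex_of_real (l + 1)"
  have L0: "?L \<noteq> 0" using l0 by (simp only: of_real_eq_0_iff)
  have eig: "f0 = (\<lambda>f. ?L * A f0 f)"
  proof -
    let ?w = "lincomb 1 f0 (- ?L) (A f0)"
    have w: "?w \<in> M" by (rule M[OF f0(1) AM[OF f0(1)]])
    have "Q ?w ?w = 1 * Q f0 ?w + (- ?L) * Q (A f0) ?w"
      by (rule Ql[OF f0(1) AM[OF f0(1)] w])
    also have "\<dots> = R f0 ?w" unfolding R_def PA[OF f0(1) w] by (simp only: mult_1_left mult_minus_left diff_conv_add_uminus)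
    also have "\<dots> = 0" by (rule R0[OF w])
    finally have z: "?w = (\<lambda>_. 0)" by (rule Qzero[OF w])
    show ?thesis
    proof
      fix f
      have "1 * f0 f + (- ?L) * A f0 f = 0" using fun_cong[OF z, of f] by (simp only: lincomb_def)
      then show "f0 f = ?L * A f0 f"
        unfolding mult_1_left mult_minus_left diff_conv_add_uminus[symmetric] right_minus_eq .
    qed
  qed
  have inj: "inj_on A M"
  proof (rule inj_onI)
    fix u v assume u: "u \<in> M" and v: "v \<in> M" and eq: "A u = A v"
    let ?w = "lincomb 1 u (- 1) v"
    have w: "?w \<in> M" by (rule M[OF u v])
    have "P ?w ?w = 1 * P u ?w + (- 1) * P v ?w" by (rule Pl[OF u v w])
    also have "\<dots> = 0" using PA[OF u w] PA[OF v w] eq by simp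
    finally have "?w = (\<lambda>_. 0)" by (rule Pd[OF w])
    then show "u = v" by (auto simp: lincomb_def fun_eq_iff)
  qed
  define x where "x = lincomb ?L f0 0 f0"
  have x: "x \<in> M" unfolding x_def by (rule M[OF f0(1) f0(1)])
  have "A x = lincomb ?L (A f0) 0 (A f0)" unfolding x_def by (rule Al[OF f0(1) f0(1)])
  also have "\<dots> = (\<lambda>f. ?L * A f0 f)" unfolding lincomb_def by (simp only: mult_zero_left add_0_right)
  finally have Ax: "A x = f0" by (rule trans[OF _ eig[symmetric]])
  then have "f0 \<in> A ` M" using x by blast
  moreover have "inv_into M A f0 = x" using inv_into_f_f[OF inj x] by (simp only: Ax)
  moreover have "f0 \<noteq> (\<lambda>_. 0)"
  proof
    assume z: "f0 = (\<lambda>_. 0)"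
    have "lincomb 0 f0 0 f0 = f0" by (simp add: lincomb_def z)
    then have "P f0 f0 = 0" using Pl[OF f0(1) f0(1) f0(1), of 0 0] by simp
    with f0(2) show False by simp
  qed
  ultimately have first: "eigenvector (A ` M) (inv_into M A) ?L f0"
    unfolding eigenvector_def x_def lincomb_def by (simp only: mult_zero_left add_0_right simp_thms)
  have second: "\<mu> \<in> \<real> \<and> l + 1 \<le> Re \<mu>" if "eigenvalue (A ` M) (inv_into M A) \<mu>" for \<mu>
  proof -
    obtain u where "eigenvector (A ` M) (inv_into M A) \<mu> u"
      using \<open>eigenvalue (A ` M) (inv_into M A) \<mu>\<close> unfolding eigenvalue_def by (rule exE)
    then have u: "u \<in> A ` M" "u \<noteq> (\<lambda>_. 0)" "inv_into M A u = (\<lambda>f. \<mu> * u f)"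
      unfolding eigenvector_def by (simp_all only: simp_thms)
    obtain y where y: "u = A y" "y \<in> M" by (rule imageE[OF u(1)])
    have uM: "u \<in> M" unfolding y(1) by (rule AM[OF y(2)])
    define w where "w = inv_into M A u"
    have w: "w \<in> M" "A w = u" unfolding w_def by (rule inv_into_into[OF u(1)], rule f_inv_into_f[OF u(1)])
    have wu: "w = lincomb \<mu> u 0 u" unfolding w_def u(3) by (simp add: lincomb_def)
    have "\<mu> * P u u = P w u" unfolding wu Pl[OF uM uM uM] by simp
    also have "\<dots> = P u u + complex_of_real (F u)" unfolding PA[OF w(1) uM] w(2) by (rule QF[OF uM])
    finally have eq: "\<mu> * P u u = P u u + complex_of_real (F u)" .
    define c where "c = Re (P u u)"
    have Pu: "P u u = complex_of_real c" unfolding c_def by (rule Preal[OF uM])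
    have "c \<noteq> 0" using Pd[OF uM] u(2) Pu by auto
    then have c: "c > 0" using P0[OF uM] by (simp add: c_def)
    have "\<mu> = complex_of_real (1 + F u / c)"
      using eq c unfolding Pu by (simp add: field_simps)
    moreover have "l \<le> F u / c" using bound[OF uM] c by (simp add: c_def[symmetric] field_simps)
    ultimately show ?thesis by auto
  qed
  show ?thesis using first second unfolding l_def by blast
qed

section \<open>Marginal weights\<close>

lemma poly_moderate_natE:
  fixes m :: "'b::euclidean_space \<Rightarrow> real"
  assumes "m \<in> poly_moderate_weights"
  obtains C and n :: nat where "C > 0" "\<And>x y. m (x + y) \<le> C * m x * (1 + norm y) ^ n"
proof -
  obtain s where s: "moderate (poly_weight s) m" and w: "weight m"
    using assms by (auto simp: poly_moderate_weights_def)
  obtain C where C: "C > 0" "\<And>x y. m (x + y) \<le> C * m x * poly_weight s y"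
    using s by (auto simp: moderate_def)
  obtain n :: nat where n: "s \<le> real n" using real_arch_simple by blast
  have "m (x + y) \<le> C * m x * (1 + norm y) ^ n" for x y
  proof -
    have "poly_weight s y \<le> (1 + norm y) powr real n"
      unfolding poly_weight_def by (intro powr_mono n) simp
    also have "\<dots> = (1 + norm y) ^ n" by (intro powr_realpow) (simp add: add_pos_nonneg)
    finally have "C * m x * poly_weight s y \<le> C * m x * (1 + norm y) ^ n"
      using C(1) w by (intro mult_left_mono) (auto simp: weight_def less_imp_le)
    with C(2)[of x y] show ?thesis by linarith
  qed
  with C(1) show thesis by (rule that)
qed

text \<open>The infimum over the second variable inherits the moderateness inequality, since that inequality
  holds with the same constant for all \<open>w\<close>. By moderateness it is positive everywhere as soon as it is
  positive at one point. It is upper semicontinuous, hence measurable.\<close>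

lemma marginal_weight:
  fixes m :: "'a::euclidean_space \<times> 'a \<Rightarrow> real"
  assumes mc: "continuous_on UNIV m" and mp: "\<And>z. m z > 0" and C: "C > 0"
    and mod: "\<And>x y w. m (x + y, w) \<le> C * m (x, w) * (1 + norm y) ^ n"
    and c0: "c0 > 0" "\<And>w. c0 \<le> m (x0, w)"
  shows "\<exists>p. p \<in> borel_measurable borel \<and> (\<forall>x. p x > 0) \<and> (\<forall>x w. p x \<le> m (x, w)) \<and>
    (\<forall>x t. p t \<le> C * p x * (1 + norm (t - x)) ^ n) \<and> (\<forall>x c. (\<forall>w. c \<le> m (x, w)) \<longrightarrow> c \<le> p x)"
proof -
  define p where "p x = (INF w. m (x, w))" for x
  have bdd: "bdd_below (range (\<lambda>w. m (x, w)))" for x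
    using mp by (intro bdd_belowI[of _ 0]) (auto simp: less_imp_le)
  have le: "p x \<le> m (x, w)" for x w unfolding p_def by (intro cINF_lower bdd) simp
  have ge: "c \<le> p x" if "\<And>w. c \<le> m (x, w)" for x c
    unfolding p_def by (intro cINF_greatest that) simp
  have pow: "(1 + norm y) ^ n > 0" for y :: 'a by (simp add: add_pos_nonneg)
  have pos: "p x > 0" for x
  proof -
    have "c0 / (C * (1 + norm (x0 - x)) ^ n) \<le> p x"
    proof (rule ge)
      fix w
      have "c0 \<le> C * m (x, w) * (1 + norm (x0 - x)) ^ n" using c0(2)[of w] mod[of x "x0 - x" w] by simp
      then show "c0 / (C * (1 + norm (x0 - x)) ^ n) \<le> m (x, w)"
        using C pow[of "x0 - x"] by (subst pos_divide_le_eq) (auto simp: mult_ac)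
    qed
    moreover have "c0 / (C * (1 + norm (x0 - x)) ^ n) > 0" using c0 C pow by simp
    ultimately show ?thesis by linarith
  qed
  have pmod: "p t \<le> C * p x * (1 + norm (t - x)) ^ n" for x t
  proof -
    have "p t / (C * (1 + norm (t - x)) ^ n) \<le> p x"
    proof (rule ge)
      fix w
      have "p t \<le> C * m (x, w) * (1 + norm (t - x)) ^ n" using le[of t w] mod[of x "t - x" w] by simp
      then show "p t / (C * (1 + norm (t - x)) ^ n) \<le> m (x, w)"
        using C pow[of "t - x"] by (subst pos_divide_le_eq) (auto simp: mult_ac)
    qed
    then show ?thesis using C pow[of "t - x"] by (subst (asm) pos_divide_le_eq) (auto simp: mult_ac)
  qed
  have "p \<in> borel_measurable borel"
  proof (rule borel_measurableI_less)
    fix y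
    have "{x. p x < y} = (\<Union>w. {x. m (x, w) < y})"
      unfolding p_def using cINF_less_iff[OF _ bdd] by auto
    moreover have "open {x. m (x, w) < y}" for w
      by (intro open_Collect_less continuous_on_compose2[OF mc] continuous_intros) auto
    ultimately have "open {x. p x < y}" by auto
    then show "{x \<in> space borel. p x < y} \<in> sets borel" by simp
  qed
  then show ?thesis using pos le pmod ge by blast
qed

text \<open>The marginal weight lies between \<open>\<bar>\<theta>\<bar>\<close> and \<open>m\<close>. Being at most \<open>m\<close>, it keeps the transform square
  integrable; being at least \<open>\<bar>\<theta>\<bar>\<close>, it makes \<open>\<theta>\<close> times the representing function square integrable.\<close>

lemma weighted_representation:
  fixes m :: "'a::euclidean_space \<times> 'a \<Rightarrow> real" and \<kappa> :: "'a functional"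
  assumes mc: "continuous_on UNIV m" and mp: "\<And>z. m z > 0" and C: "C > 0"
    and mod: "\<And>x y w. m (x + y, w) \<le> C * m (x, w) * (1 + norm y) ^ n"
    and \<theta>c: "continuous_on UNIV \<theta>" and \<theta>: "\<And>x w. norm (\<theta> x :: complex) \<le> m (x, w)" and \<theta>0: "\<theta> x0 \<noteq> 0"
    and Um: "U \<in> borel_measurable borel" and U: "slow U" and \<gamma>: "\<gamma> \<in> schwartz"
    and L2: "integrable lborel (\<lambda>z. (m z * norm (U z))\<^sup>2)"
    and N: "N \<noteq> 0" and rep: "\<And>f. f \<in> schwartz \<Longrightarrow> N * \<kappa> f = (\<integral>z. U z * stft_dual \<gamma> f z \<partial>lborel)"
  shows "\<exists>h. represents h \<kappa>" and "integrable lborel (\<lambda>x. (norm (\<theta> x * dist_fun \<kappa> x))\<^sup>2)"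
proof -
  have [measurable]: "U \<in> borel_measurable borel" by (rule Um)
  have \<theta>1: "norm (\<theta> x0) > 0" using \<theta>0 by simp
  obtain p where p: "p \<in> borel_measurable borel" "\<And>x. p x > 0" "\<And>x w. p x \<le> m (x, w)"
    "\<And>x t. p t \<le> C * p x * (1 + norm (t - x)) ^ n" "\<And>x c. \<forall>w. c \<le> m (x, w) \<Longrightarrow> c \<le> p x"
    using marginal_weight[OF mc mp C mod \<theta>1 \<theta>] by blast
  have [measurable]: "p \<in> borel_measurable borel" by (rule p(1))
  have [measurable]: "(fst :: 'a \<times> 'a \<Rightarrow> 'a) \<in> borel_measurable borel"
    by (intro borel_measurable_continuous_onI continuous_intros)
  have pL2: "integrable lborel (\<lambda>z. (p (fst z) * norm (U z))\<^sup>2)"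
  proof (rule Bochner_Integration.integrable_bound[OF L2])
    have "(p (fst z) * norm (U z))\<^sup>2 \<le> (m z * norm (U z))\<^sup>2" for z
      using p(2)[of "fst z"] p(3)[of "fst z" "snd z"] by (intro power_mono mult_right_mono) auto
    then show "AE z in lborel. norm ((p (fst z) * norm (U z))\<^sup>2) \<le> norm ((m z * norm (U z))\<^sup>2)" by simp
  qed measurable
  obtain h where h: "h \<in> borel_measurable borel" "integrable lborel (\<lambda>t. (p t * norm (h t))\<^sup>2)"
    "\<And>f. f \<in> schwartz \<Longrightarrow> integrable lborel (\<lambda>t. h t * f t) \<and> (\<integral>t. h t * f t \<partial>lborel) = (\<integral>z. U z * stft_dual \<gamma> f z \<partial>lborel)"
    using L2_representation[OF Um U p(1,2,4) \<gamma> pL2] by blast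
  \<comment> \<open>The factor \<open>N\<close> is the energy of the window in the reproducing formula.\<close>
  define k where "k t = (1 / N) * h t" for t
  have [measurable]: "h \<in> borel_measurable borel" by (rule h(1))
  have [measurable]: "k \<in> borel_measurable borel" unfolding k_def by measurable
  have k: "represents k \<kappa>"
    unfolding represents_def
  proof (intro conjI ballI)
    show "k \<in> borel_measurable lborel" by measurable
    fix f :: "'a \<Rightarrow> complex" assume f: "f \<in> schwartz"
    have eq: "(\<lambda>x. k x * f x) = (\<lambda>x. (1 / N) * (h x * f x))" by (simp add: k_def)
    show "integrable lborel (\<lambda>x. k x * f x)" unfolding eq using h(3)[OF f] by (intro integrable_mult_right) auto
    have "(\<integral>x. k x * f x \<partial>lborel) = (1 / N) * (N * \<kappa> f)"
      unfolding eq integral_mult_right_zero using h(3)[OF f] rep[OF f] by simp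
    then show "\<kappa> f = (\<integral>x. k x * f x \<partial>lborel)" using N by simp
  qed
  then show "\<exists>h. represents h \<kappa>" by blast
  have d: "represents (dist_fun \<kappa>) \<kappa>" by (rule represents_dist_fun[OF k])
  then have [measurable]: "dist_fun \<kappa> \<in> borel_measurable borel" by (simp add: represents_def)
  have [measurable]: "\<theta> \<in> borel_measurable borel" by (rule borel_measurable_continuous_onI[OF \<theta>c])
  show "integrable lborel (\<lambda>x. (norm (\<theta> x * dist_fun \<kappa> x))\<^sup>2)"
  proof (rule Bochner_Integration.integrable_bound)
    show "integrable lborel (\<lambda>t. (norm (1 / N))\<^sup>2 * (p t * norm (h t))\<^sup>2)" using h(2) by simp
    show "AE x in lborel. norm ((norm (\<theta> x * dist_fun \<kappa> x))\<^sup>2) \<le> norm ((norm (1 / N))\<^sup>2 * (p x * norm (h x))\<^sup>2)"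
      using represents_unique[OF d k]
    proof eventually_elim
      fix x assume x: "dist_fun \<kappa> x = k x"
      have "norm (\<theta> x) \<le> p x" by (rule p(5)) (simp add: \<theta>)
      then have "norm (\<theta> x) * norm (k x) \<le> p x * norm (k x)" by (intro mult_right_mono) auto
      also have "\<dots> = norm (1 / N) * (p x * norm (h x))" unfolding k_def norm_mult by (simp only: mult_ac)
      finally have "(norm (\<theta> x) * norm (k x))\<^sup>2 \<le> (norm (1 / N) * (p x * norm (h x)))\<^sup>2" by (intro power_mono) auto
      then show "norm ((norm (\<theta> x * dist_fun \<kappa> x))\<^sup>2) \<le> norm ((norm (1 / N))\<^sup>2 * (p x * norm (h x))\<^sup>2)"
        unfolding x norm_mult power_mult_distrib by simp
    qed
  qed measurable
qed

section \<open>The Fourier transform as a rotation of phase space\<close>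

text \<open>The Fourier transform acts on phase space by a quarter turn.\<close>

definition phase_rotation :: "'a::euclidean_space \<times> 'a \<Rightarrow> 'a \<times> 'a" where
  "phase_rotation = (\<lambda>(a, b). (- b, a))"

lemma lborel_distr_uminus_euclidean: "distr lborel borel uminus = (lborel :: 'a::euclidean_space measure)"
  by (subst (2) lborel_affine[of "- 1" 0]) (auto simp: density_1)

lemma phase_rotation_continuous: "continuous_on UNIV (phase_rotation :: 'a::euclidean_space \<times> 'a \<Rightarrow> _)"
  unfolding phase_rotation_def split_beta by (intro continuous_intros)

lemma phase_rotation_measurable [measurable]: "phase_rotation \<in> borel_measurable borel"
  by (rule borel_measurable_continuous_onI[OF phase_rotation_continuous])

lemma distr_phase_rotation: "distr lborel borel phase_rotation = (lborel :: ('a::euclidean_space \<times> 'a) measure)"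
proof -
  have "(lborel :: ('a \<times> 'a) measure) = distr lborel borel uminus \<Otimes>\<^sub>M distr lborel borel (\<lambda>x. x)"
    by (simp add: lborel_distr_uminus_euclidean lborel_prod distr_id2)
  also have "\<dots> = distr (lborel \<Otimes>\<^sub>M lborel) (borel \<Otimes>\<^sub>M borel) (\<lambda>(x, y). (- x, y))"
    by (rule pair_measure_distr) (auto simp: distr_id2 lborel.sigma_finite_measure_axioms)
  also have "\<dots> = distr (distr (lborel \<Otimes>\<^sub>M lborel) (lborel \<Otimes>\<^sub>M lborel) (\<lambda>(x, y). (y, x))) (borel \<Otimes>\<^sub>M borel) (\<lambda>(x, y). (- x, y))"
    by (subst lborel_pair.distr_pair_swap) simp
  also have "\<dots> = distr (lborel \<Otimes>\<^sub>M lborel) (borel \<Otimes>\<^sub>M borel) ((\<lambda>(x, y). (- x, y)) \<circ> (\<lambda>(x, y). (y, x)))"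
    by (rule distr_distr) measurable
  also have "((\<lambda>(x, y). (- x, y)) \<circ> (\<lambda>(x, y). (y, x))) = (phase_rotation :: 'a \<times> 'a \<Rightarrow> _)"
    by (auto simp: phase_rotation_def)
  finally show ?thesis by (simp add: lborel_prod borel_prod)
qed

lemma integral_phase_rotation:
  fixes F :: "'a::euclidean_space \<times> 'a \<Rightarrow> 'b::{banach, second_countable_topology}"
  assumes [measurable]: "F \<in> borel_measurable borel"
  shows "(\<integral>z. F (phase_rotation z) \<partial>lborel) = (\<integral>z. F z \<partial>lborel)"
    and "integrable lborel (\<lambda>z. F (phase_rotation z)) \<longleftrightarrow> integrable lborel F"
proof -
  have "(\<integral>z. F z \<partial>lborel) = (\<integral>z. F z \<partial>distr lborel borel phase_rotation)" by (simp only: distr_phase_rotation)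
  also have "\<dots> = (\<integral>z. F (phase_rotation z) \<partial>lborel)" by (rule integral_distr) measurable
  finally show "(\<integral>z. F (phase_rotation z) \<partial>lborel) = (\<integral>z. F z \<partial>lborel)" ..
  have "integrable lborel F \<longleftrightarrow> integrable (distr lborel borel phase_rotation) F" by (simp only: distr_phase_rotation)
  also have "\<dots> \<longleftrightarrow> integrable lborel (\<lambda>z. F (phase_rotation z))" by (rule integrable_distr_eq) measurable
  finally show "integrable lborel (\<lambda>z. F (phase_rotation z)) \<longleftrightarrow> integrable lborel F" ..
qed

text \<open>The test function is transformed instead of the distribution; this is the covariance that allows
  the frequency side to be treated like the position side, with the window \<open>fourier g\<close>.\<close>

lemma stft_dual_fourier_rotation:
  fixes f g :: "'a::euclidean_space \<Rightarrow> complex"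
  assumes f: "f \<in> schwartz" and g: "g \<in> schwartz"
  shows "stft_dual g (fourier f) (- b, a) = cis (- 2 * pi * (b \<bullet> a)) * stft_dual (fourier g) f (a, b)"
proof -
  have [measurable]: "f \<in> borel_measurable borel" "g \<in> borel_measurable borel"
    using f g by measurable
  let ?H = "\<lambda>\<xi> s. f \<xi> * g (s + b) * cis (2 * pi * (s \<bullet> a) - 2 * pi * (s \<bullet> \<xi>))"
  have gb: "integrable lborel (\<lambda>s. g (s + b))"
    using lborel_integral_affine(2)[of 1 g b] schwartz_integrable[OF g] by (simp add: add.commute)
  have i: "integrable (lborel \<Otimes>\<^sub>M lborel) (case_prod ?H)"
    by (rule integrable_pair_bound[OF schwartz_integrable[OF f] gb]) (measurable, simp add: norm_mult)
  have "stft_dual g (fourier f) (- b, a) = (\<integral>s. \<integral>\<xi>. ?H \<xi> s \<partial>lborel \<partial>lborel)"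
  proof -
    have "fourier f s * g (s + b) * cis (2 * pi * (s \<bullet> a)) = (\<integral>\<xi>. ?H \<xi> s \<partial>lborel)" for s
    proof -
      have "?H \<xi> s = (f \<xi> * cis (- 2 * pi * (\<xi> \<bullet> s))) * (g (s + b) * cis (2 * pi * (s \<bullet> a)))" for \<xi>
      proof -
        have "cis (2 * pi * (s \<bullet> a) - 2 * pi * (s \<bullet> \<xi>)) = cis (2 * pi * (s \<bullet> a)) * cis (- 2 * pi * (\<xi> \<bullet> s))"
          by (simp add: cis_mult inner_commute)
        then show ?thesis by (simp only: mult_ac)
      qed
      then have "(\<integral>\<xi>. ?H \<xi> s \<partial>lborel) = (\<integral>\<xi>. (f \<xi> * cis (- 2 * pi * (\<xi> \<bullet> s))) * (g (s + b) * cis (2 * pi * (s \<bullet> a))) \<partial>lborel)"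
        by (simp only:)
      then show ?thesis unfolding integral_mult_left_zero fourier_def by (simp only: mult.assoc)
    qed
    then show ?thesis by (simp add: stft_dual_def)
  qed
  also have "\<dots> = (\<integral>\<xi>. \<integral>s. ?H \<xi> s \<partial>lborel \<partial>lborel)"
    using lborel_pair.Fubini_integral[OF i] by simp
  also have "\<dots> = (\<integral>\<xi>. cis (- 2 * pi * (b \<bullet> a)) * (f \<xi> * fourier g (\<xi> - a) * cis (2 * pi * (\<xi> \<bullet> b))) \<partial>lborel)"
  proof (rule Bochner_Integration.integral_cong[OF refl])
    fix \<xi>
    have "(\<integral>s. ?H \<xi> s \<partial>lborel) = (\<integral>s. ?H \<xi> (- b + s) \<partial>lborel)"
      using lborel_integral_affine(1)[of 1 "\<lambda>s. ?H \<xi> s" "- b"] by simp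
    also have "\<dots> = (\<integral>s. (cis (- 2 * pi * (b \<bullet> a)) * f \<xi> * cis (2 * pi * (\<xi> \<bullet> b))) * (g s * cis (- 2 * pi * (s \<bullet> (\<xi> - a)))) \<partial>lborel)"
    proof (rule Bochner_Integration.integral_cong[OF refl])
      fix s
      have "cis (2 * pi * ((- b + s) \<bullet> a) - 2 * pi * ((- b + s) \<bullet> \<xi>))
        = cis (- 2 * pi * (b \<bullet> a)) * cis (2 * pi * (\<xi> \<bullet> b)) * cis (- 2 * pi * (s \<bullet> (\<xi> - a)))"
        unfolding cis_mult by (simp add: inner_commute algebra_simps)
      then show "?H \<xi> (- b + s) = (cis (- 2 * pi * (b \<bullet> a)) * f \<xi> * cis (2 * pi * (\<xi> \<bullet> b))) * (g s * cis (- 2 * pi * (s \<bullet> (\<xi> - a))))"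
        by simp
    qed
    also have "\<dots> = cis (- 2 * pi * (b \<bullet> a)) * (f \<xi> * fourier g (\<xi> - a) * cis (2 * pi * (\<xi> \<bullet> b)))"
      unfolding integral_mult_right_zero fourier_def by (simp only: mult_ac)
    finally show "(\<integral>s. ?H \<xi> s \<partial>lborel) = cis (- 2 * pi * (b \<bullet> a)) * (f \<xi> * fourier g (\<xi> - a) * cis (2 * pi * (\<xi> \<bullet> b)))" .
  qed
  also have "\<dots> = cis (- 2 * pi * (b \<bullet> a)) * stft_dual (fourier g) f (a, b)"
    by (simp add: stft_dual_def)
  finally show ?thesis .
qed

section \<open>Linear structure of distributions\<close>

lemma schwartz_norm_mono:
  assumes f: "f \<in> schwartz" and NK: "N \<le> K"
  shows "schwartz_norm N f \<le> schwartz_norm K f"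
proof -
  have b: "bdd_above (range (\<lambda>x. (1 + norm x) ^ K * norm (iter_deriv bs f x)))" if "set bs \<subseteq> Basis" for bs K
    using f that unfolding schwartz_def by auto
  have le: "(SUP x. (1 + norm x) ^ N * norm (iter_deriv bs f x)) \<le> (SUP x. (1 + norm x) ^ K * norm (iter_deriv bs f x))" if "set bs \<subseteq> Basis" for bs
  proof (rule cSUP_mono[OF _ b[OF that]])
    show "\<exists>y\<in>UNIV. (1 + norm x) ^ N * norm (iter_deriv bs f x) \<le> (1 + norm y) ^ K * norm (iter_deriv bs f y)" for x
      by (intro bexI[of _ x] mult_right_mono one_plus_norm_power_mono NK) auto
  qed simp
  have pos: "0 \<le> (SUP x. (1 + norm x) ^ K * norm (iter_deriv bs f x))" if "set bs \<subseteq> Basis" for bs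
  proof -
    have "(1 + norm (0::'a)) ^ K * norm (iter_deriv bs f 0) \<le> (SUP x. (1 + norm x) ^ K * norm (iter_deriv bs f x))"
      by (rule cSUP_upper[OF UNIV_I b[OF that]])
    moreover have "0 \<le> (1 + norm (0::'a)) ^ K * norm (iter_deriv bs f 0)" by simp
    ultimately show ?thesis by linarith
  qed
  have "schwartz_norm N f \<le> (\<Sum>bs | set bs \<subseteq> Basis \<and> length bs \<le> N. (SUP x. (1 + norm x) ^ K * norm (iter_deriv bs f x)))"
    unfolding schwartz_norm_def by (intro sum_mono le) auto
  also have "\<dots> \<le> schwartz_norm K f"
    unfolding schwartz_norm_def using NK by (intro sum_mono2 finite_short_lists pos) auto
  finally show ?thesis .
qed

lemma tempered_lincomb:
  assumes u: "u \<in> tempered" and v: "v \<in> tempered"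
  shows "lincomb a u b v \<in> tempered"
proof -
  obtain C1 N1 where 1: "C1 \<ge> 0" "\<And>f. f \<in> schwartz \<Longrightarrow> norm (u f) \<le> C1 * schwartz_norm N1 f" using temperedE[OF u] by metis
  obtain C2 N2 where 2: "C2 \<ge> 0" "\<And>f. f \<in> schwartz \<Longrightarrow> norm (v f) \<le> C2 * schwartz_norm N2 f" using temperedE[OF v] by metis
  have "norm (lincomb a u b v f) \<le> (norm a * C1 + norm b * C2) * schwartz_norm (max N1 N2) f" if f: "f \<in> schwartz" for f
  proof -
    let ?s = "schwartz_norm (max N1 N2) f"
    have "norm (u f) \<le> C1 * ?s" using order_trans[OF 1(2)[OF f] mult_left_mono[OF schwartz_norm_mono[OF f] 1(1)]] by simp
    moreover have "norm (v f) \<le> C2 * ?s" using order_trans[OF 2(2)[OF f] mult_left_mono[OF schwartz_norm_mono[OF f] 2(1)]] by simp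
    ultimately have "norm a * norm (u f) + norm b * norm (v f) \<le> norm a * (C1 * ?s) + norm b * (C2 * ?s)"
      by (intro add_mono mult_left_mono) auto
    moreover have "norm (lincomb a u b v f) \<le> norm a * norm (u f) + norm b * norm (v f)"
      unfolding lincomb_def by (rule order_trans[OF norm_triangle_ineq]) (simp add: norm_mult)
    ultimately show ?thesis by (simp add: algebra_simps)
  qed
  then have "\<exists>C N. \<forall>f\<in>schwartz. norm (lincomb a u b v f) \<le> C * schwartz_norm N f" by blast
  moreover have "\<forall>f. f \<notin> schwartz \<longrightarrow> lincomb a u b v f = 0" using u v by (simp add: tempered_def lincomb_def)
  moreover have "\<forall>f\<in>schwartz. \<forall>h\<in>schwartz. \<forall>c d. lincomb a u b v (\<lambda>x. c * f x + d * h x) = c * lincomb a u b v f + d * lincomb a u b v h"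
    using u v by (simp add: tempered_def lincomb_def algebra_simps)
  ultimately show ?thesis unfolding tempered_def by blast
qed

lemma stft_lincomb: "stft g (lincomb a u b v) z = a * stft g u z + b * stft g v z"
  by (cases z) (simp add: stft_def lincomb_def)

lemma fourier_dist_lincomb: "fourier_dist (lincomb a u b v) = lincomb a (fourier_dist u) b (fourier_dist v)"
  by (auto simp: fourier_dist_def lincomb_def)

lemma integrable_product_of_squares:
  fixes F G :: "'a \<Rightarrow> complex"
  assumes "integrable M (\<lambda>x. (norm (F x))\<^sup>2)" "integrable M (\<lambda>x. (norm (G x))\<^sup>2)"
    and "F \<in> borel_measurable M" "G \<in> borel_measurable M"
  shows "integrable M (\<lambda>x. F x * cnj (G x))"
proof (rule Bochner_Integration.integrable_bound)
  show "integrable M (\<lambda>x. (norm (F x))\<^sup>2 + (norm (G x))\<^sup>2)" using assms by simp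
  have "norm (F x * cnj (G x)) \<le> norm ((norm (F x))\<^sup>2 + (norm (G x))\<^sup>2)" for x
    using sum_squares_bound[of "norm (F x)" "norm (G x)"] mult_nonneg_nonneg[OF norm_ge_zero[of "F x"] norm_ge_zero[of "G x"]]
    unfolding norm_mult complex_mod_cnj real_norm_def by linarith
  then show "AE x in M. norm (F x * cnj (G x)) \<le> norm ((norm (F x))\<^sup>2 + (norm (G x))\<^sup>2)" by simp
  show "(\<lambda>x. F x * cnj (G x)) \<in> borel_measurable M"
    using assms by (intro borel_measurable_times measurable_compose[OF _ borel_measurable_cnj]) auto
qed

lemma integrable_square_lincomb:
  fixes F G :: "'a \<Rightarrow> complex"
  assumes "integrable M (\<lambda>x. (norm (F x))\<^sup>2)" "integrable M (\<lambda>x. (norm (G x))\<^sup>2)"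
    and [measurable]: "F \<in> borel_measurable M" "G \<in> borel_measurable M"
  shows "integrable M (\<lambda>x. (norm (a * F x + b * G x))\<^sup>2)"
proof (rule Bochner_Integration.integrable_bound)
  show "integrable M (\<lambda>x. 2 * ((norm a)\<^sup>2 * (norm (F x))\<^sup>2) + 2 * ((norm b)\<^sup>2 * (norm (G x))\<^sup>2))" using assms by simp
  have "(norm (a * F x + b * G x))\<^sup>2 \<le> 2 * ((norm a)\<^sup>2 * (norm (F x))\<^sup>2) + 2 * ((norm b)\<^sup>2 * (norm (G x))\<^sup>2)" for x
  proof -
    have "(norm (a * F x + b * G x))\<^sup>2 \<le> (norm (a * F x) + norm (b * G x))\<^sup>2"
      by (intro power_mono norm_triangle_ineq) auto
    also have "\<dots> \<le> 2 * (norm (a * F x))\<^sup>2 + 2 * (norm (b * G x))\<^sup>2"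
      using sum_squares_bound[of "norm (a * F x)" "norm (b * G x)"] by (simp add: power2_sum)
    finally show ?thesis by (simp add: norm_mult power_mult_distrib)
  qed
  then show "AE x in M. norm ((norm (a * F x + b * G x))\<^sup>2) \<le> norm (2 * ((norm a)\<^sup>2 * (norm (F x))\<^sup>2) + 2 * ((norm b)\<^sup>2 * (norm (G x))\<^sup>2))" by simp
qed measurable

section \<open>Forms given by multipliers\<close>

definition multiplier_form :: "('a::euclidean_space \<Rightarrow> complex) \<Rightarrow> 'a functional \<Rightarrow> 'a functional \<Rightarrow> complex" where
  "multiplier_form \<theta> u v = (\<integral>x. (norm (\<theta> x))\<^sup>2 * dist_fun u x * cnj (dist_fun v x) \<partial>lborel)"

text \<open>The alternative \<open>\<theta> = 0\<close> is needed: in that case the elements of the modulation space need not be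
  functions, while the form is zero for every choice of their pointwise values.\<close>

definition multiplier_domain :: "('a::euclidean_space \<Rightarrow> complex) \<Rightarrow> 'a functional set" where
  "multiplier_domain \<theta> = {u. (\<forall>x. \<theta> x = 0) \<or> (\<exists>h. represents h u) \<and> integrable lborel (\<lambda>x. (norm (\<theta> x * dist_fun u x))\<^sup>2)}"

lemma multiplier_form_hermitian: "multiplier_form \<theta> v u = cnj (multiplier_form \<theta> u v)"
  unfolding multiplier_form_def Bochner_Integration.integral_cnj[symmetric] by (simp add: mult_ac)

lemma multiplier_form_diag: "multiplier_form \<theta> u u = complex_of_real (\<integral>x. (norm (\<theta> x * dist_fun u x))\<^sup>2 \<partial>lborel)"
  unfolding multiplier_form_def integral_complex_of_real[symmetric]
  by (intro Bochner_Integration.integral_cong refl)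
    (simp add: norm_mult power_mult_distrib mult.assoc flip: complex_norm_square)

text \<open>The chosen pointwise values are linear only up to null sets, by uniqueness of representing
  functions; square integrability makes the integrals additive.\<close>

lemma multiplier_form_linear:
  assumes \<theta>: "continuous_on UNIV \<theta>" and u: "u \<in> multiplier_domain \<theta>" and v: "v \<in> multiplier_domain \<theta>" and w: "w \<in> multiplier_domain \<theta>"
  shows "multiplier_form \<theta> (lincomb a u b v) w = a * multiplier_form \<theta> u w + b * multiplier_form \<theta> v w"
proof (cases "\<forall>x. \<theta> x = 0")
  case True
  then show ?thesis by (simp add: multiplier_form_def)
next
  case False
  have [measurable]: "\<theta> \<in> borel_measurable borel" by (rule borel_measurable_continuous_onI[OF \<theta>])
  obtain h k l where r: "represents h u" "represents k v" "represents l w"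
    and i: "integrable lborel (\<lambda>x. (norm (\<theta> x * dist_fun u x))\<^sup>2)" "integrable lborel (\<lambda>x. (norm (\<theta> x * dist_fun v x))\<^sup>2)"
      "integrable lborel (\<lambda>x. (norm (\<theta> x * dist_fun w x))\<^sup>2)"
    using False u v w unfolding multiplier_domain_def by blast
  have m [measurable]: "dist_fun u \<in> borel_measurable borel" "dist_fun v \<in> borel_measurable borel" "dist_fun w \<in> borel_measurable borel"
    using r[THEN represents_dist_fun] by (auto simp: represents_def)
  have m' [measurable]: "dist_fun (lincomb a u b v) \<in> borel_measurable borel"
    using represents_dist_fun[OF represents_lincomb[OF r(1,2)]] by (auto simp: represents_def)
  have eq: "complex_of_real ((norm (\<theta> x))\<^sup>2) * p * cnj q = (\<theta> x * p) * cnj (\<theta> x * q)" for x p q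
    unfolding complex_norm_square by (simp add: mult_ac)
  have iu: "integrable lborel (\<lambda>x. complex_of_real ((norm (\<theta> x))\<^sup>2) * dist_fun u x * cnj (dist_fun w x))"
    and iv: "integrable lborel (\<lambda>x. complex_of_real ((norm (\<theta> x))\<^sup>2) * dist_fun v x * cnj (dist_fun w x))"
    unfolding eq by (intro integrable_product_of_squares i; measurable)+
  have "multiplier_form \<theta> (lincomb a u b v) w
    = (\<integral>x. a * (complex_of_real ((norm (\<theta> x))\<^sup>2) * dist_fun u x * cnj (dist_fun w x)) + b * (complex_of_real ((norm (\<theta> x))\<^sup>2) * dist_fun v x * cnj (dist_fun w x)) \<partial>lborel)"
    unfolding multiplier_form_def
  proof (rule integral_cong_AE)
    show "AE x in lborel. complex_of_real ((norm (\<theta> x))\<^sup>2) * dist_fun (lincomb a u b v) x * cnj (dist_fun w x)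
      = a * (complex_of_real ((norm (\<theta> x))\<^sup>2) * dist_fun u x * cnj (dist_fun w x)) + b * (complex_of_real ((norm (\<theta> x))\<^sup>2) * dist_fun v x * cnj (dist_fun w x))"
      using dist_fun_lincomb[OF r(1,2), of a b] by eventually_elim (simp add: algebra_simps)
  qed measurable
  also have "\<dots> = a * multiplier_form \<theta> u w + b * multiplier_form \<theta> v w"
    unfolding multiplier_form_def using iu iv by simp
  finally show ?thesis .
qed

section \<open>Forms on the modulation space\<close>

lemma assoc_weight_bounds:
  shows "\<bar>m0 (x, w)\<bar> \<le> assoc_weight m0 \<psi> \<phi> (x, w)"
    and "norm (\<psi> x) \<le> assoc_weight m0 \<psi> \<phi> (x, w)"
    and "norm (\<phi> w) \<le> assoc_weight m0 \<psi> \<phi> (x, w)"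
  unfolding assoc_weight_def by (auto intro!: real_le_rsqrt)

lemma phase_rotation_simps [simp]: "phase_rotation (a, b) = (- b, a)" "norm (phase_rotation z) = norm z"
  by (auto simp: phase_rotation_def norm_Pair split_beta norm_prod_def add.commute)

text \<open>Both statements are instances of \<open>weighted_representation\<close>, for \<open>m\<close> and for \<open>m\<close> composed with the
  rotation of phase space.\<close>

lemma mod_space_multiplier_domain:
  fixes g :: "'a::euclidean_space \<Rightarrow> complex"
  assumes g: "g \<in> schwartz" "g \<noteq> (\<lambda>_. 0)" and m: "m \<in> poly_moderate_weights"
    and \<theta>c: "continuous_on UNIV \<theta>" and u: "u \<in> mod_space g m"
  shows mod_space_position: "(\<And>x w. norm (\<theta> x) \<le> m (x, w)) \<Longrightarrow> u \<in> multiplier_domain \<theta>"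
    and mod_space_frequency: "(\<And>x w. norm (\<theta> w) \<le> m (x, w)) \<Longrightarrow> fourier_dist u \<in> multiplier_domain \<theta>"
proof -
  have mc: "continuous_on UNIV m" and mp: "\<And>z. m z > 0"
    using m by (auto simp: poly_moderate_weights_def weight_def)
  obtain C n where C: "C > 0" "\<And>x y. m (x + y) \<le> C * m x * (1 + norm y) ^ n"
    using poly_moderate_natE[OF m] by metis
  have ut: "u \<in> tempered" and ui: "integrable lborel (\<lambda>z. (norm (m z * stft g u z))\<^sup>2)"
    using u by (auto simp: mod_space_def)
  have Sm [measurable]: "stft g u \<in> borel_measurable borel" by (rule stft_measurable[OF g(1) ut])
  have [measurable]: "m \<in> borel_measurable borel" by (rule borel_measurable_continuous_onI[OF mc])
  have L2: "integrable lborel (\<lambda>z. (m z * norm (stft g u z))\<^sup>2)"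
    using ui mp by (simp add: norm_mult abs_of_pos)
  define N where "N = complex_of_real (\<integral>x. (norm (g x))\<^sup>2 \<partial>lborel)"
  have N: "N \<noteq> 0" using window_norm_pos[OF g] by (simp add: N_def)
  show "u \<in> multiplier_domain \<theta>" if \<theta>: "\<And>x w. norm (\<theta> x) \<le> m (x, w)"
  proof (cases "\<forall>x. \<theta> x = 0")
    case False
    then obtain x0 where x0: "\<theta> x0 \<noteq> 0" by blast
    have mod: "m (x + y, w) \<le> C * m (x, w) * (1 + norm y) ^ n" for x y w
      using C(2)[of "(x, w)" "(y, 0)"] by simp
    have rep: "N * u f = (\<integral>z. stft g u z * stft_dual g f z \<partial>lborel)" if "f \<in> schwartz" for f
      unfolding N_def by (rule stft_reproducing[OF ut that g(1)])
    show ?thesis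
      using weighted_representation[OF mc mp C(1) mod \<theta>c \<theta> x0 Sm stft_slow[OF g(1) ut] g(1) L2 N rep]
      by (simp add: multiplier_domain_def)
  qed (simp add: multiplier_domain_def)
  show "fourier_dist u \<in> multiplier_domain \<theta>" if \<theta>: "\<And>x w. norm (\<theta> w) \<le> m (x, w)"
  proof (cases "\<forall>x. \<theta> x = 0")
    case False
    then obtain x0 where x0: "\<theta> x0 \<noteq> 0" by blast
    let ?m = "\<lambda>z. m (phase_rotation z)"
    define U where "U z = stft g u (phase_rotation z) * cis (- 2 * pi * (snd z \<bullet> fst z))" for z
    have [measurable]: "(\<lambda>z::'a \<times> 'a. cis (- 2 * pi * (snd z \<bullet> fst z))) \<in> borel_measurable borel"
      by (intro borel_measurable_continuous_onI continuous_intros)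
    have Um [measurable]: "U \<in> borel_measurable borel" unfolding U_def by measurable
    have normU: "norm (U z) = norm (stft g u (phase_rotation z))" for z by (simp add: U_def norm_mult)
    have U: "slow U"
    proof -
      obtain c k where "\<And>z. norm (stft g u z) \<le> c * (1 + norm z) ^ k" using slowE[OF stft_slow[OF g(1) ut]] by metis
      then have "norm (U z) \<le> c * (1 + norm z) ^ k" for z unfolding normU by (metis phase_rotation_simps(2))
      then show ?thesis unfolding slow_def by blast
    qed
    have mc': "continuous_on UNIV ?m"
      by (rule continuous_on_compose2[OF mc phase_rotation_continuous]) simp
    have mod': "?m (x + y, w) \<le> C * ?m (x, w) * (1 + norm y) ^ n" for x y w
      using C(2)[of "(- w, x)" "(0, y)"] by simp
    have \<theta>': "norm (\<theta> x) \<le> ?m (x, w)" for x w using \<theta> by simp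
    have L2': "integrable lborel (\<lambda>z. (?m z * norm (U z))\<^sup>2)"
      unfolding normU using L2 by (subst integral_phase_rotation(2)[of "\<lambda>z. (m z * norm (stft g u z))\<^sup>2"]) auto
    have rep: "N * fourier_dist u f = (\<integral>z. U z * stft_dual (fourier g) f z \<partial>lborel)" if f: "f \<in> schwartz" for f
    proof -
      have [measurable]: "f \<in> borel_measurable borel" "g \<in> borel_measurable borel" using f g by measurable
      have [measurable]: "stft_dual g (fourier f) \<in> borel_measurable borel"
        by (intro stft_dual_measurable fourier_measurable) measurable
      have "N * fourier_dist u f = (\<integral>z. stft g u z * stft_dual g (fourier f) z \<partial>lborel)"
        unfolding N_def fourier_dist_def using stft_reproducing[OF ut fourier_schwartz[OF f] g(1)] f by simp
      also have "\<dots> = (\<integral>z. stft g u (phase_rotation z) * stft_dual g (fourier f) (phase_rotation z) \<partial>lborel)"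
        by (rule integral_phase_rotation(1)[symmetric]) measurable
      also have "\<dots> = (\<integral>z. U z * stft_dual (fourier g) f z \<partial>lborel)"
      proof (rule Bochner_Integration.integral_cong[OF refl])
        fix z :: "'a \<times> 'a"
        show "stft g u (phase_rotation z) * stft_dual g (fourier f) (phase_rotation z) = U z * stft_dual (fourier g) f z"
          by (cases z) (simp add: U_def stft_dual_fourier_rotation[OF f g(1)] mult.assoc)
      qed
      finally show ?thesis .
    qed
    show ?thesis
      using weighted_representation[OF mc' mp C(1) mod' \<theta>c \<theta>' x0 Um U fourier_schwartz[OF g(1)] L2' N rep]
      by (simp add: multiplier_domain_def)
  qed (simp add: multiplier_domain_def)
qed

lemma mod_space_lincomb:
  fixes g :: "'a::euclidean_space \<Rightarrow> complex"
  assumes g: "g \<in> schwartz" and mc: "continuous_on UNIV m"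
    and u: "u \<in> mod_space g m" and v: "v \<in> mod_space g m"
  shows "lincomb a u b v \<in> mod_space g m"
proof -
  have ut: "u \<in> tempered" "v \<in> tempered"
    and ui: "integrable lborel (\<lambda>z. (norm (m z * stft g u z))\<^sup>2)" "integrable lborel (\<lambda>z. (norm (m z * stft g v z))\<^sup>2)"
    using u v by (auto simp: mod_space_def)
  have [measurable]: "stft g u \<in> borel_measurable borel" "stft g v \<in> borel_measurable borel" "m \<in> borel_measurable borel"
    by (intro stft_measurable g ut borel_measurable_continuous_onI mc)+
  have "integrable lborel (\<lambda>z. (norm (a * (m z * stft g u z) + b * (m z * stft g v z)))\<^sup>2)"
    by (rule integrable_square_lincomb[OF ui]) measurable
  then show ?thesis
    using tempered_lincomb[OF ut] by (simp add: mod_space_def stft_lincomb algebra_simps)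
qed

lemma mod_space_mono:
  fixes g :: "'a::euclidean_space \<Rightarrow> complex"
  assumes g: "g \<in> schwartz" and m0c: "continuous_on UNIV m0" and le: "\<And>z. \<bar>m0 z\<bar> \<le> m z" and u: "u \<in> mod_space g m"
  shows "u \<in> mod_space g m0"
proof -
  have ut: "u \<in> tempered" and ui: "integrable lborel (\<lambda>z. (norm (m z * stft g u z))\<^sup>2)"
    using u by (auto simp: mod_space_def)
  have [measurable]: "stft g u \<in> borel_measurable borel" "m0 \<in> borel_measurable borel"
    by (intro stft_measurable g ut borel_measurable_continuous_onI m0c)+
  have "integrable lborel (\<lambda>z. (norm (m0 z * stft g u z))\<^sup>2)"
  proof (rule Bochner_Integration.integrable_bound[OF ui])
    have "(norm (m0 z * stft g u z))\<^sup>2 \<le> (norm (m z * stft g u z))\<^sup>2" for z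
      using le[of z] unfolding norm_mult norm_of_real by (intro power_mono mult_right_mono) auto
    then show "AE z in lborel. norm ((norm (m0 z * stft g u z))\<^sup>2) \<le> norm ((norm (m z * stft g u z))\<^sup>2)" by simp
  qed measurable
  then show ?thesis using ut by (simp add: mod_space_def)
qed

lemma mod_inner_alt:
  "mod_inner g \<mu> u v = (\<integral>z. (complex_of_real (\<mu> z) * stft g u z) * cnj (complex_of_real (\<mu> z) * stft g v z) \<partial>lborel)"
  unfolding mod_inner_def by (simp add: power2_eq_square mult_ac)

lemma mod_inner_hermitian: "mod_inner g \<mu> v u = cnj (mod_inner g \<mu> u v)"
  unfolding mod_inner_def Bochner_Integration.integral_cnj[symmetric] by (simp add: mult_ac)

lemma mod_inner_diag: "mod_inner g \<mu> u u = complex_of_real ((mod_norm g \<mu> u)\<^sup>2)"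
proof -
  have "mod_inner g \<mu> u u = (\<integral>z. complex_of_real ((norm (\<mu> z * stft g u z))\<^sup>2) \<partial>lborel)"
    unfolding mod_inner_alt complex_norm_square[symmetric] of_real_power ..
  also have "\<dots> = complex_of_real (\<integral>z. (norm (\<mu> z * stft g u z))\<^sup>2 \<partial>lborel)" by (rule integral_complex_of_real)
  finally show ?thesis unfolding mod_norm_def by simp
qed

lemma mod_inner_linear:
  fixes g :: "'a::euclidean_space \<Rightarrow> complex"
  assumes g: "g \<in> schwartz" and \<mu>: "continuous_on UNIV \<mu>"
    and u: "u \<in> mod_space g \<mu>" and v: "v \<in> mod_space g \<mu>" and w: "w \<in> mod_space g \<mu>"
  shows "mod_inner g \<mu> (lincomb a u b v) w = a * mod_inner g \<mu> u w + b * mod_inner g \<mu> v w"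
proof -
  have [measurable]: "\<mu> \<in> borel_measurable borel" by (rule borel_measurable_continuous_onI[OF \<mu>])
  have t: "u \<in> tempered" "v \<in> tempered" "w \<in> tempered"
    and i: "integrable lborel (\<lambda>z. (norm (\<mu> z * stft g u z))\<^sup>2)" "integrable lborel (\<lambda>z. (norm (\<mu> z * stft g v z))\<^sup>2)"
      "integrable lborel (\<lambda>z. (norm (\<mu> z * stft g w z))\<^sup>2)"
    using u v w by (auto simp: mod_space_def)
  have [measurable]: "stft g u \<in> borel_measurable borel" "stft g v \<in> borel_measurable borel" "stft g w \<in> borel_measurable borel"
    by (intro stft_measurable g t)+
  have iu: "integrable lborel (\<lambda>z. (\<mu> z * stft g u z) * cnj (\<mu> z * stft g w z))"
    by (rule integrable_product_of_squares[OF i(1,3)]) measurable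
  have iv: "integrable lborel (\<lambda>z. (\<mu> z * stft g v z) * cnj (\<mu> z * stft g w z))"
    by (rule integrable_product_of_squares[OF i(2,3)]) measurable
  have "mod_inner g \<mu> (lincomb a u b v) w
    = (\<integral>z. a * ((\<mu> z * stft g u z) * cnj (\<mu> z * stft g w z)) + b * ((\<mu> z * stft g v z) * cnj (\<mu> z * stft g w z)) \<partial>lborel)"
    unfolding mod_inner_alt by (intro Bochner_Integration.integral_cong refl) (simp add: stft_lincomb algebra_simps)
  also have "\<dots> = a * mod_inner g \<mu> u w + b * mod_inner g \<mu> v w"
    unfolding mod_inner_alt
    by (subst Bochner_Integration.integral_add[OF integrable_mult_right[OF iu] integrable_mult_right[OF iv]])
      (simp only: integral_mult_right_zero)
  finally show ?thesis .
qed

text \<open>A distribution whose short-time Fourier transform vanishes almost everywhere is zero, by the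
  reproducing formula.\<close>

lemma mod_inner_definite:
  fixes g :: "'a::euclidean_space \<Rightarrow> complex"
  assumes g: "g \<in> schwartz" "g \<noteq> (\<lambda>_. 0)" and \<mu>: "\<And>z. \<mu> z > 0"
    and u: "u \<in> mod_space g \<mu>" and z: "mod_inner g \<mu> u u = 0"
  shows "u = (\<lambda>_. 0)"
proof
  fix f
  have ut: "u \<in> tempered" and ui: "integrable lborel (\<lambda>z. (norm (\<mu> z * stft g u z))\<^sup>2)"
    using u by (auto simp: mod_space_def)
  show "u f = 0"
  proof (cases "f \<in> schwartz")
    case False
    then show ?thesis using ut by (simp add: tempered_def)
  next
    case True
    have "(\<integral>z. (norm (\<mu> z * stft g u z))\<^sup>2 \<partial>lborel) = 0"
      using z unfolding mod_inner_diag mod_norm_def by simp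
    then have "AE z in lborel. (norm (\<mu> z * stft g u z))\<^sup>2 = 0"
      using integral_nonneg_eq_0_iff_AE[OF ui] by simp
    then have "AE z in lborel. stft g u z * stft_dual g f z = 0"
    proof eventually_elim
      fix z assume "(norm (\<mu> z * stft g u z))\<^sup>2 = 0"
      then show "stft g u z * stft_dual g f z = 0" using \<mu>[of z] by simp
    qed
    then have "(\<integral>z. stft g u z * stft_dual g f z \<partial>lborel) = 0" by (rule integral_eq_zero_AE)
    then show ?thesis
      using stft_reproducing[OF ut True g(1)] window_norm_pos[OF g] by simp
  qed
qed

lemma conf_inner_eq:
  "conf_inner g \<psi> \<phi> m0 u v = mod_inner g m0 u v + multiplier_form \<psi> u v + multiplier_form \<phi> (fourier_dist u) (fourier_dist v)"
  by (simp add: conf_inner_def multiplier_form_def)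

lemma conf_inner_diag:
  "conf_inner g \<psi> \<phi> m0 u u = mod_inner g m0 u u + complex_of_real (confinement \<psi> \<phi> u)"
  unfolding conf_inner_eq multiplier_form_diag confinement_def by simp

section \<open>The eigenvalue problem\<close>

theorem theorem17:
  fixes m0 :: "(real^'d) \<times> (real^'d) \<Rightarrow> real"
    and \<psi> \<phi> g :: "real^'d \<Rightarrow> complex"
    and A :: "(real^'d) functional \<Rightarrow> (real^'d) functional"
    and f0 :: "(real^'d) functional"
  defines "M \<equiv> mod_space g (assoc_weight m0 \<psi> \<phi>)"
  assumes "g \<in> schwartz" and "g \<noteq> (\<lambda>_. 0)"
    and "m0 \<in> poly_moderate_weights"
    and "admissible_weights m0 \<psi> \<phi>"
    and "riesz_operator g \<psi> \<phi> m0 A"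
    and "is_arg_min (confinement \<psi> \<phi>) (\<lambda>f. f \<in> M \<and> mod_norm g m0 f = 1) f0"
  shows "eigenvector (A ` M) (inv_into M A) (complex_of_real (confinement \<psi> \<phi> f0 + 1)) f0 \<and>
    (\<forall>\<mu>. eigenvalue (A ` M) (inv_into M A) \<mu> \<longrightarrow>
      \<mu> \<in> \<real> \<and> confinement \<psi> \<phi> f0 + 1 \<le> Re \<mu>)"
proof (rule minimizer_is_ground_state[where P = "mod_inner g m0" and Q = "conf_inner g \<psi> \<phi> m0"])
  let ?m = "assoc_weight m0 \<psi> \<phi>"
  note g = assms(2,3)
  have m0: "continuous_on UNIV m0" "\<And>z. m0 z > 0"
    using assms(4) by (auto simp: poly_moderate_weights_def weight_def)
  have m: "?m \<in> poly_moderate_weights" and \<psi>: "continuous_on UNIV \<psi>" and \<phi>: "continuous_on UNIV \<phi>"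
    using assms(5) by (auto simp: admissible_weights_def)
  have mc: "continuous_on UNIV ?m"
    using m by (simp add: poly_moderate_weights_def weight_def)
  have le: "\<bar>m0 z\<bar> \<le> ?m z" for z using assoc_weight_bounds(1)[of m0 "fst z" "snd z"] by simp
  have M0: "u \<in> mod_space g m0" if "u \<in> M" for u
    using mod_space_mono[OF g(1) m0(1) le] that by (simp add: M_def)
  have Mpos: "u \<in> multiplier_domain \<psi>" and Mfreq: "fourier_dist u \<in> multiplier_domain \<phi>" if "u \<in> M" for u
    using mod_space_position[OF g m \<psi> that[unfolded M_def] assoc_weight_bounds(2)]
      mod_space_frequency[OF g m \<phi> that[unfolded M_def] assoc_weight_bounds(3)] by auto
  have norm1: "mod_norm g m0 u = 1 \<longleftrightarrow> mod_inner g m0 u u = 1" for u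
  proof -
    have "mod_norm g m0 u \<ge> 0" by (simp add: mod_norm_def)
    then show ?thesis unfolding mod_inner_diag by (simp add: power2_eq_1_iff flip: of_real_power)
  qed
  show "lincomb a u b v \<in> M" if "u \<in> M" "v \<in> M" for u v a b
    using mod_space_lincomb[OF g(1) mc] that by (simp add: M_def)
  show lin: "mod_inner g m0 (lincomb a u b v) w = a * mod_inner g m0 u w + b * mod_inner g m0 v w" if "u \<in> M" "v \<in> M" "w \<in> M" for u v w a b
    by (rule mod_inner_linear[OF g(1) m0(1) M0[OF that(1)] M0[OF that(2)] M0[OF that(3)]])
  show "mod_inner g m0 v u = cnj (mod_inner g m0 u v)" for u v by (rule mod_inner_hermitian)
  show "conf_inner g \<psi> \<phi> m0 (lincomb a u b v) w = a * conf_inner g \<psi> \<phi> m0 u w + b * conf_inner g \<psi> \<phi> m0 v w"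
    if "u \<in> M" "v \<in> M" "w \<in> M" for u v w a b
    unfolding conf_inner_eq lin[OF that] fourier_dist_lincomb
      multiplier_form_linear[OF \<psi> Mpos[OF that(1)] Mpos[OF that(2)] Mpos[OF that(3)]]
      multiplier_form_linear[OF \<phi> Mfreq[OF that(1)] Mfreq[OF that(2)] Mfreq[OF that(3)]]
    by (simp add: algebra_simps)
  show "conf_inner g \<psi> \<phi> m0 v u = cnj (conf_inner g \<psi> \<phi> m0 u v)" for u v
    unfolding conf_inner_eq complex_cnj_add
    by (simp only: mod_inner_hermitian[of g m0 v u] multiplier_form_hermitian[of _ v u]
        multiplier_form_hermitian[of _ "fourier_dist v" "fourier_dist u"])
  show "conf_inner g \<psi> \<phi> m0 u u = mod_inner g m0 u u + complex_of_real (confinement \<psi> \<phi> u)" for u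
    by (rule conf_inner_diag)
  show "confinement \<psi> \<phi> u \<ge> 0" for u by (simp add: confinement_def)
  show "Re (mod_inner g m0 u u) \<ge> 0" for u unfolding mod_inner_diag by simp
  show "u = (\<lambda>_. 0)" if "u \<in> M" "mod_inner g m0 u u = 0" for u
    by (rule mod_inner_definite[OF g m0(2) M0[OF that(1)] that(2)])
  show "A u \<in> M" if "u \<in> M" for u
    using assms(6) that unfolding riesz_operator_def Let_def M_def by blast
  show "A (lincomb a u b v) = lincomb a (A u) b (A v)" if "u \<in> M" "v \<in> M" for u v a b
    using assms(6) that unfolding riesz_operator_def Let_def M_def by blast
  show "mod_inner g m0 u v = conf_inner g \<psi> \<phi> m0 (A u) v" if "u \<in> M" "v \<in> M" for u v
    using assms(6) that unfolding riesz_operator_def Let_def M_def by blast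
  show "f0 \<in> M" "mod_inner g m0 f0 f0 = 1"
    using assms(7) unfolding is_arg_min_def norm1 by auto
  show "confinement \<psi> \<phi> f0 \<le> confinement \<psi> \<phi> f" if "f \<in> M" "mod_inner g m0 f f = 1" for f
    using assms(7) that unfolding is_arg_min_def norm1 by (auto simp: not_less)
qed

end
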